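(* Let $T>0$ and let $u\in W^{4,\infty}((0,T)\times\Omega)$ be a solution of the Kuramoto-Sivashinsky equation $$\partial_tu+\partial_x\frac{u^2}{2}+\partial_x^2u+\partial_x^4u=0\quad\text{in }(0,T)\times\Omega$$ with initial data $u|_{t=0}=u_0\in W^{4,\infty}(\Omega)$. For each $\tau>0$, let $q=(q_0,q_1,q_2,q_3)$ (depending on $\tau$) be an entropy solution on $(0,T)\times\Omega$ of the system $$\begin{aligned} \partial_tq_0+\partial_x(q_0^2/2)+q_2+\partial_xq_3&=0,\\ \tau\,\partial_tq_1-(\partial_xq_2-q_3)&=0,\\ \tau\,\partial_tq_2-(\partial_xq_1-q_2)&=0,\\ \tau\,\partial_tq_3+(\partial_xq_0-q_1)&=0, \end{aligned}$$ with initial data $q|_{t=0}=(u_0,\partial_xu_0,\partial_x^2u_0,\partial_x^3u_0)$. Then, as $\tau\to0$, $$\|u-q_0\|_{L^\infty(0,T;L^2(\Omega))}+\sum_{j=1}^{3}\sqrt{\tau}\,\|\partial_x^ju-q_j\|_{L^\infty(0,T;L^2(\Omega))}=\mathcal{O}(\tau).$$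
   Context: $\Omega$ is a bounded one-dimensional interval with periodic boundary conditions (endpoints identified); all function spaces on $\Omega$ and $(0,T)\times\Omega$ are understood as spaces of functions periodic in $x$. $\mathcal{O}(\tau)$ means: there are $C>0$ and $\tau_0>0$, independent of $\tau$ (but possibly depending on $u$, $T$, $\Omega$), such that the quantity is at most $C\tau$ for all $\tau\in(0,\tau_0]$. Entropy solution: the energy density, energy flux and energy source are $$e(q)=\tfrac12 q_0^2+\tfrac{\tau}{2}\sum_{j=1}^{3}q_j^2,\qquad G(q)=\tfrac13q_0^3+q_0q_3-q_1q_2,\qquad S(q)=-q_0q_2-q_2^2,$$ and smooth solutions satisfy $\partial_t e(q)+\partial_x G(q)=S(q)$. An entropy solution with initial data $q^{\mathrm{in}}$ is a function $q\in L^\infty((0,T)\times\Omega)^4$ that satisfies the system with initial data $q^{\mathrm{in}}$ in the sense of distributions (weak form with test functions in $C_c^\infty([0,T)\times\Omega)$, including the initial term) and the energy inequality $$\int_0^T\!\!\int_\Omega \bigl(e(q)\,\partial_t\varphi+G(q)\,\partial_x\varphi+S(q)\,\varphi\bigr)\,dx\,dt+\int_\Omega e(q^{\mathrm{in}})\,\varphi(0,\cdot)\,dx\ \ge 0$$ for all nonnegative $\varphi\in C_c^\infty([0,T)\times\Omega)$. *)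

theory Defs
  imports "HOL-Analysis.Analysis" "HOL-Probability.Essential_Supremum"
begin

text \<open>
  Conventions. The domain \<open>\<Omega>\<close> is the interval from \<open>a\<close> to \<open>b\<close> with identified endpoints.
  A function on \<open>\<Omega>\<close> is a function on \<open>\<real>\<close> of period \<open>b - a\<close>; a function on \<open>(0,T) \<times> \<Omega>\<close> is a
  function of pairs \<open>(t,x)\<close> that has period \<open>b - a\<close> in \<open>x\<close>, and its values for \<open>t \<notin> (0,T)\<close> are
  irrelevant. Elements of \<open>L\<^sup>\<infinity>\<close> are given by Borel measurable representatives. Integrals
  over \<open>\<Omega>\<close> are taken over one period, that is, over \<open>(a,b)\<close>.
\<close>

section \<open>Smooth functions and test functions\<close>

primrec C_k :: "nat \<Rightarrow> ('a::euclidean_space \<Rightarrow> 'b::real_normed_vector) \<Rightarrow> bool" where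
  "C_k 0 f \<longleftrightarrow> continuous_on UNIV f"
| "C_k (Suc k) f \<longleftrightarrow>
     f differentiable_on UNIV \<and> (\<forall>v. C_k k (\<lambda>z. frechet_derivative f (at z) v))"

definition smooth :: "('a::euclidean_space \<Rightarrow> 'b::real_normed_vector) \<Rightarrow> bool" where
  "smooth f \<longleftrightarrow> (\<forall>k. C_k k f)"

definition dt :: "(real \<times> real \<Rightarrow> real) \<Rightarrow> real \<times> real \<Rightarrow> real" where
  "dt \<phi> z = frechet_derivative \<phi> (at z) (1, 0)"

definition dx :: "(real \<times> real \<Rightarrow> real) \<Rightarrow> real \<times> real \<Rightarrow> real" where
  "dx \<phi> z = frechet_derivative \<phi> (at z) (0, 1)"

definition test_space :: "real \<Rightarrow> real \<Rightarrow> (real \<Rightarrow> real) set" where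
  "test_space a b = {\<phi>. smooth \<phi> \<and> (\<forall>x. \<phi> (x + (b - a)) = \<phi> x)}"

text \<open>
  \<open>C\<^sub>c\<^sup>\<infinity>([0,T) \<times> \<Omega>)\<close>: a function that is smooth up to \<open>t = 0\<close> is the restriction of a smooth
  function on all of \<open>\<real> \<times> \<Omega>\<close> (Seeley extension), and the values for \<open>t < 0\<close> are never used.
  Compact support in \<open>[0,T) \<times> \<Omega>\<close> means vanishing near \<open>t = T\<close>, since \<open>\<Omega>\<close> is compact.
\<close>
definition test_init :: "real \<Rightarrow> real \<Rightarrow> real \<Rightarrow> (real \<times> real \<Rightarrow> real) set" where
  "test_init T a b = {\<phi>. smooth \<phi> \<and> (\<forall>t x. \<phi> (t, x + (b - a)) = \<phi> (t, x)) \<and>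
     (\<exists>s<T. \<forall>t\<ge>s. \<forall>x. \<phi> (t, x) = 0)}"

text \<open>\<open>C\<^sub>c\<^sup>\<infinity>((0,T) \<times> \<Omega>)\<close>\<close>
definition test_interior :: "real \<Rightarrow> real \<Rightarrow> real \<Rightarrow> (real \<times> real \<Rightarrow> real) set" where
  "test_interior T a b = {\<phi> \<in> test_init T a b. \<exists>r>0. \<forall>t\<le>r. \<forall>x. \<phi> (t, x) = 0}"

section \<open>Function spaces on \<open>\<Omega>\<close>\<close>

definition Linf_space :: "real \<Rightarrow> real \<Rightarrow> (real \<Rightarrow> real) set" where
  "Linf_space a b = {f. f \<in> borel_measurable borel \<and> (\<forall>x. f (x + (b - a)) = f x) \<and>
     (\<exists>M. AE x in lborel. \<bar>f x\<bar> \<le> M)}"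

definition weak_deriv_space ::
    "real \<Rightarrow> real \<Rightarrow> nat \<Rightarrow> (real \<Rightarrow> real) \<Rightarrow> (real \<Rightarrow> real) \<Rightarrow> bool" where
  "weak_deriv_space a b j f g \<longleftrightarrow> g \<in> Linf_space a b \<and>
     (\<forall>\<phi>\<in>test_space a b.
        (LINT x:{a<..<b}|lborel. f x * (deriv ^^ j) \<phi> x) =
        (-1) ^ j * (LINT x:{a<..<b}|lborel. g x * \<phi> x))"

definition Winf_space :: "real \<Rightarrow> real \<Rightarrow> nat \<Rightarrow> (real \<Rightarrow> real) set" where
  "Winf_space a b k = {f \<in> Linf_space a b. \<forall>j\<le>k. \<exists>g. weak_deriv_space a b j f g}"

text \<open>The weak derivative is unique up to null sets; we choose a representative.\<close>
definition D_space :: "real \<Rightarrow> real \<Rightarrow> nat \<Rightarrow> (real \<Rightarrow> real) \<Rightarrow> real \<Rightarrow> real" where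
  "D_space a b j f = (SOME g. weak_deriv_space a b j f g)"

section \<open>Function spaces on \<open>(0,T) \<times> \<Omega>\<close>\<close>

definition Linf :: "real \<Rightarrow> real \<Rightarrow> real \<Rightarrow> (real \<times> real \<Rightarrow> real) set" where
  "Linf T a b = {f. set_borel_measurable lborel ({0<..<T} \<times> UNIV) f \<and>
     (\<forall>t\<in>{0<..<T}. \<forall>x. f (t, x + (b - a)) = f (t, x)) \<and>
     (\<exists>M. AE z in lborel. z \<in> {0<..<T} \<times> UNIV \<longrightarrow> \<bar>f z\<bar> \<le> M)}"

text \<open>\<open>g\<close> is the weak derivative \<open>\<partial>\<^sub>t\<^sup>i \<partial>\<^sub>x\<^sup>j f\<close>, and it is essentially bounded.\<close>
definition weak_deriv :: "real \<Rightarrow> real \<Rightarrow> real \<Rightarrow> nat \<Rightarrow> nat \<Rightarrow>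
    (real \<times> real \<Rightarrow> real) \<Rightarrow> (real \<times> real \<Rightarrow> real) \<Rightarrow> bool" where
  "weak_deriv T a b i j f g \<longleftrightarrow> g \<in> Linf T a b \<and>
     (\<forall>\<phi>\<in>test_interior T a b.
        (LINT z:{0<..<T} \<times> {a<..<b}|lborel. f z * (dt ^^ i) ((dx ^^ j) \<phi>) z) =
        (-1) ^ (i + j) * (LINT z:{0<..<T} \<times> {a<..<b}|lborel. g z * \<phi> z))"

definition Winf :: "real \<Rightarrow> real \<Rightarrow> real \<Rightarrow> nat \<Rightarrow> (real \<times> real \<Rightarrow> real) set" where
  "Winf T a b k = {f \<in> Linf T a b. \<forall>i j. i + j \<le> k \<longrightarrow> (\<exists>g. weak_deriv T a b i j f g)}"

definition D :: "real \<Rightarrow> real \<Rightarrow> real \<Rightarrow> nat \<Rightarrow> nat \<Rightarrow>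
    (real \<times> real \<Rightarrow> real) \<Rightarrow> real \<times> real \<Rightarrow> real" where
  "D T a b i j f = (SOME g. weak_deriv T a b i j f g)"

text \<open>
  Functions in \<open>W\<^sup>1\<^sup>,\<^sup>\<infinity>\<close> have a representative that is continuous up to \<open>t = 0\<close>, and the initial
  value is that of this representative.
\<close>
definition has_initial_value ::
    "real \<Rightarrow> (real \<times> real \<Rightarrow> real) \<Rightarrow> (real \<Rightarrow> real) \<Rightarrow> bool" where
  "has_initial_value T u u0 \<longleftrightarrow> (\<exists>w. continuous_on ({0..<T} \<times> UNIV) w \<and>
     (AE z in lborel. z \<in> {0<..<T} \<times> UNIV \<longrightarrow> w z = u z) \<and>
     (AE x in lborel. w (0, x) = u0 x))"

definition L2_norm :: "real \<Rightarrow> real \<Rightarrow> (real \<Rightarrow> real) \<Rightarrow> ennreal" where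
  "L2_norm a b f = (let I = (\<integral>\<^sup>+ x\<in>{a<..<b}. ennreal ((f x)\<^sup>2) \<partial>lborel)
     in if I = \<infinity> then \<infinity> else ennreal (sqrt (enn2real I)))"

definition Linf_L2_norm :: "real \<Rightarrow> real \<Rightarrow> real \<Rightarrow> (real \<times> real \<Rightarrow> real) \<Rightarrow> ennreal" where
  "Linf_L2_norm T a b f =
     esssup (restrict_space lborel {0<..<T}) (\<lambda>t. L2_norm a b (\<lambda>x. f (t, x)))"

section \<open>The Kuramoto-Sivashinsky equation\<close>

definition KS_solution :: "real \<Rightarrow> real \<Rightarrow> real \<Rightarrow> (real \<times> real \<Rightarrow> real) \<Rightarrow> bool" where
  "KS_solution T a b u \<longleftrightarrow> (AE z in lborel. z \<in> {0<..<T} \<times> UNIV \<longrightarrow>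
     D T a b 1 0 u z + D T a b 0 1 (\<lambda>z. (u z)\<^sup>2 / 2) z + D T a b 0 2 u z + D T a b 0 4 u z = 0)"

section \<open>The hyperbolic system; states are \<open>p 0, p 1, p 2, p 3\<close>\<close>

definition energy :: "real \<Rightarrow> (nat \<Rightarrow> real) \<Rightarrow> real" where
  "energy \<tau> p = (p 0)\<^sup>2 / 2 + \<tau> / 2 * (\<Sum>j=1..3. (p j)\<^sup>2)"

definition energy_flux :: "(nat \<Rightarrow> real) \<Rightarrow> real" where
  "energy_flux p = (p 0) ^ 3 / 3 + p 0 * p 3 - p 1 * p 2"

definition energy_source :: "(nat \<Rightarrow> real) \<Rightarrow> real" where
  "energy_source p = - p 0 * p 2 - (p 2)\<^sup>2"

text \<open>
  Weak form of \<open>\<partial>\<^sub>t A + \<partial>\<^sub>x B + R = 0\<close> with initial value \<open>A0\<close> for \<open>A\<close>.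
\<close>
definition weak_balance :: "real \<Rightarrow> real \<Rightarrow> real \<Rightarrow> (real \<times> real \<Rightarrow> real) \<Rightarrow>
    (real \<times> real \<Rightarrow> real) \<Rightarrow> (real \<times> real \<Rightarrow> real) \<Rightarrow> (real \<Rightarrow> real) \<Rightarrow> bool" where
  "weak_balance T a b A B R A0 \<longleftrightarrow> (\<forall>\<phi>\<in>test_init T a b.
     (LINT z:{0<..<T} \<times> {a<..<b}|lborel. A z * dt \<phi> z + B z * dx \<phi> z - R z * \<phi> z) +
     (LINT x:{a<..<b}|lborel. A0 x * \<phi> (0, x)) = 0)"

definition weak_solution :: "real \<Rightarrow> real \<Rightarrow> real \<Rightarrow> real \<Rightarrow>
    (real \<times> real \<Rightarrow> nat \<Rightarrow> real) \<Rightarrow> (real \<Rightarrow> nat \<Rightarrow> real) \<Rightarrow> bool" where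
  "weak_solution \<tau> T a b q qin \<longleftrightarrow>
     weak_balance T a b (\<lambda>z. q z 0) (\<lambda>z. (q z 0)\<^sup>2 / 2 + q z 3) (\<lambda>z. q z 2) (\<lambda>x. qin x 0) \<and>
     weak_balance T a b (\<lambda>z. \<tau> * q z 1) (\<lambda>z. - q z 2) (\<lambda>z. q z 3) (\<lambda>x. \<tau> * qin x 1) \<and>
     weak_balance T a b (\<lambda>z. \<tau> * q z 2) (\<lambda>z. - q z 1) (\<lambda>z. q z 2) (\<lambda>x. \<tau> * qin x 2) \<and>
     weak_balance T a b (\<lambda>z. \<tau> * q z 3) (\<lambda>z. q z 0) (\<lambda>z. - q z 1) (\<lambda>x. \<tau> * qin x 3)"

definition energy_inequality :: "real \<Rightarrow> real \<Rightarrow> real \<Rightarrow> real \<Rightarrow>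
    (real \<times> real \<Rightarrow> nat \<Rightarrow> real) \<Rightarrow> (real \<Rightarrow> nat \<Rightarrow> real) \<Rightarrow> bool" where
  "energy_inequality \<tau> T a b q qin \<longleftrightarrow>
     (\<forall>\<phi>\<in>test_init T a b. (\<forall>t\<in>{0..<T}. \<forall>x. \<phi> (t, x) \<ge> 0) \<longrightarrow>
        (LINT z:{0<..<T} \<times> {a<..<b}|lborel. energy \<tau> (q z) * dt \<phi> z
            + energy_flux (q z) * dx \<phi> z + energy_source (q z) * \<phi> z) +
        (LINT x:{a<..<b}|lborel. energy \<tau> (qin x) * \<phi> (0, x)) \<ge> 0)"

definition entropy_solution :: "real \<Rightarrow> real \<Rightarrow> real \<Rightarrow> real \<Rightarrow>
    (real \<times> real \<Rightarrow> nat \<Rightarrow> real) \<Rightarrow> (real \<Rightarrow> nat \<Rightarrow> real) \<Rightarrow> bool" where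
  "entropy_solution \<tau> T a b q qin \<longleftrightarrow>
     (\<forall>j\<in>{0..3}. (\<lambda>z. q z j) \<in> Linf T a b) \<and>
     weak_solution \<tau> T a b q qin \<and> energy_inequality \<tau> T a b q qin"

end

theory Submission
  imports Defs
begin

text \<open>
  Relative energy method with a corrected ansatz. Let \<open>p\<^sub>0 = u - \<tau> u\<^bsub>txx\<^esub>\<close>, \<open>p\<^sub>1 = u\<^bsub>x\<^esub>\<close>,
  \<open>p\<^sub>2 = u\<^bsub>xx\<^esub> + \<tau> u\<^bsub>t\<^esub>\<close>, \<open>p\<^sub>3 = u\<^bsub>xxx\<^esub>\<close>. Then \<open>p\<close> satisfies the second and the fourth equation of the
  hyperbolic system exactly, and the first and the third one up to \<open>\<O>(\<tau>)\<close>; only derivatives of \<open>u\<close>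
  of order at most four occur. The third equation is damped, so its residual can be absorbed, and the
  relative energy \<open>e(q - p)\<close> obeys a Gronwall inequality with source \<open>\<O>(\<tau>\<^sup>2)\<close> and initial value
  \<open>\<O>(\<tau>\<^sup>2)\<close>. The uncorrected ansatz \<open>p\<^sub>j = \<partial>\<^sub>x\<^sup>j u\<close> would only give \<open>\<O>(\<surd>\<tau>)\<close>.

  Since \<open>p\<close> must serve as a test function, \<open>u\<close> is replaced by a mollification \<open>U\<close> with a kernel that looks
  forward in time and is periodic in space. Its derivatives up to order three converge uniformly: this
  holds for \<open>U\<close> because \<open>u\<close> has a continuous representative, and it passes to the derivatives by the
  interpolation inequality \<open>|g'| \<le> 2 |g|/h + h |g''|\<close>.
\<close>

section \<open>Calculus of smooth functions\<close>

text \<open>The corrections are antiderivatives in space. With \<open>p3 = u_xxx\<close> the fourth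
  equation requires \<open>(p0)_x = p1 - \<tau> (p3)_t\<close>, which
  \<open>p0 = u - \<tau> u_txx\<close> solves; in the same way the second equation forces the term
  \<open>\<tau> u_t\<close> in \<open>p2\<close>. Without them both equations keep residuals of size
  \<open>\<tau>\<close>. Neither is damped, and the energy weighs the errors in \<open>q1\<close>
  and \<open>q3\<close> only by \<open>\<tau>\<close>, so Young's inequality would turn these
  residuals into a source of size \<open>\<tau>\<close> instead of its square. An entropy solution
  need not have values at single times. Gronwall's argument is therefore run in dual form: an
  explicit decreasing weight in time is tested against the inequality, and the bound comes out on
  time intervals, proportional to their length. The mollification is not sent to a limit in the
  energy estimate: for each \<open>\<tau>\<close> it is so fine that its errors are at most
  \<open>\<tau>\<close>. Its derivatives up to order four inherit the bound \<open>M\<close> of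
  those of \<open>u\<close>, so the constants depend neither on \<open>\<tau>\<close> nor on the
  kernel. A forward kernel needs room before time \<open>T\<close>; all estimates hold up to
  \<open>T1 < T\<close> with constants independent of \<open>T1\<close>.\<close>

lemma smooth_coinduct:
  assumes "P f"
    and step: "\<And>g. P g \<Longrightarrow> g differentiable_on UNIV \<and> (\<forall>v. P (\<lambda>z. frechet_derivative g (at z) v))"
  shows "smooth f"
proof -
  \<comment> \<open>All members of the class are treated at once, since differentiating one member
    yields another.\<close>
  have "\<forall>g. P g \<longrightarrow> C_k k g" for k
  proof (induction k)
    case 0
    then show ?case using step differentiable_imp_continuous_on by auto
  next
    case (Suc k)
    then show ?case using step by auto
  qed
  with \<open>P f\<close> show ?thesis by (auto simp: smooth_def)
qed

lemma smooth_differentiable: "smooth f \<Longrightarrow> f differentiable (at z)"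
  unfolding smooth_def using C_k.simps(2)[of 0 f] by (auto simp: differentiable_on_def)

lemma smooth_has_derivative: "smooth f \<Longrightarrow> (f has_derivative frechet_derivative f (at z)) (at z)"
  using smooth_differentiable frechet_derivative_works by blast

lemma smooth_frechet: "smooth f \<Longrightarrow> smooth (\<lambda>z. frechet_derivative f (at z) v)"
  unfolding smooth_def using C_k.simps(2) by metis

lemma smooth_continuous: "smooth f \<Longrightarrow> continuous_on S f"
  unfolding smooth_def using C_k.simps(1)[of f] continuous_on_subset by blast

lemma smooth_continuous_compose:
  "smooth f \<Longrightarrow> continuous_on S g \<Longrightarrow> continuous_on S (\<lambda>x. f (g x))"
  by (rule continuous_on_compose2[OF smooth_continuous[where S = UNIV]]) auto

lemma frechet_eq:
  assumes "(f has_derivative f') (at z)"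
  shows "frechet_derivative f (at z) = f'"
  using assms frechet_derivative_at by blast

lemma smoothI:
  assumes "\<And>z. (f has_derivative f' z) (at z)" and "\<And>v. smooth (\<lambda>z. f' z v)"
  shows "smooth f"
proof -
  have "\<And>z. frechet_derivative f (at z) = f' z" using assms(1) frechet_eq by blast
  then have "C_k k f" for k
    using assms by (cases k)
      (auto simp: smooth_def differentiable_on_def intro!: differentiableI
        continuous_at_imp_continuous_on has_derivative_continuous)
  then show ?thesis by (simp add: smooth_def)
qed

lemma smooth_const [simp, intro]: "smooth (\<lambda>_. c)"
  by (rule smooth_coinduct[where P = "\<lambda>f. \<exists>c. f = (\<lambda>_. c)"]) auto

lemma smooth_bounded_linear:
  assumes "bounded_linear f" shows "smooth f"
proof (rule smoothI)
  show "(f has_derivative f) (at z)" for z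
    using assms bounded_linear_imp_has_derivative by blast
qed auto

lemmas smooth_fst [simp, intro] = smooth_bounded_linear[OF bounded_linear_fst]
lemmas smooth_snd [simp, intro] = smooth_bounded_linear[OF bounded_linear_snd]
lemmas smooth_ident [simp, intro] = smooth_bounded_linear[OF bounded_linear_ident]

lemma C_k_Suc_imp: "C_k (Suc k) f \<Longrightarrow> C_k k f"
proof (induction k arbitrary: f)
  case 0
  then show ?case using differentiable_imp_continuous_on by auto
next
  case (Suc k)
  then show ?case by (metis C_k.simps(2))
qed

lemma C_k_add: "C_k k f \<Longrightarrow> C_k k g \<Longrightarrow> C_k k (\<lambda>z. f z + g z)"
proof (induction k arbitrary: f g)
  case (Suc k)
  have d: "((\<lambda>z. f z + g z) has_derivative
      (\<lambda>v. frechet_derivative f (at z) v + frechet_derivative g (at z) v)) (at z)" for z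
    using Suc.prems by (intro has_derivative_add)
      (auto simp: differentiable_on_def frechet_derivative_works)
  show ?case
    using Suc d by (auto simp: frechet_eq[OF d] differentiable_on_def intro!: differentiableI)
qed (auto intro!: continuous_intros)

text \<open>At order \<open>Suc k\<close> the product rule also contains the undifferentiated
  factors, which \<open>C_k_Suc_imp\<close> supplies at order \<open>k\<close>.\<close>

lemma C_k_mult:
  fixes f g :: "'a::euclidean_space \<Rightarrow> real"
  shows "C_k k f \<Longrightarrow> C_k k g \<Longrightarrow> C_k k (\<lambda>z. f z * g z)"
proof (induction k arbitrary: f g)
  case (Suc k)
  have d: "((\<lambda>z. f z * g z) has_derivative
      (\<lambda>v. f z * frechet_derivative g (at z) v + frechet_derivative f (at z) v * g z)) (at z)" for z
    using Suc.prems by (intro has_derivative_mult)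
      (auto simp: differentiable_on_def frechet_derivative_works)
  show ?case
    using Suc d C_k_Suc_imp[of k f] C_k_Suc_imp[of k g]
    by (auto simp: frechet_eq[OF d] differentiable_on_def intro!: differentiableI C_k_add)
qed (auto intro!: continuous_intros)

lemma smooth_add [intro]: "smooth f \<Longrightarrow> smooth g \<Longrightarrow> smooth (\<lambda>z. f z + g z)"
  by (simp add: smooth_def C_k_add)

lemma smooth_mult [intro]:
  fixes f g :: "'a::euclidean_space \<Rightarrow> real"
  shows "smooth f \<Longrightarrow> smooth g \<Longrightarrow> smooth (\<lambda>z. f z * g z)"
  by (simp add: smooth_def C_k_mult)

lemma smooth_cmult [intro]:
  fixes f :: "'a::euclidean_space \<Rightarrow> real"
  shows "smooth f \<Longrightarrow> smooth (\<lambda>z. c * f z)"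
  by (intro smooth_mult smooth_const)

lemma smooth_uminus [intro]:
  fixes f :: "'a::euclidean_space \<Rightarrow> real"
  shows "smooth f \<Longrightarrow> smooth (\<lambda>z. - f z)"
  using smooth_cmult[of f "-1"] by simp

lemma smooth_diff [intro]:
  fixes f g :: "'a::euclidean_space \<Rightarrow> real"
  shows "smooth f \<Longrightarrow> smooth g \<Longrightarrow> smooth (\<lambda>z. f z - g z)"
  using smooth_add[of f "\<lambda>z. - g z"] by auto

lemma smooth_has_real_derivative:
  fixes f :: "real \<Rightarrow> real"
  assumes "smooth f" shows "(f has_real_derivative deriv f x) (at x)"
  using smooth_differentiable[OF assms] DERIV_deriv_iff_real_differentiable by blast

lemma smooth_deriv [intro]:
  fixes f :: "real \<Rightarrow> real"
  assumes "smooth f" shows "smooth (deriv f)"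
proof -
  have "deriv f = (\<lambda>x. frechet_derivative f (at x) 1)"
    using frechet_eq[OF has_field_derivative_imp_has_derivative[OF smooth_has_real_derivative[OF assms]]]
    by (auto simp: fun_eq_iff)
  then show ?thesis using smooth_frechet[OF assms] by simp
qed

lemma smooth_deriv_iter [intro]:
  fixes f :: "real \<Rightarrow> real"
  shows "smooth f \<Longrightarrow> smooth ((deriv ^^ j) f)"
  by (induction j) auto

lemma smooth_if_deriv:
  fixes f g :: "real \<Rightarrow> real"
  assumes "\<And>x. (f has_real_derivative g x) (at x)" "smooth g"
  shows "smooth f"
  by (rule smoothI[OF has_field_derivative_imp_has_derivative[OF assms(1)]])
    (use assms(2) in \<open>auto intro!: smooth_mult\<close>)

lemma smooth_compose:
  fixes f :: "'a::euclidean_space \<Rightarrow> real" and g :: "real \<Rightarrow> real"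
  assumes "smooth g" "smooth f"
  shows "smooth (\<lambda>z. g (f z))"
proof -
  \<comment> \<open>The outer function is generalised and \<open>f\<close> stays fixed: the chain
    rule turns \<open>g\<close> into \<open>deriv g\<close> and multiplies by a derivative of
    \<open>f\<close>.\<close>
  have "\<forall>g :: real \<Rightarrow> real. smooth g \<longrightarrow> C_k k (\<lambda>z. g (f z))" for k
  proof (induction k)
    case 0
    then show ?case using assms(2) by (auto intro: smooth_continuous_compose[OF _ smooth_continuous])
  next
    case (Suc k)
    show ?case
    proof (intro allI impI)
      fix g :: "real \<Rightarrow> real" assume g: "smooth g"
      have d: "((\<lambda>z. g (f z)) has_derivative (\<lambda>v. deriv g (f z) * frechet_derivative f (at z) v)) (at z)" for z
        using has_derivative_compose[OF smooth_has_derivative[OF assms(2)]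
          has_field_derivative_imp_has_derivative[OF smooth_has_real_derivative[OF g]]] .
      have "C_k k (\<lambda>z. frechet_derivative f (at z) v)" for v
        using smooth_frechet[OF assms(2)] by (simp add: smooth_def)
      then show "C_k (Suc k) (\<lambda>z. g (f z))"
        using d Suc[rule_format, OF smooth_deriv[OF g]]
        by (auto simp: frechet_eq[OF d] differentiable_on_def intro!: differentiableI C_k_mult)
    qed
  qed
  then show ?thesis using assms by (simp add: smooth_def)
qed

lemma smooth_exp [intro]: "smooth (exp :: real \<Rightarrow> real)"
proof -
  have "C_k k (exp :: real \<Rightarrow> real)" for k
  proof (induction k)
    case (Suc k)
    have d: "(exp has_derivative (\<lambda>v. exp z * v)) (at z)" for z :: real
      using DERIV_exp[of z] by (simp add: has_field_derivative_def)
    have c: "C_k k (\<lambda>_::real. v)" for v :: real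
      using smooth_const[of v] unfolding smooth_def by blast
    from c Suc d show ?case
      by (auto simp: frechet_eq[OF d] differentiable_on_def intro!: differentiableI C_k_mult)
  qed (auto intro!: continuous_intros)
  then show ?thesis by (simp add: smooth_def)
qed

lemma smooth_cos_sin: "smooth (cos :: real \<Rightarrow> real)" "smooth (sin :: real \<Rightarrow> real)"
proof -
  have "C_k k (cos :: real \<Rightarrow> real) \<and> C_k k (sin :: real \<Rightarrow> real)" for k
  proof (induction k)
    case (Suc k)
    have c: "(cos has_derivative (\<lambda>v. sin z * (- v))) (at z)" for z :: real
      using DERIV_cos[of z] by (auto simp: has_field_derivative_def elim!: has_derivative_eq_rhs)
    have s: "(sin has_derivative (\<lambda>v. cos z * v)) (at z)" for z :: real
      using DERIV_sin[of z] by (simp add: has_field_derivative_def)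
    have v: "C_k k (\<lambda>_::real. v)" for v :: real
      using smooth_const[of v] unfolding smooth_def by blast
    have "C_k k (\<lambda>z. - (sin z * v))" for v :: real
      using C_k_mult[OF _ v[of "- v"], of sin] Suc by simp
    with v Suc c s show ?case
      by (auto simp: frechet_eq[OF c] frechet_eq[OF s] differentiable_on_def
        intro!: differentiableI C_k_mult)
  qed (auto intro!: continuous_intros)
  then show "smooth (cos :: real \<Rightarrow> real)" "smooth (sin :: real \<Rightarrow> real)"
    by (auto simp: smooth_def)
qed

section \<open>A smooth function that vanishes on a half-line\<close>

definition flat :: "real \<Rightarrow> real" where
  "flat x = (if x > 0 then exp (- inverse x) else 0)"

lemma flat_nonneg: "flat x \<ge> 0" and flat_le_1: "flat x \<le> 1" and flat_pos_iff: "flat x > 0 \<longleftrightarrow> x > 0"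
  and flat_eq_0_iff: "flat x = 0 \<longleftrightarrow> x \<le> 0"
  by (auto simp: flat_def)

lemma poly_exp_decay:
  fixes p :: "real poly"
  shows "((\<lambda>y. poly p y * exp (- y)) \<longlongrightarrow> 0) at_top"
proof -
  have "((\<lambda>y. \<Sum>i\<le>degree p. coeff p i * (y ^ i / exp y)) \<longlongrightarrow> (\<Sum>i\<le>degree p. coeff p i * 0)) at_top"
    by (intro tendsto_intros tendsto_power_div_exp_0)
  then show ?thesis
    by (simp add: poly_altdef sum_divide_distrib exp_minus field_simps)
qed

text \<open>Differentiation preserves the form
  \<open>poly p (inverse x) * exp (- inverse x)\<close>: with \<open>y = 1/x\<close> it replaces the
  polynomial \<open>p\<close> by \<open>y^2 (p - p')\<close>. All these functions tend to 0 at the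
  origin because the exponential beats every polynomial, and the difference quotient at 0 is the
  function of the same form for the polynomial \<open>y p\<close>.\<close>

lemma smooth_flat [intro]: "smooth flat"
proof -
  define F :: "real poly \<Rightarrow> real \<Rightarrow> real"
    where "F p x = (if x > 0 then poly p (inverse x) * exp (- inverse x) else 0)" for p x
  have F0: "(F p \<longlongrightarrow> 0) (at 0)" for p
  proof (rule filterlim_split_at_real)
    have "(F p \<longlongrightarrow> 0) (at_right 0) \<longleftrightarrow>
        ((\<lambda>x. poly p (inverse x) * exp (- inverse x)) \<longlongrightarrow> 0) (at_right 0)"
      by (intro filterlim_cong refl) (auto simp: F_def eventually_at intro!: exI[of _ 1])
    then show "(F p \<longlongrightarrow> 0) (at_right 0)"
      using filterlim_compose[OF poly_exp_decay filterlim_inverse_at_top_right] by simp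
    show "(F p \<longlongrightarrow> 0) (at_left 0)"
      by (rule tendsto_eventually) (auto simp: F_def eventually_at intro!: exI[of _ 1])
  qed
  have dF: "(F p has_real_derivative F ([:0, 0, 1:] * (p - pderiv p)) x) (at x)" for p x
  proof -
    consider "x > 0" | "x < 0" | "x = 0" by linarith
    then show ?thesis
    proof cases
      case 1
      have "((\<lambda>x. poly p (inverse x) * exp (- inverse x)) has_real_derivative
          F ([:0, 0, 1:] * (p - pderiv p)) x) (at x)"
        using 1 by (auto intro!: derivative_eq_intros simp: F_def)
          (simp add: field_simps power2_eq_square)
      moreover have "eventually (\<lambda>y. poly p (inverse y) * exp (- inverse y) = F p y) (nhds x)"
        using 1 by (auto simp: F_def eventually_nhds intro!: exI[of _ "{0<..}"])
      ultimately show ?thesis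
        by (rule DERIV_cong_ev[OF refl _ refl, THEN iffD1, rotated])
    next
      case 2
      have "eventually (\<lambda>y. 0 = F p y) (nhds x)"
        using 2 by (auto simp: F_def eventually_nhds intro!: exI[of _ "{..<0}"])
      moreover have "((\<lambda>_. 0) has_real_derivative F ([:0, 0, 1:] * (p - pderiv p)) x) (at x)"
        using 2 by (auto simp: F_def)
      ultimately show ?thesis
        by (rule DERIV_cong_ev[OF refl _ refl, THEN iffD1])
    next
      case 3
      have "((\<lambda>h. (F p h - F p 0) / h) \<longlongrightarrow> 0) (at 0) \<longleftrightarrow> (F ([:0, 1:] * p) \<longlongrightarrow> 0) (at 0)"
        by (intro filterlim_cong refl) (auto simp: F_def divide_inverse algebra_simps)
      with F0 have "((\<lambda>h. (F p h - F p 0) / h) \<longlongrightarrow> 0) (at 0)" by blast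
      with 3 show ?thesis by (simp add: DERIV_def) (simp add: F_def)
    qed
  qed
  have "C_k k (F p)" for k p
  proof (induction k arbitrary: p)
    case 0
    show ?case using DERIV_isCont[OF dF] by (auto simp: continuous_at_imp_continuous_on)
  next
    case (Suc k)
    note d = has_field_derivative_imp_has_derivative[OF dF]
    have c: "C_k k (\<lambda>_::real. v)" for v :: real
      using smooth_const[of v] unfolding smooth_def by blast
    from c Suc d show ?case
      by (auto simp: frechet_eq[OF d] differentiable_on_def intro!: differentiableI C_k_mult
        simp del: mult_pCons_left)
  qed
  moreover have "flat = F 1" by (auto simp: flat_def F_def fun_eq_iff)
  ultimately show ?thesis by (metis smooth_def)
qed

section \<open>Partial derivatives in time and space\<close>

lemma smooth_dt [intro]: "smooth f \<Longrightarrow> smooth (dt f)"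
  and smooth_dx [intro]: "smooth f \<Longrightarrow> smooth (dx f)"
  unfolding dt_def[abs_def] dx_def[abs_def] by (auto intro: smooth_frechet)

lemma dt_eq: "(f has_derivative f') (at z) \<Longrightarrow> dt f z = f' (1, 0)"
  and dx_eq: "(f has_derivative f') (at z) \<Longrightarrow> dx f z = f' (0, 1)"
  by (simp_all add: dt_def dx_def frechet_eq)

lemma smooth_has_derivative_dt_dx:
  assumes "smooth f"
  shows "(f has_derivative (\<lambda>h. fst h * dt f z + snd h * dx f z)) (at z)"
proof -
  note d = smooth_has_derivative[OF assms, of z]
  interpret bounded_linear "frechet_derivative f (at z)"
    using d by (rule has_derivative_bounded_linear)
  have "frechet_derivative f (at z) h = fst h * dt f z + snd h * dx f z" for h
  proof -
    have "h = fst h *\<^sub>R (1, 0) + snd h *\<^sub>R (0, 1)" by (cases h) simp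
    then show ?thesis
      by (metis add dt_def dx_def scaleR real_scaleR_def)
  qed
  then show ?thesis using d by (metis (no_types, lifting) ext)
qed

lemma smooth_dt_real:
  assumes "smooth f"
  shows "((\<lambda>t. f (t, x)) has_real_derivative dt f (t, x)) (at t)"
proof -
  have "((\<lambda>t. (t, x)) has_derivative (\<lambda>h. (h, 0))) (at t)"
    by (auto intro!: derivative_eq_intros)
  from has_derivative_compose[OF this smooth_has_derivative_dt_dx[OF assms]]
  show ?thesis by (auto simp: has_field_derivative_def mult.commute[of _ "dt _ _"] elim!: has_derivative_eq_rhs)
qed

lemma smooth_dx_real:
  assumes "smooth f"
  shows "((\<lambda>x. f (t, x)) has_real_derivative dx f (t, x)) (at x)"
proof -
  have "((\<lambda>x. (t, x)) has_derivative (\<lambda>h. (0, h))) (at x)"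
    by (auto intro!: derivative_eq_intros)
  from has_derivative_compose[OF this smooth_has_derivative_dt_dx[OF assms]]
  show ?thesis by (auto simp: has_field_derivative_def elim!: has_derivative_eq_rhs)
qed

lemma dt_dx_add:
  assumes "smooth f" "smooth g"
  shows "dt (\<lambda>z. f z + g z) = (\<lambda>z. dt f z + dt g z)" "dx (\<lambda>z. f z + g z) = (\<lambda>z. dx f z + dx g z)"
  using has_derivative_add[OF assms[THEN smooth_has_derivative_dt_dx]]
  by (auto simp: fun_eq_iff simp del: split_paired_All intro!: dt_eq[THEN trans] dx_eq[THEN trans])

lemma dt_dx_mult:
  assumes "smooth f" "smooth g"
  shows "dt (\<lambda>z. f z * g z) = (\<lambda>z. f z * dt g z + dt f z * g z)"
    "dx (\<lambda>z. f z * g z) = (\<lambda>z. f z * dx g z + dx f z * g z)"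
  using has_derivative_mult[OF assms[THEN smooth_has_derivative_dt_dx]]
  by (auto simp: fun_eq_iff simp del: split_paired_All intro!: dt_eq[THEN trans] dx_eq[THEN trans])

lemma dt_dx_const [simp]: "dt (\<lambda>_. c) = (\<lambda>_. 0)" "dx (\<lambda>_. c) = (\<lambda>_. 0)"
  by (auto simp: dt_eq[OF has_derivative_const] dx_eq[OF has_derivative_const] fun_eq_iff)

lemma dt_dx_cmult:
  assumes "smooth f"
  shows "dt (\<lambda>z. c * f z) = (\<lambda>z. c * dt f z)" "dx (\<lambda>z. c * f z) = (\<lambda>z. c * dx f z)"
  using dt_dx_mult[OF smooth_const assms] by simp_all

lemma dt_dx_compose:
  fixes g :: "real \<Rightarrow> real"
  assumes "smooth f" "smooth g"
  shows "dt (\<lambda>z. g (f z)) = (\<lambda>z. deriv g (f z) * dt f z)"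
    "dx (\<lambda>z. g (f z)) = (\<lambda>z. deriv g (f z) * dx f z)"
  using has_derivative_compose[OF smooth_has_derivative_dt_dx[OF assms(1)]
          has_field_derivative_imp_has_derivative[OF smooth_has_real_derivative[OF assms(2)]]]
  by (auto simp: fun_eq_iff simp del: split_paired_All intro!: dt_eq[THEN trans] dx_eq[THEN trans])

lemma dt_dx_fst_snd:
  "dt fst = (\<lambda>_. 1)" "dx fst = (\<lambda>_. 0)" "dt snd = (\<lambda>_. 0)" "dx snd = (\<lambda>_. 1)"
  using dt_eq[OF has_derivative_fst[OF has_derivative_ident]] dx_eq[OF has_derivative_fst[OF has_derivative_ident]]
    dt_eq[OF has_derivative_snd[OF has_derivative_ident]] dx_eq[OF has_derivative_snd[OF has_derivative_ident]]
  by (auto simp: fun_eq_iff)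

lemma periodic_dt_dx:
  assumes "smooth f" "\<And>t x. f (t, x + L) = f (t, x)"
  shows "dt f (t, x + L) = dt f (t, x)" "dx f (t, x + L) = dx f (t, x)"
proof -
  have "((\<lambda>z. z + (0, L)) has_derivative (\<lambda>h. h)) (at (t, x))"
    by (auto intro!: derivative_eq_intros)
  from has_derivative_compose[OF this smooth_has_derivative_dt_dx[OF assms(1)]]
  have "(f has_derivative (\<lambda>h. fst h * dt f (t, x + L) + snd h * dx f (t, x + L))) (at (t, x))"
    using assms(2) by (simp add: split_beta) (metis (no_types, lifting) ext add.right_neutral add_Pair prod.collapse)
  then show "dt f (t, x + L) = dt f (t, x)" "dx f (t, x + L) = dx f (t, x)"
    by (auto simp: dt_eq dx_eq)
qed

section \<open>Test functions and the fundamental lemma of the calculus of variations\<close>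

text \<open>The positive and the negative part of \<open>h\<close> are densities of two measures
  \<open>P\<close> and \<open>N\<close>, and the hypothesis says that \<open>P\<close> is at most
  \<open>N\<close> on boxes. Covering the set \<open>g > 0\<close> by nonoverlapping boxes inside an
  open set \<open>U\<close> bounds its \<open>P\<close>-measure by \<open>N U\<close>; outer
  regularity of the finite measure \<open>N\<close> shrinks \<open>U\<close> to the set itself,
  where \<open>N\<close> vanishes.\<close>

lemma AE_nonpos_if_box_integrals_nonpos:
  fixes h :: "'a::euclidean_space \<Rightarrow> real"
  assumes O: "open O'" and int: "set_integrable lborel O' h"
    and nonpos: "\<And>c d. cbox c d \<subseteq> O' \<Longrightarrow> (LINT x:box c d|lborel. h x) \<le> 0"
  shows "AE x in lborel. x \<in> O' \<longrightarrow> h x \<le> 0"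
proof -
  define g where "g x = indicator O' x * h x" for x
  have g: "integrable lborel g"
    using int by (simp add: set_integrable_def g_def[abs_def])
  then have [measurable]: "g \<in> borel_measurable borel" by auto
  define P where "P = density lborel (\<lambda>x. ennreal (max 0 (g x)))"
  define N where "N = density lborel (\<lambda>x. ennreal (max 0 (- g x)))"
  have sets [simp]: "sets P = sets borel" "sets N = sets borel" by (auto simp: P_def N_def)
  have box: "emeasure P (box c d) \<le> emeasure N (box c d)" if "cbox c d \<subseteq> O'" for c d
  proof -
    have "(\<integral>x. indicator (box c d) x * g x \<partial>lborel) = (LINT x:box c d|lborel. h x)"
      using that box_subset_cbox[of c d] unfolding set_lebesgue_integral_def
      by (intro Bochner_Integration.integral_cong) (auto simp: g_def indicator_def)
    then have le: "(\<integral>x. indicator (box c d) x * g x \<partial>lborel) \<le> 0" using nonpos[OF that] by simp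
    have i: "integrable lborel (\<lambda>x. indicator (box c d) x * max 0 (g x))"
        "integrable lborel (\<lambda>x. indicator (box c d) x * max 0 (- g x))"
      using g by (auto intro!: integrable_real_mult_indicator simp: mult.commute[of "indicator _ _"])
    have "(\<integral>x. indicator (box c d) x * max 0 (g x) \<partial>lborel) - (\<integral>x. indicator (box c d) x * max 0 (- g x) \<partial>lborel)
      = (\<integral>x. indicator (box c d) x * g x \<partial>lborel)"
      by (subst Bochner_Integration.integral_diff[symmetric, OF i])
        (auto intro!: Bochner_Integration.integral_cong simp: max_def algebra_simps)
    with le have le: "(\<integral>x. indicator (box c d) x * max 0 (g x) \<partial>lborel) \<le> (\<integral>x. indicator (box c d) x * max 0 (- g x) \<partial>lborel)"
      by simp
    have "emeasure P (box c d) = ennreal (\<integral>x. indicator (box c d) x * max 0 (g x) \<partial>lborel)"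
      unfolding P_def using i by (auto simp: emeasure_density nn_integral_eq_integral[symmetric] ennreal_mult'' intro!: nn_integral_cong simp: indicator_def)
    moreover have "emeasure N (box c d) = ennreal (\<integral>x. indicator (box c d) x * max 0 (- g x) \<partial>lborel)"
      unfolding N_def using i by (auto simp: emeasure_density nn_integral_eq_integral[symmetric] ennreal_mult'' intro!: nn_integral_cong simp: indicator_def)
    ultimately show ?thesis using le by (simp add: ennreal_leI)
  qed
  \<comment> \<open>The covering lemma works inside a bounded box, hence the intersection with a
    cube; the cubes exhaust the space at the end.\<close>
  have null: "{x \<in> cbox (- (real n *\<^sub>R One)) (real n *\<^sub>R One). g x > 0} \<in> null_sets lborel" (is "?B \<in> _")
    if "n > 0" for n
  proof -
    have B [measurable]: "?B \<in> sets borel" by measurable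
    have "emeasure P ?B \<le> emeasure N U" if U: "?B \<subseteq> U" "open U" for U
    proof -
      have ne: "box (- (real n *\<^sub>R One)) (real n *\<^sub>R One :: 'a) \<noteq> {}"
        using \<open>n > 0\<close> by (auto simp: box_ne_empty inner_diff_left)
      \<comment> \<open>A point with \<open>g > 0\<close> lies in \<open>O'\<close>, so every
        covering box attached to such a point stays inside \<open>U \<inter> O'\<close>, where the
        hypothesis on boxes is available.\<close>
      have "gauge (\<lambda>x. if x \<in> U \<inter> O' then U \<inter> O' else UNIV)"
        using U O by (auto simp: gauge_def)
      from covering_lemma[OF _ ne this, of ?B] obtain D where D: "countable D"
        "\<And>K. K \<in> D \<Longrightarrow> interior K \<noteq> {} \<and> (\<exists>c d. K = cbox c d)"
        "pairwise (\<lambda>A B. interior A \<inter> interior B = {}) D"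
        "\<And>K. K \<in> D \<Longrightarrow> \<exists>x \<in> ?B \<inter> K. K \<subseteq> (if x \<in> U \<inter> O' then U \<inter> O' else UNIV)"
        "?B \<subseteq> \<Union>D"
        by (metis (no_types, lifting) mem_Collect_eq subsetI)
      have sub: "K \<subseteq> U \<inter> O'" if "K \<in> D" for K
        using D(4)[OF that] U by (auto simp: g_def indicator_def split: if_splits)
      have cb: "\<exists>c d. K = cbox c d \<and> interior K = box c d" if "K \<in> D" for K
        using D(2)[OF that] interior_cbox by blast
      \<comment> \<open>Only the interiors of the covering boxes are disjoint; replacing the boxes
        by their interiors costs countably many boundaries, a null set.\<close>
      have "(\<Union>K\<in>D. K - interior K) \<in> null_sets lborel"
      proof (rule null_sets_UN'[OF D(1)])
        fix K assume "K \<in> D"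
        then obtain c d where "K = cbox c d" "interior K = box c d" using cb by blast
        then show "K - interior K \<in> null_sets lborel"
          using negligible_frontier_interval[of c d] by (simp add: negligible_iff_null_sets null_sets_completion_iff)
      qed
      then have ae: "AE x in P. x \<notin> (\<Union>K\<in>D. K - interior K)"
        unfolding P_def by (subst AE_density) (auto dest: AE_not_in)
      have disj: "disjoint_family_on interior D"
        using D(3) by (auto simp: disjoint_family_on_def pairwise_def)
      have "emeasure P ?B \<le> emeasure P (\<Union>K\<in>D. interior K)"
      proof (rule emeasure_mono_AE)
        show "AE x in P. x \<in> ?B \<longrightarrow> x \<in> (\<Union>K\<in>D. interior K)"
          using ae by eventually_elim (use D(5) in blast)
        show "(\<Union>K\<in>D. interior K) \<in> sets P"
          using D(1) by (auto intro!: borel_open)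
      qed
      also have "\<dots> = (\<integral>\<^sup>+K. emeasure P (interior K) \<partial>count_space D)"
        by (rule emeasure_UN_countable) (use D(1) disj in auto)
      also have "\<dots> \<le> (\<integral>\<^sup>+K. emeasure N (interior K) \<partial>count_space D)"
      proof (rule nn_integral_mono)
        fix K assume "K \<in> space (count_space D)"
        then have "K \<in> D" by simp
        then obtain c d where "K = cbox c d" "interior K = box c d" using cb by blast
        with box[of c d] sub[OF \<open>K \<in> D\<close>] show "emeasure P (interior K) \<le> emeasure N (interior K)"
          by auto
      qed
      also have "\<dots> = emeasure N (\<Union>K\<in>D. interior K)"
        by (rule emeasure_UN_countable[symmetric]) (use D(1) disj in auto)
      also have "\<dots> \<le> emeasure N U"
        by (intro emeasure_mono) (use sub interior_subset U in \<open>auto dest!: subsetD[OF interior_subset]\<close>)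
      finally show ?thesis .
    qed
    moreover have "emeasure N ?B = (INF U\<in>{U. ?B \<subseteq> U \<and> open U}. emeasure N U)"
    proof (rule outer_regular)
      have "emeasure N (space N) = ennreal (\<integral>x. max 0 (- g x) \<partial>lborel)"
        unfolding N_def using g by (simp add: emeasure_density nn_integral_eq_integral)
      then show "emeasure N (space N) \<noteq> \<infinity>" by simp
    qed auto
    ultimately have "emeasure P ?B \<le> emeasure N ?B" by (auto intro!: INF_greatest)
    also have "emeasure N ?B = 0"
      unfolding N_def by (subst emeasure_density) (auto simp: nn_integral_0_iff_AE indicator_def)
    finally have "emeasure P ?B = 0" by simp
    then have "AE x in lborel. x \<notin> ?B"
      unfolding P_def by (subst (asm) emeasure_density)
        (auto simp: nn_integral_0_iff_AE indicator_def max_def split: if_splits elim!: eventually_mono)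
    then show ?thesis by (subst AE_iff_null_sets) auto
  qed
  have "AE x in lborel. \<forall>n. x \<notin> {x \<in> cbox (- (real (Suc n) *\<^sub>R One)) (real (Suc n) *\<^sub>R One). g x > 0}"
    unfolding AE_all_countable using null AE_not_in by blast
  then show ?thesis
  proof eventually_elim
    case (elim x)
    have "\<exists>n. x \<in> cbox (- (real (Suc n) *\<^sub>R One)) (real (Suc n) *\<^sub>R One)"
    proof -
      obtain n where n: "norm x \<le> real n" using real_arch_simple by blast
      then have "\<bar>x \<bullet> i\<bar> \<le> real (Suc n)" if "i \<in> Basis" for i
        using Basis_le_norm[OF that, of x] by simp
      then have "- real (Suc n) \<le> x \<bullet> i \<and> x \<bullet> i \<le> real (Suc n)" if "i \<in> Basis" for i
        using abs_le_D1 abs_le_D2 that by (metis minus_le_iff)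
      then show ?thesis by (intro exI[of _ n]) (auto simp: mem_box simp del: of_nat_Suc)
    qed
    then show ?case using elim by (auto simp: g_def indicator_def not_less split: if_splits)
  qed
qed

abbreviation cell :: "real \<Rightarrow> real \<Rightarrow> real \<Rightarrow> (real \<times> real) set" where
  "cell T a b \<equiv> {0<..<T} \<times> {a<..<b}"

section \<open>Cutoff functions, localised in time and periodic in space\<close>

lemma flat_tendsto: "(\<lambda>n. flat (real n * s)) \<longlonglongrightarrow> indicator {0<..} s"
proof (cases "s > 0")
  case True
  have "(\<lambda>n. exp (- inverse s * inverse (real n))) \<longlonglongrightarrow> exp (- inverse s * 0)"
    by (intro tendsto_intros LIMSEQ_inverse_real_of_nat[THEN LIMSEQ_imp_Suc] lim_inverse_n)
  moreover have "eventually (\<lambda>n. exp (- inverse s * inverse (real n)) = flat (real n * s)) sequentially"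
    using eventually_gt_at_top[of 0] by eventually_elim (use True in \<open>auto simp: flat_def\<close>)
  ultimately show ?thesis using True
    by (auto simp: indicator_def elim: Lim_transform_eventually)
next
  case False
  then have "flat (real n * s) = 0" for n
    by (auto simp: flat_eq_0_iff mult_nonneg_nonpos)
  with False show ?thesis by (simp add: indicator_def)
qed

text \<open>Rounding selects the multiple of \<open>2 * pi\<close> that brings the angle into
  \<open>[- pi, pi]\<close>; there the cosine is even and decreases in the absolute value.\<close>

lemma cos_greater_imp_near_multiple:
  assumes "0 \<le> \<rho>" "\<rho> \<le> pi" "cos \<theta> > cos \<rho>"
  obtains k :: int where "\<bar>\<theta> - 2 * pi * of_int k\<bar> < \<rho>"
proof -
  define k where "k = round (\<theta> / (2 * pi))"
  have "\<bar>\<theta> / (2 * pi) - of_int k\<bar> \<le> 1 / 2"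
    using of_int_round_abs_le[of "\<theta> / (2 * pi)"] by (simp add: k_def abs_minus_commute)
  then have "\<bar>\<theta> / (2 * pi) - of_int k\<bar> * (2 * pi) \<le> 1 / 2 * (2 * pi)"
    by (intro mult_right_mono) auto
  moreover have "\<bar>\<theta> / (2 * pi) - of_int k\<bar> * (2 * pi) = \<bar>\<theta> - 2 * pi * of_int k\<bar>"
    by (simp flip: abs_mult_pos add: field_simps)
  ultimately have le: "\<bar>\<theta> - 2 * pi * of_int k\<bar> \<le> pi" by simp
  have "cos \<bar>\<theta> - 2 * pi * of_int k\<bar> = cos (\<theta> - 2 * pi * of_int k)" by simp
  also have "\<dots> = cos \<theta>"
    using cos_int_2pin[of k] sin_int_2pin[of k] by (simp add: cos_diff mult.assoc)
  finally have "\<not> \<rho> \<le> \<bar>\<theta> - 2 * pi * of_int k\<bar>"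
    using assms cos_monotone_0_pi_le[OF assms(1) _ le] by auto
  then show ?thesis using that[of k] by simp
qed

definition bump :: "real \<Rightarrow> real \<Rightarrow> nat \<Rightarrow> real \<Rightarrow> real" where
  "bump c d n t = flat (real n * (t - c)) * flat (real n * (d - t))"

lemma smooth_bump [intro]: "smooth (bump c d n)"
proof -
  have "smooth (\<lambda>t. real n * (t - c))" "smooth (\<lambda>t. real n * (d - t))"
    by (intro smooth_cmult smooth_diff smooth_ident smooth_const)+
  then show ?thesis
    unfolding bump_def[abs_def] by (intro smooth_mult[OF smooth_compose[OF smooth_flat] smooth_compose[OF smooth_flat]])
qed

lemma bump_nonneg: "bump c d n t \<ge> 0" and bump_le_1: "bump c d n t \<le> 1"
  unfolding bump_def by (auto simp: flat_nonneg flat_le_1 intro: mult_le_one)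

lemma bump_eq_0: "t \<le> c \<or> d \<le> t \<Longrightarrow> bump c d n t = 0"
  by (auto simp: bump_def flat_eq_0_iff mult_nonneg_nonpos)

lemma bump_tendsto: "(\<lambda>n. bump c d n t) \<longlonglongrightarrow> indicator {c<..<d} t"
proof -
  have "(\<lambda>n. bump c d n t) \<longlonglongrightarrow> indicator {0<..} (t - c) * indicator {0<..} (d - t)"
    unfolding bump_def by (intro tendsto_intros flat_tendsto)
  then show ?thesis by (auto simp: indicator_def split: if_splits)
qed

text \<open>For \<open>L > 0\<close> and \<open>0 \<le> r \<le> L / 2\<close> it is positive exactly
  at the points of distance less than \<open>r\<close> from the multiples of \<open>L\<close>. It
  thus replaces \<open>r\<close> minus the distance to this lattice by a smooth periodic
  function.\<close>

definition cos_well :: "real \<Rightarrow> real \<Rightarrow> real \<Rightarrow> real" where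
  "cos_well L r y = cos (2 * pi / L * y) - cos (2 * pi / L * r)"

lemma smooth_cos_well [intro]: "smooth (cos_well L r)"
  unfolding cos_well_def[abs_def]
  by (intro smooth_diff smooth_const smooth_compose[OF smooth_cos_sin(1)] smooth_cmult smooth_ident)

lemma cos_well_periodic: "L \<noteq> 0 \<Longrightarrow> cos_well L r (y + L) = cos_well L r y"
  by (simp add: cos_well_def distrib_left)

lemma cos_well_pos_imp:
  assumes "L > 0" "0 \<le> r" "r \<le> L / 2" "cos_well L r y > 0"
  obtains k :: int where "\<bar>y - of_int k * L\<bar> < r"
proof -
  have "0 \<le> 2 * pi / L * r" "2 * pi / L * r \<le> pi"
    using assms by (auto simp: field_simps)
  then obtain k :: int where "\<bar>2 * pi / L * y - 2 * pi * of_int k\<bar> < 2 * pi / L * r"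
    using assms(4) cos_greater_imp_near_multiple unfolding cos_well_def by (metis diff_gt_0_iff_gt)
  then have "\<bar>2 * pi / L * y - 2 * pi * of_int k\<bar> * (L / (2 * pi)) < 2 * pi / L * r * (L / (2 * pi))"
    using assms(1) by (intro mult_strict_right_mono) auto
  moreover have "\<bar>2 * pi / L * y - 2 * pi * of_int k\<bar> * (L / (2 * pi)) = \<bar>(2 * pi / L * y - 2 * pi * of_int k) * (L / (2 * pi))\<bar>"
    using assms(1) by (simp add: abs_mult)
  moreover have "(2 * pi / L * y - 2 * pi * of_int k) * (L / (2 * pi)) = y - of_int k * L"
    using assms(1) by (simp add: field_simps)
  moreover have "2 * pi / L * r * (L / (2 * pi)) = r"
    using assms(1) by simp
  ultimately have "\<bar>y - of_int k * L\<bar> < r" by metis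
  then show ?thesis by (rule that)
qed

lemma cos_well_pos:
  assumes "L > 0" "\<bar>y\<bar> < r" "r \<le> L / 2"
  shows "cos_well L r y > 0"
proof -
  have "cos (2 * pi / L * r) < cos (2 * pi / L * \<bar>y\<bar>)"
    using assms by (intro cos_monotone_0_pi) (auto simp: field_simps)
  also have "cos (2 * pi / L * \<bar>y\<bar>) = cos (2 * pi / L * y)"
    by (cases "y \<ge> 0") auto
  finally show ?thesis by (simp add: cos_well_def)
qed

definition pbump :: "real \<Rightarrow> real \<Rightarrow> real \<Rightarrow> nat \<Rightarrow> real \<Rightarrow> real" where
  "pbump L c d n x = flat (real n * cos_well L ((d - c) / 2) (x - (c + d) / 2))"

lemma smooth_pbump [intro]: "smooth (pbump L c d n)"
proof -
  have "smooth (\<lambda>x. x - (c + d) / 2 :: real)"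
    by (intro smooth_diff smooth_ident smooth_const)
  then show ?thesis
    unfolding pbump_def[abs_def]
    by (intro smooth_compose[OF smooth_flat] smooth_cmult smooth_compose[OF smooth_cos_well])
qed

lemma pbump_nonneg: "pbump L c d n x \<ge> 0" and pbump_le_1: "pbump L c d n x \<le> 1"
  unfolding pbump_def by (auto simp: flat_nonneg flat_le_1)

lemma pbump_periodic: "L \<noteq> 0 \<Longrightarrow> pbump L c d n (x + L) = pbump L c d n x"
  using cos_well_periodic[of L "(d - c) / 2" "x - (c + d) / 2"]
  by (simp add: pbump_def algebra_simps)

text \<open>The periodic bump lives on all translates of \<open>(c,d)\<close> by multiples of the
  period. Of these only \<open>(c,d)\<close> itself meets \<open>(a,b)\<close>, because
  \<open>a < c\<close> and \<open>d < b\<close>.\<close>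

lemma pbump_tendsto:
  assumes "a < c" "c \<le> d" "d < b" "x \<in> {a<..<b}"
  shows "(\<lambda>n. pbump (b - a) c d n x) \<longlonglongrightarrow> indicator {c<..<d} x"
proof -
  have "cos_well (b - a) ((d - c) / 2) (x - (c + d) / 2) > 0 \<longleftrightarrow> x \<in> {c<..<d}" (is "?l \<longleftrightarrow> ?r")
  proof
    assume ?l
    then obtain k :: int where k: "\<bar>x - (c + d) / 2 - of_int k * (b - a)\<bar> < (d - c) / 2"
      using assms by (elim cos_well_pos_imp[rotated -1]) auto
    have "\<not> k \<ge> 1"
    proof
      assume "k \<ge> 1"
      then have "1 * (b - a) \<le> of_int k * (b - a)" using assms by (intro mult_right_mono) auto
      with k assms show False by (simp add: abs_less_iff field_simps)
    qed
    moreover have "\<not> k \<le> -1"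
    proof
      assume "k \<le> -1"
      then have "of_int k * (b - a) \<le> (-1) * (b - a)" using assms by (intro mult_right_mono) auto
      with k assms show False by (simp add: abs_less_iff field_simps)
    qed
    ultimately have "k = 0" by linarith
    with k have "\<bar>x - (c + d) / 2\<bar> < (d - c) / 2" by simp
    then show ?r by (auto simp: abs_less_iff field_simps)
  next
    assume ?r
    then show ?l using assms by (intro cos_well_pos) (auto simp: abs_less_iff field_simps)
  qed
  then have "indicator {0<..} (cos_well (b - a) ((d - c) / 2) (x - (c + d) / 2)) = (indicator {c<..<d} x :: real)"
    by (auto simp: indicator_def)
  then show ?thesis
    unfolding pbump_def using flat_tendsto by metis
qed

lemma set_integral_mult_tendsto:
  fixes f :: "'a::euclidean_space \<Rightarrow> real"
  assumes f: "set_integrable lborel S f" and "S \<in> sets borel"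
    and \<phi>: "\<And>n. \<phi> n \<in> borel_measurable borel" "\<And>n x. \<bar>\<phi> n x\<bar> \<le> 1"
      "\<And>x. x \<in> S \<Longrightarrow> (\<lambda>n. \<phi> n x) \<longlonglongrightarrow> indicator B x"
    and "B \<subseteq> S" "B \<in> sets borel"
  shows "(\<lambda>n. LINT x:S|lborel. f x * \<phi> n x) \<longlonglongrightarrow> (LINT x:B|lborel. f x)"
proof -
  have int: "integrable lborel (\<lambda>x. indicator S x *\<^sub>R f x)"
    using f by (simp add: set_integrable_def)
  note [measurable] = borel_measurable_integrable[OF int] \<phi>(1) assms(2) assms(7)
  have eq: "indicator S x *\<^sub>R f x * \<phi> n x = indicator S x *\<^sub>R (f x * \<phi> n x)"
    "indicator S x *\<^sub>R f x * indicator B x = indicator B x *\<^sub>R f x" for n x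
    using assms(6) by (auto simp: indicator_def)
  have "(\<lambda>n. \<integral>x. indicator S x *\<^sub>R f x * \<phi> n x \<partial>lborel) \<longlonglongrightarrow> (\<integral>x. indicator S x *\<^sub>R f x * indicator B x \<partial>lborel)"
  proof (rule integral_dominated_convergence[where w = "\<lambda>x. norm (indicator S x *\<^sub>R f x)"])
    show "integrable lborel (\<lambda>x. norm (indicator S x *\<^sub>R f x))" using int by (rule integrable_norm)
    show "AE x in lborel. (\<lambda>n. indicator S x *\<^sub>R f x * \<phi> n x) \<longlonglongrightarrow> indicator S x *\<^sub>R f x * indicator B x"
      by (intro AE_I2) (auto simp: indicator_def[of S] intro!: tendsto_mult \<phi>(3))
    show "AE x in lborel. norm (indicator S x *\<^sub>R f x * \<phi> n x) \<le> norm (indicator S x *\<^sub>R f x)" for n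
      using \<phi>(2) by (intro AE_I2) (auto simp: abs_mult intro!: mult_left_le)
  qed measurable
  then show ?thesis
    unfolding set_lebesgue_integral_def eq by simp
qed

lemma smooth_measurable: "smooth f \<Longrightarrow> f \<in> borel_measurable borel"
  for f :: "'a::euclidean_space \<Rightarrow> real"
  by (intro borel_measurable_continuous_onI smooth_continuous)

text \<open>A one-sided fundamental lemma: comparison with a mollification will yield inequalities
  up to some \<open>e\<close> rather than equations. Products of a bump in time and a periodic bump
  in space are admissible test functions and approximate the indicators of boxes.\<close>

lemma AE_nonpos_cell:
  assumes f: "set_integrable lborel (cell T a b) f"
    and nonpos: "\<And>\<phi>. \<phi> \<in> test_interior T a b \<Longrightarrow> (\<And>z. \<phi> z \<ge> 0) \<Longrightarrow> (LINT z:cell T a b|lborel. f z * \<phi> z) \<le> 0"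
  shows "AE z\<in>cell T a b in lborel. f z \<le> 0"
proof (rule AE_nonpos_if_box_integrals_nonpos[OF _ f])
  show "open (cell T a b)" by (intro open_Times) auto
  fix c d :: "real \<times> real" assume sub: "cbox c d \<subseteq> cell T a b"
  show "(LINT x:box c d|lborel. f x) \<le> 0"
  proof (cases "box c d = {}")
    case True then show ?thesis by (simp add: set_lebesgue_integral_def)
  next
    case False
    obtain c1 c2 d1 d2 where cd: "c = (c1, c2)" "d = (d1, d2)" by (cases c; cases d)
    have ne: "c1 < d1" "c2 < d2" using False by (auto simp: cd box_prod)
    then have "c \<in> cbox c d" "d \<in> cbox c d" by (auto simp: cd cbox_Pair_eq)
    then have "c \<in> cell T a b" "d \<in> cell T a b" using sub by blast+
    then have o: "0 < c1" "d1 < T" "a < c2" "d2 < b" by (auto simp: cd)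
    define \<phi> where "\<phi> n z = bump c1 d1 n (fst z) * pbump (b - a) c2 d2 n (snd z)" for n z
    have sm: "smooth (\<phi> n)" for n
      unfolding \<phi>_def[abs_def]
      by (intro smooth_mult smooth_compose[OF smooth_bump] smooth_compose[OF smooth_pbump] smooth_fst smooth_snd)
    have test: "\<phi> n \<in> test_interior T a b" for n
      unfolding test_interior_def test_init_def
      using sm[of n] o ne pbump_periodic[of "b - a"] by (auto simp: \<phi>_def bump_eq_0)
    have "(\<lambda>n. LINT x:cell T a b|lborel. f x * \<phi> n x) \<longlonglongrightarrow> (LINT x:box c d|lborel. f x)"
    proof (rule set_integral_mult_tendsto[OF f])
      show "\<bar>\<phi> n x\<bar> \<le> 1" for n x
        unfolding \<phi>_def abs_mult
        by (intro mult_le_one) (simp_all add: bump_nonneg pbump_nonneg bump_le_1 pbump_le_1)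
      fix z assume "z \<in> cell T a b"
      then have "(\<lambda>n. \<phi> n z) \<longlonglongrightarrow> indicator {c1<..<d1} (fst z) * indicator {c2<..<d2} (snd z)"
        unfolding \<phi>_def using o ne by (intro tendsto_mult bump_tendsto pbump_tendsto) auto
      moreover have "indicator {c1<..<d1} (fst z) * indicator {c2<..<d2} (snd z) = (indicator (box c d) z :: real)"
        by (cases z) (auto simp: cd box_prod indicator_def)
      ultimately show "(\<lambda>n. \<phi> n z) \<longlonglongrightarrow> indicator (box c d) z" by simp
    next
      show "box c d \<subseteq> cell T a b" using sub box_subset_cbox by blast
      show "cell T a b \<in> sets borel" by (intro borel_open open_Times) auto
      show "\<phi> n \<in> borel_measurable borel" for n using sm by (rule smooth_measurable)
    qed (rule box_borel)
    moreover have "(LINT x:cell T a b|lborel. f x * \<phi> n x) \<le> 0" for n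
      by (rule nonpos[OF test]) (simp add: \<phi>_def bump_nonneg pbump_nonneg)
    ultimately show ?thesis by (intro LIMSEQ_le_const2) auto
  qed
qed

lemma AE_nonpos_space:
  assumes f: "set_integrable lborel {a<..<b} f"
    and nonpos: "\<And>\<phi>. \<phi> \<in> test_space a b \<Longrightarrow> (\<And>z. \<phi> z \<ge> 0) \<Longrightarrow> (LINT z:{a<..<b}|lborel. f z * \<phi> z) \<le> 0"
  shows "AE z\<in>{a<..<b} in lborel. f z \<le> 0"
proof (rule AE_nonpos_if_box_integrals_nonpos[OF _ f])
  fix c d :: real assume sub: "cbox c d \<subseteq> {a<..<b}"
  show "(LINT x:box c d|lborel. f x) \<le> 0"
  proof (cases "c < d")
    case False then show ?thesis by (simp add: set_lebesgue_integral_def box_real)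
  next
    case True
    then have "c \<in> cbox c d" "d \<in> cbox c d" by auto
    with sub have o: "a < c" "d < b" by auto
    have test: "pbump (b - a) c d n \<in> test_space a b" for n
      unfolding test_space_def using o True pbump_periodic[of "b - a"] by auto
    have "(\<lambda>n. LINT x:{a<..<b}|lborel. f x * pbump (b - a) c d n x) \<longlonglongrightarrow> (LINT x:box c d|lborel. f x)"
      using o True sub
    proof (intro set_integral_mult_tendsto[OF f])
      show "\<bar>pbump (b - a) c d n x\<bar> \<le> 1" for n x using pbump_nonneg[of "b - a" c d n x] pbump_le_1[of "b - a" c d n x] by simp
      show "(\<lambda>n. pbump (b - a) c d n x) \<longlonglongrightarrow> indicator (box c d) x" if "x \<in> {a<..<b}" for x
        unfolding box_real using o True that by (intro pbump_tendsto) auto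
      show "pbump (b - a) c d n \<in> borel_measurable borel" for n
        by (rule smooth_measurable) (rule smooth_pbump)
      show "box c d \<subseteq> {a<..<b}" using sub box_subset_cbox by blast
    qed (use box_borel in simp_all)
    moreover have "(LINT x:{a<..<b}|lborel. f x * pbump (b - a) c d n x) \<le> 0" for n
      by (rule nonpos[OF test pbump_nonneg])
    ultimately show ?thesis by (intro LIMSEQ_le_const2) auto
  qed
qed auto

section \<open>Essentially bounded functions and integrals over a cell\<close>

text \<open>In contrast to \<open>Linf\<close> and \<open>Linf_space\<close> this notion ignores
  periodicity and lives on an arbitrary set, so that one set of closure rules serves cells, strips
  and intervals.\<close>

definition ess_bounded :: "'a::euclidean_space set \<Rightarrow> ('a \<Rightarrow> real) \<Rightarrow> bool" where
  "ess_bounded S f \<longleftrightarrow> set_borel_measurable lborel S f \<and> (\<exists>M. AE z\<in>S in lborel. \<bar>f z\<bar> \<le> M)"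

lemma ess_bounded_const [simp]: "S \<in> sets borel \<Longrightarrow> ess_bounded S (\<lambda>_. c)"
  by (auto simp: ess_bounded_def set_borel_measurable_def intro!: exI[of _ "\<bar>c\<bar>"])

lemma ess_bounded_add [intro]:
  assumes "ess_bounded S f" "ess_bounded S g"
  shows "ess_bounded S (\<lambda>z. f z + g z)"
proof -
  from assms obtain M N where
    [measurable]: "(\<lambda>x. indicator S x *\<^sub>R f x) \<in> borel_measurable lborel" "(\<lambda>x. indicator S x *\<^sub>R g x) \<in> borel_measurable lborel"
    and b: "AE z\<in>S in lborel. \<bar>f z\<bar> \<le> M" "AE z\<in>S in lborel. \<bar>g z\<bar> \<le> N"
    by (auto simp: ess_bounded_def set_borel_measurable_def)
  have "(\<lambda>x. indicator S x *\<^sub>R f x + indicator S x *\<^sub>R g x) \<in> borel_measurable lborel" by measurable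
  moreover have "AE z\<in>S in lborel. \<bar>f z + g z\<bar> \<le> M + N"
    using b by eventually_elim auto
  ultimately show ?thesis
    by (auto simp: ess_bounded_def set_borel_measurable_def scaleR_right_distrib simp del: real_scaleR_def)
qed

lemma ess_bounded_mult [intro]:
  assumes "ess_bounded S f" "ess_bounded S g"
  shows "ess_bounded S (\<lambda>z. f z * g z)"
proof -
  from assms obtain M N where
    [measurable]: "(\<lambda>x. indicator S x *\<^sub>R f x) \<in> borel_measurable lborel" "(\<lambda>x. indicator S x *\<^sub>R g x) \<in> borel_measurable lborel"
    and b: "AE z\<in>S in lborel. \<bar>f z\<bar> \<le> M" "AE z\<in>S in lborel. \<bar>g z\<bar> \<le> N"
    by (auto simp: ess_bounded_def set_borel_measurable_def)
  have "(\<lambda>x. (indicator S x *\<^sub>R f x) * (indicator S x *\<^sub>R g x)) \<in> borel_measurable lborel" by measurable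
  also have "(\<lambda>x. (indicator S x *\<^sub>R f x) * (indicator S x *\<^sub>R g x)) = (\<lambda>x. indicator S x *\<^sub>R (f x * g x))"
    by (auto simp: indicator_def)
  finally have "(\<lambda>x. indicator S x *\<^sub>R (f x * g x)) \<in> borel_measurable lborel" .
  moreover have "AE z\<in>S in lborel. \<bar>f z * g z\<bar> \<le> M * N"
    using b by eventually_elim (auto simp: abs_mult intro!: mult_mono)
  ultimately show ?thesis
    by (auto simp: ess_bounded_def set_borel_measurable_def)
qed

lemma ess_bounded_cmult [intro]: "ess_bounded S f \<Longrightarrow> ess_bounded S (\<lambda>z. c * f z)"
proof -
  assume f: "ess_bounded S f"
  then obtain M where
    m: "(\<lambda>x. indicator S x *\<^sub>R f x) \<in> borel_measurable lborel"
    and b: "AE z\<in>S in lborel. \<bar>f z\<bar> \<le> M"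
    by (auto simp: ess_bounded_def set_borel_measurable_def)
  have "AE z\<in>S in lborel. \<bar>c * f z\<bar> \<le> \<bar>c\<bar> * M"
    using b by eventually_elim (auto simp: abs_mult intro!: mult_left_mono)
  then show ?thesis
    using borel_measurable_times[OF borel_measurable_const[of c] m]
    by (auto simp: ess_bounded_def set_borel_measurable_def mult.left_commute)
qed

lemma ess_bounded_uminus [intro]: "ess_bounded S f \<Longrightarrow> ess_bounded S (\<lambda>z. - f z)"
  using ess_bounded_cmult[of S f "-1"] by simp

lemma ess_bounded_diff [intro]: "ess_bounded S f \<Longrightarrow> ess_bounded S g \<Longrightarrow> ess_bounded S (\<lambda>z. f z - g z)"
  using ess_bounded_add[of S f "\<lambda>z. - g z"] by auto

lemma ess_bounded_divide [intro]: "ess_bounded S f \<Longrightarrow> ess_bounded S (\<lambda>z. f z / c)"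
  using ess_bounded_cmult[of S f "inverse c"] by (simp add: field_simps)

lemma ess_bounded_power2 [intro]: "ess_bounded S f \<Longrightarrow> ess_bounded S (\<lambda>z. (f z)\<^sup>2)"
  unfolding power2_eq_square by (rule ess_bounded_mult)

lemma ess_bounded_continuous:
  assumes "continuous_on UNIV f" "bounded S" "S \<in> sets borel"
  shows "ess_bounded S f"
proof -
  have "compact (closure S)" using assms(2) by simp
  then have "bounded (f ` closure S)"
    by (intro compact_imp_bounded compact_continuous_image continuous_on_subset[OF assms(1)]) auto
  then obtain M where "\<And>z. z \<in> closure S \<Longrightarrow> \<bar>f z\<bar> \<le> M"
    by (auto simp: bounded_iff)
  then have "AE z\<in>S in lborel. \<bar>f z\<bar> \<le> M"
    using closure_subset[of S] by (intro AE_I2) auto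
  moreover have "f \<in> borel_measurable borel" using assms(1) by (rule borel_measurable_continuous_onI)
  ultimately show ?thesis
    using assms(3) by (auto simp: ess_bounded_def set_borel_measurable_def)
qed

lemma cell_borel [simp]: "cell T a b \<in> sets borel"
  by (intro borel_open open_Times) auto

lemma bounded_cell [simp]: "bounded (cell T a b)"
  by (intro bounded_Times) auto

lemma ess_bounded_smooth [intro]:
  "smooth f \<Longrightarrow> ess_bounded (cell T a b) f"
  by (intro ess_bounded_continuous smooth_continuous) auto

lemma ess_bounded_subset:
  assumes "ess_bounded S f" "S' \<subseteq> S" "S' \<in> sets borel"
  shows "ess_bounded S' f"
proof -
  from assms obtain M where "AE z\<in>S in lborel. \<bar>f z\<bar> \<le> M" by (auto simp: ess_bounded_def)
  then have "AE z\<in>S' in lborel. \<bar>f z\<bar> \<le> M" by eventually_elim (use assms in auto)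
  then show ?thesis using assms set_borel_measurable_subset[of lborel S f S']
    by (auto simp: ess_bounded_def)
qed

lemma ess_bounded_integrable:
  assumes "ess_bounded S f" "bounded S" "S \<in> sets borel"
  shows "set_integrable lborel S f"
proof -
  from assms obtain M where
    m: "(\<lambda>x. indicator S x *\<^sub>R f x) \<in> borel_measurable lborel"
    and b: "AE z\<in>S in lborel. \<bar>f z\<bar> \<le> M"
    by (auto simp: ess_bounded_def set_borel_measurable_def)
  have "emeasure lborel S < \<infinity>" using emeasure_bounded_finite[OF assms(2)] .
  then have "integrable lborel (\<lambda>z. indicator S z * M)"
    using assms(3) by (intro integrable_mult_left integrable_real_indicator) auto
  then show ?thesis
    unfolding set_integrable_def using m
  proof (rule Bochner_Integration.integrable_bound)
    show "AE x in lborel. norm (indicator S x *\<^sub>R f x) \<le> norm (indicator S x * M)"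
      using b by eventually_elim (auto simp: indicator_def)
  qed
qed

lemma Linf_ess_bounded: "f \<in> Linf T a b \<Longrightarrow> ess_bounded (cell T a b) f"
proof -
  assume "f \<in> Linf T a b"
  then have "ess_bounded ({0<..<T} \<times> UNIV) f"
    by (auto simp: Linf_def ess_bounded_def)
  then show ?thesis by (rule ess_bounded_subset) auto
qed

lemma Linf_space_ess_bounded: "h \<in> Linf_space a b \<Longrightarrow> ess_bounded {a<..<b} h"
proof -
  assume h: "h \<in> Linf_space a b"
  then have [measurable]: "h \<in> borel_measurable borel" by (auto simp: Linf_space_def)
  have "set_borel_measurable lborel {a<..<b} h" unfolding set_borel_measurable_def by measurable
  then show ?thesis using h by (auto simp: Linf_space_def ess_bounded_def elim!: eventually_mono)
qed

lemma set_integral_le_AE: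
  fixes f g :: "'a::euclidean_space \<Rightarrow> real"
  assumes "set_integrable lborel S f" "set_integrable lborel S g"
    "AE z\<in>S in lborel. f z \<le> g z"
  shows "(LINT z:S|lborel. f z) \<le> (LINT z:S|lborel. g z)"
  using assms unfolding set_integrable_def set_lebesgue_integral_def
  by (intro integral_mono_AE) (auto simp: indicator_def elim!: eventually_mono)

lemma set_integral_const:
  fixes S :: "'a::euclidean_space set"
  assumes "bounded S" "S \<in> sets borel"
  shows "(LINT z:S|lborel. c) = c * measure lborel S"
  using emeasure_bounded_finite[OF assms(1)] assms(2)
  by (simp add: set_lebesgue_integral_def measure_def)

lemma abs_set_integral_le:
  fixes f :: "'a::euclidean_space \<Rightarrow> real"
  assumes f: "ess_bounded S f" and S: "bounded S" "S \<in> sets borel" and "AE z\<in>S in lborel. \<bar>f z\<bar> \<le> K"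
  shows "\<bar>LINT z:S|lborel. f z\<bar> \<le> K * measure lborel S"
proof -
  have "(LINT z:S|lborel. f z) \<le> (LINT z:S|lborel. K)"
    using assms by (intro set_integral_le_AE ess_bounded_integrable) (auto elim!: eventually_mono)
  moreover have "(LINT z:S|lborel. - K) \<le> (LINT z:S|lborel. f z)"
    using assms by (intro set_integral_le_AE ess_bounded_integrable) (auto elim!: eventually_mono)
  ultimately show ?thesis using S by (simp add: set_integral_const)
qed

lemma measure_cell: "0 \<le> T \<Longrightarrow> a \<le> b \<Longrightarrow> measure lborel (cell T a b) = T * (b - a)"
proof -
  assume "0 \<le> T" "a \<le> b"
  moreover have "cell T a b = box (0, a) (T, b)" by (auto simp: box_prod)
  ultimately show ?thesis
    by (simp add: measure_lborel_box_eq Basis_prod_def prod.union_disjoint inner_Pair_0)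
qed

section \<open>Iterated integrals and boundary terms\<close>

lemma set_integral_Times:
  fixes f :: "real \<times> real \<Rightarrow> real"
  assumes "set_integrable lborel (A \<times> B) f"
  shows "(LINT z:A \<times> B|lborel. f z) = (LINT t:A|lborel. LINT x:B|lborel. f (t, x))"
    and "(LINT z:A \<times> B|lborel. f z) = (LINT x:B|lborel. LINT t:A|lborel. f (t, x))"
    and "set_integrable lborel A (\<lambda>t. LINT x:B|lborel. f (t, x))"
    and "AE t in lborel. t \<in> A \<longrightarrow> set_integrable lborel B (\<lambda>x. f (t, x))"
proof -
  have int: "integrable (lborel \<Otimes>\<^sub>M lborel) (\<lambda>z. indicator (A \<times> B) z *\<^sub>R f z)"
    using assms by (simp add: set_integrable_def lborel_prod)
  have ind: "indicator (A \<times> B) (t, x) = (indicator A t * indicator B x :: real)" for t x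
    by (auto simp: indicator_def)
  have int': "integrable (lborel \<Otimes>\<^sub>M lborel) (\<lambda>(t, x). indicator (A \<times> B) (t, x) *\<^sub>R f (t, x))"
    using int by (simp add: case_prod_unfold)
  show "(LINT z:A \<times> B|lborel. f z) = (LINT t:A|lborel. LINT x:B|lborel. f (t, x))"
    using lborel_pair.integral_fst'[OF int]
    by (simp add: set_lebesgue_integral_def lborel_prod ind mult.assoc)
  show "(LINT z:A \<times> B|lborel. f z) = (LINT x:B|lborel. LINT t:A|lborel. f (t, x))"
  proof -
    have "(\<lambda>(t, x). indicator (A \<times> B) (t, x) *\<^sub>R f (t, x)) = (\<lambda>z. indicator (A \<times> B) z *\<^sub>R f z)"
      by auto
    then show ?thesis
      using lborel_pair.integral_snd[OF int']
      by (simp add: set_lebesgue_integral_def lborel_prod) (simp add: ind mult.assoc mult.left_commute[of "indicator A _"])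
  qed
  show "set_integrable lborel A (\<lambda>t. LINT x:B|lborel. f (t, x))"
    using lborel_pair.integrable_fst'[OF int]
    by (simp add: set_integrable_def set_lebesgue_integral_def ind mult.assoc)
  show "AE t in lborel. t \<in> A \<longrightarrow> set_integrable lborel B (\<lambda>x. f (t, x))"
    using lborel_pair.AE_integrable_fst'[OF int]
    by eventually_elim (auto simp: set_integrable_def ind)
qed

lemma set_integral_FTC:
  fixes F f :: "real \<Rightarrow> real"
  assumes "a \<le> b" "\<And>x. (F has_real_derivative f x) (at x)" "continuous_on UNIV f"
  shows "(LINT x:{a<..<b}|lborel. f x) = F b - F a"
proof -
  have "(\<integral>x. f x * indicator {a..b} x \<partial>lborel) = F b - F a"
    using assms by (intro integral_FTC_Icc_real) (auto simp: continuous_on_eq_continuous_at)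
  moreover have "(LINT x:{a<..<b}|lborel. f x) = (\<integral>x. f x * indicator {a..b} x \<partial>lborel)"
    unfolding set_lebesgue_integral_def
  proof (rule integral_cong_AE)
    have [measurable]: "f \<in> borel_measurable borel" using assms(3) by (rule borel_measurable_continuous_onI)
    show "(\<lambda>x. indicator {a<..<b} x *\<^sub>R f x) \<in> borel_measurable lborel"
      "(\<lambda>x. f x * indicator {a..b} x) \<in> borel_measurable lborel" by measurable
    have "AE x in lborel. x \<noteq> a \<and> x \<noteq> b"
      using AE_lborel_singleton[of a] AE_lborel_singleton[of b] by eventually_elim auto
    then show "AE x in lborel. indicator {a<..<b} x *\<^sub>R f x = f x * indicator {a..b} x"
      by eventually_elim (auto simp: indicator_def)
  qed
  ultimately show ?thesis by simp
qed

lemma smooth_set_integrable: "smooth f \<Longrightarrow> set_integrable lborel (cell T a b) f"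
  for f :: "real \<times> real \<Rightarrow> real"
  by (intro ess_bounded_integrable ess_bounded_smooth) auto

lemma smooth_continuous_slice:
  assumes "smooth f"
  shows "continuous_on S (\<lambda>x. f (t, x))" "continuous_on S (\<lambda>t. f (t, x))"
  by (rule smooth_continuous_compose[OF assms], intro continuous_intros)+

lemma cell_integral_dx:
  assumes "smooth F" "\<And>t x. F (t, x + (b - a)) = F (t, x)" "a \<le> b"
  shows "(LINT z:cell T a b|lborel. dx F z) = 0"
proof -
  have "(LINT x:{a<..<b}|lborel. dx F (t, x)) = F (t, b) - F (t, a)" for t
    using assms(3) smooth_dx_real[OF assms(1)] smooth_continuous_slice(1)[OF smooth_dx[OF assms(1)]]
    by (rule set_integral_FTC)
  moreover have "F (t, b) = F (t, a)" for t using assms(2)[of t a] by simp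
  ultimately show ?thesis
    by (simp add: set_integral_Times(1)[OF smooth_set_integrable[OF smooth_dx[OF assms(1)]]])
qed

lemma cell_integral_dt:
  assumes "smooth F" "0 \<le> T"
  shows "(LINT z:cell T a b|lborel. dt F z) = (LINT x:{a<..<b}|lborel. F (T, x) - F (0, x))"
proof -
  have "(LINT t:{0<..<T}|lborel. dt F (t, x)) = F (T, x) - F (0, x)" for x
    using assms(2) smooth_dt_real[OF assms(1)] smooth_continuous_slice(2)[OF smooth_dt[OF assms(1)]]
    by (rule set_integral_FTC)
  then show ?thesis
    by (simp add: set_integral_Times(2)[OF smooth_set_integrable[OF smooth_dt[OF assms(1)]]])
qed

section \<open>Mollification\<close>

lemma AE_open_dense:
  fixes U :: "'a::euclidean_space set"
  assumes "open U" "U \<noteq> {}" "AE x in lborel. x \<in> U \<longrightarrow> P x"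
  obtains x where "x \<in> U" "P x"
proof (rule ccontr)
  assume "\<not> thesis"
  with that have "AE x in lborel. x \<notin> U" using assms(3) by (auto elim!: eventually_mono)
  then have "U \<in> null_sets lborel" using assms(1) by (subst AE_iff_null_sets) auto
  then have "negligible U" by (simp add: negligible_iff_null_sets null_sets_completionI)
  with open_not_negligible[OF assms(1,2)] show False by blast
qed

text \<open>With the argument \<open>w - z\<close> the support of \<open>k\<close> shows directly
  where \<open>f\<close> is sampled relative to \<open>z\<close>; the price is one minus sign for
  every derivative.\<close>

definition conv :: "(real \<times> real) set \<Rightarrow> (real \<times> real \<Rightarrow> real) \<Rightarrow> (real \<times> real \<Rightarrow> real) \<Rightarrow> real \<times> real \<Rightarrow> real" where
  "conv S f k z = (LINT w:S|lborel. f w * k (w - z))"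

lemma ess_bounded_shift:
  fixes k :: "real \<times> real \<Rightarrow> real"
  assumes "smooth k" "bounded S" "S \<in> sets borel"
  shows "ess_bounded S (\<lambda>w. k (w - z))"
  by (rule ess_bounded_continuous[OF smooth_continuous_compose[OF assms(1)] assms(2,3)])
    (intro continuous_intros)

lemma conv_integrable:
  fixes k :: "real \<times> real \<Rightarrow> real"
  assumes "ess_bounded S f" "bounded S" "S \<in> sets borel" "smooth k"
  shows "set_integrable lborel S (\<lambda>w. f w * k (w - z))"
  by (rule ess_bounded_integrable[OF ess_bounded_mult[OF assms(1) ess_bounded_shift[OF assms(4,2,3)]] assms(2,3)])

text \<open>The mean value inequality is applied to \<open>k\<close> minus its linear part at
  \<open>p\<close>. The partial derivatives are uniformly continuous on the ball of radius
  \<open>R + 1\<close>; the additional 1 leaves room for the increment \<open>h\<close>.\<close>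

lemma linear_approx_uniform:
  fixes k :: "real \<times> real \<Rightarrow> real"
  assumes k: "smooth k" and "R \<ge> 0" "e > 0"
  obtains \<delta> where "\<delta> > 0" "\<And>p h. norm p \<le> R \<Longrightarrow> norm h < \<delta> \<Longrightarrow>
    \<bar>k (p - h) - k p + (fst h * dt k p + snd h * dx k p)\<bar> \<le> e * norm h"
proof -
  have "uniformly_continuous_on (cball 0 (R + 1)) (dt k)" "uniformly_continuous_on (cball 0 (R + 1)) (dx k)"
    by (auto intro!: compact_uniformly_continuous smooth_continuous smooth_dt smooth_dx k)
  then obtain d1 d2 where d: "d1 > 0" "d2 > 0"
    "\<And>p q. p \<in> cball 0 (R + 1) \<Longrightarrow> q \<in> cball 0 (R + 1) \<Longrightarrow> dist q p < d1 \<Longrightarrow> dist (dt k q) (dt k p) < e / 2"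
    "\<And>p q. p \<in> cball 0 (R + 1) \<Longrightarrow> q \<in> cball 0 (R + 1) \<Longrightarrow> dist q p < d2 \<Longrightarrow> dist (dx k q) (dx k p) < e / 2"
    unfolding uniformly_continuous_on_def using \<open>e > 0\<close> by (metis half_gt_zero)
  show thesis
  proof (rule that)
    show "min 1 (min d1 d2) > 0" using d by simp
    fix p h :: "real \<times> real" assume p: "norm p \<le> R" and h: "norm h < min 1 (min d1 d2)"
    define B where "B = cball p (norm h)"
    have B: "q \<in> cball 0 (R + 1)" "dist q p < d1" "dist q p < d2" if "q \<in> B" for q
    proof -
      have "norm q \<le> norm p + norm (q - p)" using norm_triangle_ineq[of p "q - p"] by simp
      then show "q \<in> cball 0 (R + 1)" using that p h by (auto simp: B_def dist_norm norm_minus_commute)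
      show "dist q p < d1" "dist q p < d2" using that h by (auto simp: B_def dist_commute)
    qed
    have pB: "p \<in> cball 0 (R + 1)" using p by simp
    define g where "g q = k q - (fst q * dt k p + snd q * dx k p)" for q
    have "(g has_derivative (\<lambda>h. (fst h * dt k q + snd h * dx k q) - (fst h * dt k p + snd h * dx k p))) (at q within B)" for q
      unfolding g_def
      by (intro has_derivative_diff has_derivative_at_withinI[OF smooth_has_derivative_dt_dx[OF k]])
        (auto intro!: derivative_eq_intros)
    moreover have "onorm (\<lambda>h. (fst h * dt k q + snd h * dx k q) - (fst h * dt k p + snd h * dx k p)) \<le> e" if "q \<in> B" for q
    proof (rule onorm_bound)
      fix v :: "real \<times> real"
      have e: "\<bar>dt k q - dt k p\<bar> \<le> e / 2" "\<bar>dx k q - dx k p\<bar> \<le> e / 2"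
        using d(3)[OF pB B(1)[OF that] B(2)[OF that]] d(4)[OF pB B(1)[OF that] B(3)[OF that]]
        by (auto simp: dist_real_def)
      have "norm ((fst v * dt k q + snd v * dx k q) - (fst v * dt k p + snd v * dx k p))
          = \<bar>fst v * (dt k q - dt k p) + snd v * (dx k q - dx k p)\<bar>"
        by (simp add: algebra_simps)
      also have "\<dots> \<le> \<bar>fst v\<bar> * \<bar>dt k q - dt k p\<bar> + \<bar>snd v\<bar> * \<bar>dx k q - dx k p\<bar>"
        by (metis abs_mult abs_triangle_ineq)
      also have "\<dots> \<le> norm v * (e / 2) + norm v * (e / 2)"
        using e norm_fst_le[of "fst v" "snd v"] norm_snd_le[of "snd v" "fst v"]
        by (intro add_mono mult_mono) auto
      finally show "norm ((fst v * dt k q + snd v * dx k q) - (fst v * dt k p + snd v * dx k p)) \<le> e * norm v"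
        by (simp add: algebra_simps)
    qed (use \<open>e > 0\<close> in simp)
    ultimately have "norm (g (p - h) - g p) \<le> e * norm (p - h - p)"
      by (intro differentiable_bound[where S = B]) (auto simp: B_def dist_norm)
    then show "\<bar>k (p - h) - k p + (fst h * dt k p + snd h * dx k p)\<bar> \<le> e * norm h"
      by (simp add: g_def algebra_simps)
  qed
qed

text \<open>The linear approximation of the kernel is uniform over the bounded set \<open>S\<close>
  and hence survives integration against \<open>f\<close>. The tolerance is
  \<open>e / (I + 1)\<close>, where \<open>I\<close> is the integral of the absolute value of
  \<open>f\<close>.\<close>

lemma conv_has_derivative:
  assumes f: "ess_bounded S f" and S: "bounded S" "S \<in> sets borel" and k: "smooth k"
  shows "(conv S f k has_derivative (\<lambda>h. fst h * (- conv S f (dt k) z) + snd h * (- conv S f (dx k) z))) (at z)"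
  unfolding has_derivative_at_alt
proof (intro conjI allI impI)
  show "bounded_linear (\<lambda>h. fst h * (- conv S f (dt k) z) + snd h * (- conv S f (dx k) z))"
    by (intro bounded_linear_add bounded_linear_mult_left[THEN bounded_linear_compose] bounded_linear_fst bounded_linear_snd)
  fix e :: real assume "e > 0"
  define I where "I = (LINT w:S|lborel. \<bar>f w\<bar>)"
  have fi: "set_integrable lborel S f" using f S by (rule ess_bounded_integrable)
  then have fa: "set_integrable lborel S (\<lambda>w. \<bar>f w\<bar>)" by (rule set_integrable_abs)
  have I: "I \<ge> 0" unfolding I_def set_lebesgue_integral_def by (intro integral_nonneg_AE) auto
  obtain R where R: "R \<ge> 0" "\<And>w. w \<in> S \<Longrightarrow> norm (w - z) \<le> R"
  proof -
    obtain B where B: "\<And>w. w \<in> S \<Longrightarrow> norm w \<le> B" using S(1) by (auto simp: bounded_iff)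
    show ?thesis
      by (rule that[of "\<bar>B\<bar> + norm z"]) (use B norm_triangle_ineq4[of _ z] in \<open>auto, smt\<close>)
  qed
  obtain \<delta> where \<delta>: "\<delta> > 0" "\<And>p h. norm p \<le> R \<Longrightarrow> norm h < \<delta> \<Longrightarrow>
    \<bar>k (p - h) - k p + (fst h * dt k p + snd h * dx k p)\<bar> \<le> e / (I + 1) * norm h"
    using linear_approx_uniform[OF k R(1), of "e / (I + 1)"] \<open>e > 0\<close> I by auto
  show "\<exists>d>0. \<forall>y. norm (y - z) < d \<longrightarrow> norm (conv S f k y - conv S f k z
    - (fst (y - z) * (- conv S f (dt k) z) + snd (y - z) * (- conv S f (dx k) z))) \<le> e * norm (y - z)"
  proof (intro exI[of _ \<delta>] conjI allI impI)
    fix y assume y: "norm (y - z) < \<delta>"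
    define h where "h = y - z"
    let ?r = "\<lambda>w. k (w - z - h) - k (w - z) + (fst h * dt k (w - z) + snd h * dx k (w - z))"
    have ik: "set_integrable lborel S (\<lambda>w. f w * k (w - z))" "set_integrable lborel S (\<lambda>w. f w * k (w - y))"
      "set_integrable lborel S (\<lambda>w. fst h * (f w * dt k (w - z)))" "set_integrable lborel S (\<lambda>w. snd h * (f w * dx k (w - z)))"
      by (intro set_integrable_mult_right impI conv_integrable f S smooth_dt smooth_dx k)+
    have "(LINT w:S|lborel. f w * ?r w)
        = (LINT w:S|lborel. (f w * k (w - y) - f w * k (w - z)) + (fst h * (f w * dt k (w - z)) + snd h * (f w * dx k (w - z))))"
      by (simp add: h_def algebra_simps)
    also have "\<dots> = (conv S f k y - conv S f k z) + (fst h * conv S f (dt k) z + snd h * conv S f (dx k) z)"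
      using ik by (simp add: conv_def set_integral_add set_integral_diff)
    finally have eq: "conv S f k y - conv S f k z - (fst h * (- conv S f (dt k) z) + snd h * (- conv S f (dx k) z))
        = (LINT w:S|lborel. f w * ?r w)" by simp
    have ir: "set_integrable lborel S (\<lambda>w. f w * ?r w)"
    proof -
      have "set_integrable lborel S (\<lambda>w. (f w * k (w - y) - f w * k (w - z)) + (fst h * (f w * dt k (w - z)) + snd h * (f w * dx k (w - z))))"
        using ik by (intro set_integral_add(1) set_integral_diff(1))
      then show ?thesis by (simp add: h_def algebra_simps)
    qed
    have "norm (LINT w:S|lborel. f w * ?r w) \<le> (LINT w:S|lborel. norm (f w * ?r w))"
      using ir by (rule set_integral_norm_bound)
    also have "\<dots> \<le> (LINT w:S|lborel. \<bar>f w\<bar> * (e / (I + 1) * norm h))"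
    proof (intro set_integral_mono set_integrable_norm set_integrable_mult_left impI fa ir)
      fix w assume "w \<in> S"
      then have "\<bar>?r w\<bar> \<le> e / (I + 1) * norm h"
        using R(2)[of w] \<delta>(2)[of "w - z" h] y by (simp add: h_def)
      then show "norm (f w * ?r w) \<le> \<bar>f w\<bar> * (e / (I + 1) * norm h)"
        unfolding real_norm_def abs_mult by (rule mult_left_mono) simp
    qed
    also have "\<dots> = I * (e / (I + 1) * norm h)" by (simp add: I_def)
    also have "\<dots> \<le> (I + 1) * (e / (I + 1) * norm h)"
      using \<open>e > 0\<close> I by (intro mult_right_mono) auto
    also have "\<dots> = e * norm h" using I by simp
    finally show "norm (conv S f k y - conv S f k z - (fst (y - z) * (- conv S f (dt k) z) + snd (y - z) * (- conv S f (dx k) z)))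
        \<le> e * norm (y - z)"
      unfolding h_def[symmetric] eq .
  qed (fact \<delta>(1))
qed

lemma dt_dx_conv:
  assumes "ess_bounded S f" "bounded S" "S \<in> sets borel" "smooth k"
  shows "dt (conv S f k) = (\<lambda>z. - conv S f (dt k) z)" "dx (conv S f k) = (\<lambda>z. - conv S f (dx k) z)"
  using conv_has_derivative[OF assms]
  by (auto simp: fun_eq_iff simp del: split_paired_All intro!: dt_eq[THEN trans] dx_eq[THEN trans])

text \<open>A directional derivative of a convolution is again a convolution of the same
  \<open>f\<close> with a smooth kernel, so the class of all these convolutions is closed under
  differentiation.\<close>

lemma smooth_conv:
  assumes f: "ess_bounded S f" and S: "bounded S" "S \<in> sets borel" and k: "smooth k"
  shows "smooth (conv S f k)"
proof (rule smooth_coinduct[where P = "\<lambda>F. \<exists>k. smooth k \<and> F = conv S f k"])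
  show "\<exists>k'. smooth k' \<and> conv S f k = conv S f k'" using k by blast
  fix F assume "\<exists>k. smooth k \<and> F = conv S f k"
  then obtain k where k: "smooth k" and F: "F = conv S f k" by blast
  note d = conv_has_derivative[OF f S k]
  have "\<exists>k'. smooth k' \<and> (\<lambda>z. frechet_derivative F (at z) v) = conv S f k'" for v
  proof (intro exI conjI)
    show "smooth (\<lambda>w. (- fst v) * dt k w + (- snd v) * dx k w)"
      using k by (intro smooth_add smooth_cmult) auto
    have "set_integrable lborel S (\<lambda>w. (- fst v) * (f w * dt k (w - z)))" "set_integrable lborel S (\<lambda>w. (- snd v) * (f w * dx k (w - z)))" for z
      by (intro set_integrable_mult_right impI conv_integrable f S smooth_dt smooth_dx k)+
    note lin = set_integral_add(2)[OF this]
    show "(\<lambda>z. frechet_derivative F (at z) v) = conv S f (\<lambda>w. (- fst v) * dt k w + (- snd v) * dx k w)"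
    proof
      fix z
      have "conv S f (\<lambda>w. (- fst v) * dt k w + (- snd v) * dx k w) z
        = (LINT w:S|lborel. (- fst v) * (f w * dt k (w - z)) + (- snd v) * (f w * dx k (w - z)))"
        by (simp add: conv_def algebra_simps)
      also have "\<dots> = frechet_derivative F (at z) v"
        unfolding lin F frechet_eq[OF d] conv_def set_integral_mult_right by simp
      finally show "frechet_derivative F (at z) v = conv S f (\<lambda>w. (- fst v) * dt k w + (- snd v) * dx k w) z" ..
    qed
  qed
  then show "F differentiable_on UNIV \<and> (\<forall>v. \<exists>k. smooth k \<and> (\<lambda>z. frechet_derivative F (at z) v) = conv S f k)"
    using d by (auto simp: F differentiable_on_def intro!: differentiableI)
qed

text \<open>\<open>V i j\<close> plays the role of \<open>\<partial>\<^sub>t\<^sup>i \<partial>\<^sub>x\<^sup>j U\<close> for a smooth periodic \<open>U = V 0 0\<close>.\<close>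
definition smooth_family :: "real \<Rightarrow> (nat \<Rightarrow> nat \<Rightarrow> real \<times> real \<Rightarrow> real) \<Rightarrow> bool" where
  "smooth_family L V \<longleftrightarrow> (\<forall>i j. smooth (V i j) \<and> dt (V i j) = V (Suc i) j \<and> dx (V i j) = V i (Suc j) \<and>
     (\<forall>t x. V i j (t, x + L) = V i j (t, x)))"

lemma deriv_tensor:
  fixes \<eta> \<zeta> :: "real \<Rightarrow> real"
  assumes "smooth \<eta>" "smooth \<zeta>"
  shows "smooth (\<lambda>w. \<eta> (fst w - t) * \<zeta> (snd w - x))"
    "dt (\<lambda>w. \<eta> (fst w - t) * \<zeta> (snd w - x)) = (\<lambda>w. deriv \<eta> (fst w - t) * \<zeta> (snd w - x))"
    "dx (\<lambda>w. \<eta> (fst w - t) * \<zeta> (snd w - x)) = (\<lambda>w. \<eta> (fst w - t) * deriv \<zeta> (snd w - x))"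
proof -
  have sm: "smooth (\<lambda>w::real \<times> real. fst w - t)" "smooth (\<lambda>w::real \<times> real. snd w - x)"
    by (auto intro!: smooth_diff)
  have "((\<lambda>w. fst w - t) has_derivative fst) (at w)" "((\<lambda>w. snd w - x) has_derivative snd) (at w)"
    for w :: "real \<times> real"
    by (auto intro!: derivative_eq_intros)
  note d = this[THEN dt_eq] this[THEN dx_eq]
  note s = smooth_compose[OF assms(1) sm(1)] smooth_compose[OF assms(2) sm(2)]
  show "smooth (\<lambda>w. \<eta> (fst w - t) * \<zeta> (snd w - x))" by (rule smooth_mult[OF s])
  show "dt (\<lambda>w. \<eta> (fst w - t) * \<zeta> (snd w - x)) = (\<lambda>w. deriv \<eta> (fst w - t) * \<zeta> (snd w - x))"
    "dx (\<lambda>w. \<eta> (fst w - t) * \<zeta> (snd w - x)) = (\<lambda>w. \<eta> (fst w - t) * deriv \<zeta> (snd w - x))"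
    using dt_dx_compose[OF sm(1) assms(1)] dt_dx_compose[OF sm(2) assms(2)]
    by (simp_all add: dt_dx_mult[OF s] d)
qed

lemma deriv_tensor_iter:
  fixes \<eta> \<zeta> :: "real \<Rightarrow> real"
  assumes "smooth \<eta>" "smooth \<zeta>"
  shows "(dt ^^ i) ((dx ^^ j) (\<lambda>w. \<eta> (fst w - t) * \<zeta> (snd w - x)))
    = (\<lambda>w. (deriv ^^ i) \<eta> (fst w - t) * (deriv ^^ j) \<zeta> (snd w - x))"
proof -
  have x: "(dx ^^ j) (\<lambda>w. \<eta> (fst w - t) * \<zeta> (snd w - x)) = (\<lambda>w. \<eta> (fst w - t) * (deriv ^^ j) \<zeta> (snd w - x))"
    by (induction j) (simp_all add: deriv_tensor(3)[OF assms(1) smooth_deriv_iter[OF assms(2)]])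
  show ?thesis
    unfolding x
    by (induction i) (simp_all add: deriv_tensor(2)[OF smooth_deriv_iter[OF assms(1)] smooth_deriv_iter[OF assms(2)]])
qed

lemma deriv_periodic:
  fixes f :: "real \<Rightarrow> real"
  assumes "smooth f" "\<And>x. f (x + L) = f x"
  shows "deriv f (x + L) = deriv f x"
proof -
  have "((\<lambda>x. f (x + L)) has_real_derivative deriv f (x + L)) (at x)"
    using smooth_has_real_derivative[OF assms(1), of "x + L"] by (simp add: DERIV_shift)
  then show ?thesis
    using assms(2) smooth_has_real_derivative[OF assms(1), of x] DERIV_unique by simp
qed

lemma deriv_iter_periodic:
  fixes f :: "real \<Rightarrow> real"
  assumes "smooth f" "\<And>x. f (x + L) = f x"
  shows "(deriv ^^ j) f (x + L) = (deriv ^^ j) f x"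
  by (induction j arbitrary: x) (auto intro!: deriv_periodic smooth_deriv_iter assms simp: assms(2))

lemma weak_deriv_self: "u \<in> Linf T a b \<Longrightarrow> weak_deriv T a b 0 0 u u"
  by (simp add: weak_deriv_def)

text \<open>The kernel looks forward in time, so that the mollification is defined up to \<open>t = 0\<close>, and it is
  periodic in space, so that its translates are admissible test functions.\<close>
lemma mollification:
  assumes "a < b" "0 < \<epsilon>" "\<epsilon> \<le> (b - a) / 2" "0 \<le> T'" "T' + 2 * \<epsilon> < T"
    and u: "ess_bounded (cell T a b) u"
  obtains K V where "smooth K" "\<And>w. K w \<ge> 0"
    "\<And>z. fst z \<in> {0..T'} \<Longrightarrow> (LINT w:cell T a b|lborel. K (w - z)) = 1"
    "\<And>w. K w \<noteq> 0 \<Longrightarrow> \<epsilon> < fst w \<and> fst w < 2 * \<epsilon> \<and> (\<exists>m::int. \<bar>snd w - of_int m * (b - a)\<bar> < \<epsilon>)"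
    "\<And>z. fst z \<in> {0..T'} \<Longrightarrow> (\<lambda>w. K (w - z)) \<in> test_interior T a b"
    "smooth_family (b - a) V"
    "\<And>i j g z. weak_deriv T a b i j u g \<Longrightarrow> fst z \<in> {0..T'} \<Longrightarrow>
      V i j z = (LINT w:cell T a b|lborel. g w * K (w - z))"
proof -
  define L where "L = b - a"
  have L: "L > 0" "L \<noteq> 0" using assms by (auto simp: L_def)
  define \<eta> where "\<eta> = bump \<epsilon> (2 * \<epsilon>) 1"
  define \<zeta>0 where "\<zeta>0 = (\<lambda>y. flat (cos_well L \<epsilon> y))"
  have sm: "smooth \<eta>" "smooth \<zeta>0"
    unfolding \<eta>_def \<zeta>0_def by (auto intro!: smooth_compose[OF smooth_flat])
  define N where "N z = (LINT w:cell T a b|lborel. \<eta> (fst w - fst z) * \<zeta>0 (snd w - snd z))" for z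
  define k0 where "k0 w = \<eta> (fst w) * \<zeta>0 (snd w)" for w
  have k0: "smooth k0" "dt k0 = (\<lambda>w. deriv \<eta> (fst w) * \<zeta>0 (snd w))" "dx k0 = (\<lambda>w. \<eta> (fst w) * deriv \<zeta>0 (snd w))"
    using deriv_tensor[OF sm, of 0 0] unfolding k0_def[abs_def] by simp_all
  have one: "ess_bounded (cell T a b) (\<lambda>_. 1)" by simp
  have N: "N = conv (cell T a b) (\<lambda>_. 1) k0"
    by (auto simp: N_def conv_def k0_def fun_eq_iff)
  have \<zeta>per: "\<zeta>0 (y + L) = \<zeta>0 y" for y
    using cos_well_periodic[OF L(2)] by (simp add: \<zeta>0_def)
  \<comment> \<open>The mass of the unnormalised kernel does not depend on the centre: its
    derivatives are integrals of \<open>dt F\<close> and \<open>dx F\<close>. The first has no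
    boundary values, since the kernel lives at times between \<open>fst z + \<epsilon>\<close> and
    \<open>fst z + 2 * \<epsilon>\<close>; the second vanishes by periodicity. Hence a single
    constant normalises all translates.\<close>
  have dN: "(N has_derivative (\<lambda>h. 0)) (at z)" if z: "fst z \<in> {0..T'}" for z
  proof -
    define F where "F w = \<eta> (fst w - fst z) * \<zeta>0 (snd w - snd z)" for w
    have F: "smooth F" "dt F = (\<lambda>w. deriv \<eta> (fst w - fst z) * \<zeta>0 (snd w - snd z))"
      "dx F = (\<lambda>w. \<eta> (fst w - fst z) * deriv \<zeta>0 (snd w - snd z))"
      using deriv_tensor[OF sm, of "fst z" "snd z"] unfolding F_def[abs_def] by simp_all
    have Fper: "F (t, x + (b - a)) = F (t, x)" for t x
      using \<zeta>per[of "x - snd z"] by (simp add: F_def L_def algebra_simps)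
    have "conv (cell T a b) (\<lambda>_. 1) (dt k0) z = (LINT w:cell T a b|lborel. dt F w)"
      by (simp add: conv_def k0 F)
    also have "\<dots> = (LINT x:{a<..<b}|lborel. F (T, x) - F (0, x))"
      using assms by (intro cell_integral_dt F) auto
    also have "\<dots> = 0"
    proof -
      have "F (T, x) = 0" "F (0, x) = 0" for x
        using z assms by (auto simp: F_def \<eta>_def intro!: bump_eq_0)
      then show ?thesis by simp
    qed
    finally have 1: "conv (cell T a b) (\<lambda>_. 1) (dt k0) z = 0" .
    have "conv (cell T a b) (\<lambda>_. 1) (dx k0) z = (LINT w:cell T a b|lborel. dx F w)"
      by (simp add: conv_def k0 F)
    also have "\<dots> = 0"
      using assms(1) by (intro cell_integral_dx F Fper) auto
    finally have 2: "conv (cell T a b) (\<lambda>_. 1) (dx k0) z = 0" .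
    show ?thesis
      using conv_has_derivative[OF one bounded_cell cell_borel k0(1), of z] 1 2 by (simp add: N)
  qed
  have "\<exists>c. \<forall>z\<in>{0..T'} \<times> UNIV. N z = c"
    by (rule has_derivative_zero_constant)
      (auto intro!: convex_Times has_derivative_at_withinI[OF dN])
  then obtain c where c: "\<And>z. fst z \<in> {0..T'} \<Longrightarrow> N z = c" by (auto simp: mem_Times_iff)
  \<comment> \<open>The integrand is continuous and nonnegative, and positive at time
    \<open>3 / 2 * \<epsilon>\<close> in the middle of the interval.\<close>
  have "c > 0"
  proof -
    define z0 :: "real \<times> real" where "z0 = (0, (a + b) / 2)"
    have cN: "c = N z0" using c[of z0] assms by (simp add: z0_def)
    have cont: "continuous_on UNIV (\<lambda>w. k0 (w - z0))"
      by (rule smooth_continuous_compose[OF k0(1)]) (intro continuous_intros)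
    have int: "set_integrable lborel (cell T a b) (\<lambda>w. k0 (w - z0))"
      using cont by (intro ess_bounded_integrable ess_bounded_continuous) auto
    have nn: "k0 w \<ge> 0" for w by (simp add: k0_def \<eta>_def \<zeta>0_def bump_nonneg flat_nonneg)
    then have "N z0 \<ge> 0"
      unfolding N conv_def set_lebesgue_integral_def by (intro integral_nonneg_AE) (auto simp: indicator_def)
    moreover have "N z0 \<noteq> 0"
    proof
      assume "N z0 = 0"
      then have "AE w in lborel. indicator (cell T a b) w *\<^sub>R k0 (w - z0) = 0"
        using int nn unfolding N conv_def set_lebesgue_integral_def set_integrable_def
        by (subst (asm) integral_nonneg_eq_0_iff_AE) (auto simp: indicator_def)
      then have ae: "AE w in lborel. w \<in> cell T a b \<inter> (\<lambda>w. k0 (w - z0)) -` {0<..} \<longrightarrow> False"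
        by eventually_elim (auto simp: indicator_def)
      have "open (cell T a b \<inter> (\<lambda>w. k0 (w - z0)) -` {0<..})"
        by (intro open_Int open_Times open_vimage cont) auto
      moreover have "(3 / 2 * \<epsilon>, (a + b) / 2) \<in> cell T a b \<inter> (\<lambda>w. k0 (w - z0)) -` {0<..}"
      proof -
        have "\<eta> (3 / 2 * \<epsilon>) > 0" using assms by (simp add: \<eta>_def bump_def flat_pos_iff)
        moreover have "\<zeta>0 0 > 0" using assms L cos_well_pos[of L 0 \<epsilon>] by (simp add: \<zeta>0_def flat_pos_iff L_def)
        ultimately have "k0 ((3 / 2 * \<epsilon>, (a + b) / 2) - z0) > 0" by (simp add: k0_def z0_def)
        then show ?thesis using assms by simp
      qed
      ultimately show False using AE_open_dense[OF _ _ ae] by blast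
    qed
    ultimately show ?thesis using cN by simp
  qed
  define \<zeta> where "\<zeta> y = inverse c * \<zeta>0 y" for y
  have s\<zeta>: "smooth \<zeta>" unfolding \<zeta>_def[abs_def] by (intro smooth_cmult sm)
  have p\<zeta>: "\<zeta> (y + L) = \<zeta> y" for y by (simp add: \<zeta>_def \<zeta>per)
  define k where "k i j = (\<lambda>w. (deriv ^^ i) \<eta> (fst w) * (deriv ^^ j) \<zeta> (snd w))" for i j
  have k: "smooth (k i j)" "dt (k i j) = k (Suc i) j" "dx (k i j) = k i (Suc j)" for i j
    using deriv_tensor[OF smooth_deriv_iter[OF sm(1), of i] smooth_deriv_iter[OF s\<zeta>, of j], of 0 0]
    unfolding k_def[abs_def] by simp_all
  define K where "K = k 0 0"
  \<comment> \<open>The sign compensates the factor \<open>-1\<close> that every derivative of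
    \<open>conv\<close> produces.\<close>
  define V where "V i j = (\<lambda>z. (-1) ^ (i + j) * conv (cell T a b) u (k i j) z)" for i j
  have K: "K w = \<eta> (fst w) * \<zeta> (snd w)" for w by (simp add: K_def k_def)
  have Kz: "(\<lambda>w. K (w - z)) = (\<lambda>w. \<eta> (fst w - fst z) * \<zeta> (snd w - snd z))" for z
    by (simp add: K fun_eq_iff)
  have Ksupp: "\<epsilon> < fst w \<and> fst w < 2 * \<epsilon> \<and> (\<exists>m::int. \<bar>snd w - of_int m * (b - a)\<bar> < \<epsilon>)" if "K w \<noteq> 0" for w
  proof -
    have "\<eta> (fst w) \<noteq> 0" "\<zeta>0 (snd w) \<noteq> 0" using that by (auto simp: K \<zeta>_def)
    then have "\<epsilon> < fst w" "fst w < 2 * \<epsilon>" "cos_well L \<epsilon> (snd w) > 0"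
      using bump_eq_0[of "fst w" \<epsilon> "2 * \<epsilon>" 1] by (auto simp: \<eta>_def \<zeta>0_def flat_eq_0_iff not_le[symmetric])
    moreover from this(3) obtain m :: int where "\<bar>snd w - of_int m * L\<bar> < \<epsilon>"
      using assms L by (elim cos_well_pos_imp[rotated -1]) (auto simp: L_def)
    ultimately show ?thesis by (auto simp: L_def)
  qed
  have Ktest: "(\<lambda>w. K (w - z)) \<in> test_interior T a b" if z: "fst z \<in> {0..T'}" for z
  proof -
    have "smooth (\<lambda>w. K (w - z))" unfolding Kz by (rule deriv_tensor(1)[OF sm(1) s\<zeta>])
    moreover have "K ((t, x + (b - a)) - z) = K ((t, x) - z)" for t x
      using p\<zeta>[of "x - snd z"] by (simp add: K L_def algebra_simps)
    moreover have "K ((t, x) - z) = 0" if "t \<ge> T' + 2 * \<epsilon>" for t x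
      using Ksupp[of "(t, x) - z"] that z by auto
    moreover have "K ((t, x) - z) = 0" if "t \<le> \<epsilon>" for t x
      using Ksupp[of "(t, x) - z"] that z by auto
    ultimately show ?thesis
      using assms(2,5) unfolding test_interior_def test_init_def
      by (intro CollectI conjI allI exI[of _ \<epsilon>] exI[of _ "T' + 2 * \<epsilon>"]) auto
  qed
  show thesis
  proof (rule that[of K V])
    show "smooth K" unfolding K_def by (rule k)
    show "K w \<ge> 0" for w
      using \<open>c > 0\<close> by (simp add: K \<eta>_def \<zeta>_def \<zeta>0_def bump_nonneg flat_nonneg)
    show "(LINT w:cell T a b|lborel. K (w - z)) = 1" if "fst z \<in> {0..T'}" for z
    proof -
      have "(LINT w:cell T a b|lborel. K (w - z)) = (LINT w:cell T a b|lborel. inverse c * k0 (w - z))"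
        by (simp add: K k0_def \<zeta>_def algebra_simps)
      also have "\<dots> = inverse c * N z" by (simp add: N conv_def)
      finally show ?thesis using c[OF that] \<open>c > 0\<close> by simp
    qed
    show "\<epsilon> < fst w \<and> fst w < 2 * \<epsilon> \<and> (\<exists>m::int. \<bar>snd w - of_int m * (b - a)\<bar> < \<epsilon>)" if "K w \<noteq> 0" for w
      using Ksupp[OF that] .
    show "(\<lambda>w. K (w - z)) \<in> test_interior T a b" if "fst z \<in> {0..T'}" for z
      using Ktest[OF that] .
    have sc: "smooth (conv (cell T a b) u (k i j))" for i j
      by (intro smooth_conv u bounded_cell cell_borel k)
    have "V i j (t, x + L) = V i j (t, x)" for i j t x
    proof -
      have per: "k i j (w - (t, x + L)) = k i j (w - (t, x))" for w
        using deriv_iter_periodic[OF s\<zeta> p\<zeta>, of j "snd w - x - L"]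
        by (simp add: k_def algebra_simps)
      show ?thesis by (simp add: V_def conv_def per)
    qed
    moreover have "smooth (V i j)" for i j
      unfolding V_def by (rule smooth_cmult[OF sc])
    moreover have "dt (V i j) = V (Suc i) j" "dx (V i j) = V i (Suc j)" for i j
      unfolding V_def dt_dx_cmult[OF sc] dt_dx_conv[OF u bounded_cell cell_borel k(1)] k by simp_all
    ultimately show "smooth_family (b - a) V"
      by (simp add: smooth_family_def L_def)
    show "V i j z = (LINT w:cell T a b|lborel. g w * K (w - z))"
      if "weak_deriv T a b i j u g" "fst z \<in> {0..T'}" for i j g z
    proof -
      \<comment> \<open>The translated kernel is an admissible test function, so its derivatives can
        be moved onto \<open>u\<close>; the resulting sign cancels the one in
        \<open>V\<close>.\<close>
      have "(LINT w:cell T a b|lborel. u w * (dt ^^ i) ((dx ^^ j) (\<lambda>w. K (w - z))) w)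
          = (-1) ^ (i + j) * (LINT w:cell T a b|lborel. g w * K (w - z))"
        using that Ktest[OF that(2)] unfolding weak_deriv_def by blast
      moreover have "(dt ^^ i) ((dx ^^ j) (\<lambda>w. K (w - z))) w = k i j (w - z)" for w
        unfolding Kz deriv_tensor_iter[OF sm(1) s\<zeta>] by (simp add: k_def)
      ultimately have "conv (cell T a b) u (k i j) z = (-1) ^ (i + j) * (LINT w:cell T a b|lborel. g w * K (w - z))"
        by (simp add: conv_def)
      then show ?thesis by (simp add: V_def flip: mult.assoc power_mult_distrib)
    qed
  qed
qed

section \<open>Continuous representatives and uniform continuity modulo the period\<close>

lemma periodic_of_int:
  fixes f :: "real \<Rightarrow> 'a"
  assumes "\<And>x. f (x + L) = f x"
  shows "f (x + of_int m * L) = f x"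
proof -
  have n: "f (x + of_nat n * L) = f x" for n x
  proof (induction n)
    case (Suc n)
    have "f (x + of_nat (Suc n) * L) = f ((x + of_nat n * L) + L)" by (simp add: algebra_simps)
    with Suc show ?case by (simp only: assms)
  qed simp
  show ?thesis
  proof (cases "m \<ge> 0")
    case True
    then show ?thesis using n[of x "nat m"] by simp
  next
    case False
    then show ?thesis using n[of "x + of_int m * L" "nat (- m)"] by simp
  qed
qed

text \<open>The point may lie on the initial line. If the bound failed there, it would also fail at
  nearby points of positive time and therefore on a nonempty open set, which is not null.\<close>

lemma AE_continuous_le:
  fixes g :: "real \<times> real \<Rightarrow> real"
  assumes g: "continuous_on ({0..<T} \<times> UNIV) g"
    and ae: "AE z\<in>{0<..<T} \<times> UNIV in lborel. g z \<le> c" and z: "z \<in> {0..<T} \<times> UNIV"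
  shows "g z \<le> c"
proof (rule ccontr)
  assume "\<not> g z \<le> c"
  obtain A where A: "open A" "A \<inter> ({0..<T} \<times> UNIV) = g -` {c<..} \<inter> ({0..<T} \<times> UNIV)"
    using g[unfolded continuous_on_open_invariant, rule_format, OF open_greaterThan, of c] by blast
  with \<open>\<not> g z \<le> c\<close> z have "z \<in> A" by auto
  then obtain e where e: "e > 0" "ball z e \<subseteq> A" using A(1) open_contains_ball by blast
  obtain t x where tx: "z = (t, x)" by (cases z)
  define d where "d = min (e / 2) ((T - t) / 2)"
  have d: "0 < d" "d < e" "t + d < T" using e z by (auto simp: d_def tx min_def field_simps)
  have "(t + d, x) \<in> ball z e" using d by (simp add: tx dist_norm norm_Pair)
  then have "(t + d, x) \<in> A \<inter> ({0<..<T} \<times> UNIV)" using e d z by (auto simp: tx)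
  then have ne: "A \<inter> ({0<..<T} \<times> UNIV) \<noteq> {}" by blast
  have gA: "c < g z" if "z \<in> A \<inter> ({0<..<T} \<times> UNIV)" for z
  proof -
    have "z \<in> A \<inter> ({0..<T} \<times> UNIV)" using that by (cases z) auto
    then show ?thesis unfolding A(2) by simp
  qed
  have "open (A \<inter> ({0<..<T} \<times> UNIV))" using A(1) by (intro open_Int open_Times) auto
  moreover have ae': "AE z in lborel. z \<in> A \<inter> ({0<..<T} \<times> UNIV) \<longrightarrow> False"
    using ae
  proof eventually_elim
    case (elim z)
    have "z \<in> {0<..<T} \<times> UNIV" if "z \<in> A \<inter> ({0<..<T} \<times> UNIV)" using that by blast
    with elim gA[of z] show ?case by linarith
  qed
  ultimately show False using AE_open_dense[OF _ ne ae'] by blast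
qed

text \<open>Null sets are translation invariant, so the periodicity of \<open>u\<close> gives that
  of \<open>w\<close> almost everywhere. \<open>AE_continuous_le\<close>, applied to the difference
  with bound 0, extends it to all points and to the initial time.\<close>

lemma continuous_representative_periodic:
  fixes u w :: "real \<times> real \<Rightarrow> real"
  assumes u: "\<And>t x. t \<in> {0<..<T} \<Longrightarrow> u (t, x + L) = u (t, x)"
    and w: "continuous_on ({0..<T} \<times> UNIV) w"
    and ae: "AE z\<in>{0<..<T} \<times> UNIV in lborel. w z = u z"
    and t: "t \<in> {0..<T}"
  shows "w (t, x + L) = w (t, x)"
proof -
  have "AE z in lborel. z + (0, L) \<in> {0<..<T} \<times> UNIV \<longrightarrow> w (z + (0, L)) = u (z + (0, L))"
  proof -
    obtain N where N: "N \<in> null_sets lborel" "{z. \<not> (z \<in> {0<..<T} \<times> UNIV \<longrightarrow> w z = u z)} \<subseteq> N"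
      using ae by (auto simp: eventually_ae_filter)
    have "{z. z - (0, - L) \<in> N} \<in> null_sets lborel" by (rule null_sets_translation[OF N(1)])
    then show ?thesis by (rule AE_I') (use N(2) in auto)
  qed
  with ae have "AE z\<in>{0<..<T} \<times> UNIV in lborel. \<bar>w (z + (0, L)) - w z\<bar> \<le> 0"
    by eventually_elim (use u in auto)
  note ae' = this
  have "\<bar>w ((t, x) + (0, L)) - w (t, x)\<bar> \<le> 0"
  proof (rule AE_continuous_le[where g = "\<lambda>z :: real \<times> real. \<bar>w (z + (0, L)) - w z\<bar>", OF _ ae'])
    show "continuous_on ({0..<T} \<times> UNIV) (\<lambda>z. \<bar>w (z + (0, L)) - w z\<bar>)"
    proof (intro continuous_on_rabs continuous_on_diff w)
      show "continuous_on ({0..<T} \<times> UNIV) (\<lambda>z. w (z + (0, L)))"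
        by (rule continuous_on_compose2[OF w]) (auto intro!: continuous_intros)
    qed
  qed (use t in auto)
  then show ?thesis by simp
qed

text \<open>Closeness in space is meant modulo the period. The two points are shifted by different
  multiples of \<open>L\<close>, which bring \<open>x\<close> into \<open>[0, L]\<close> and
  \<open>y\<close> next to it, hence both into the compact range
  \<open>[- L, 2 * L]\<close>.\<close>

lemma periodic_uniformly_continuous:
  fixes w :: "real \<times> real \<Rightarrow> real"
  assumes L: "L > 0" and w: "continuous_on ({0..T'} \<times> UNIV) w"
    and per: "\<And>t x. t \<in> {0..T'} \<Longrightarrow> w (t, x + L) = w (t, x)" and "e > 0"
  obtains \<delta> where "\<delta> > 0" "\<And>s t x y m. s \<in> {0..T'} \<Longrightarrow> t \<in> {0..T'} \<Longrightarrow> \<bar>s - t\<bar> < \<delta> \<Longrightarrow>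
      \<bar>y - x - of_int m * L\<bar> < \<delta> \<Longrightarrow> \<bar>w (s, y) - w (t, x)\<bar> \<le> e"
proof -
  have "uniformly_continuous_on ({0..T'} \<times> {- L..2 * L}) w"
    by (intro compact_uniformly_continuous continuous_on_subset[OF w] compact_Times) auto
  then obtain d where d: "d > 0" "\<And>p q. p \<in> {0..T'} \<times> {- L..2 * L} \<Longrightarrow> q \<in> {0..T'} \<times> {- L..2 * L} \<Longrightarrow>
      dist q p < d \<Longrightarrow> dist (w q) (w p) < e"
    unfolding uniformly_continuous_on_def using \<open>e > 0\<close> by metis
  show thesis
  proof (rule that)
    show "min L (d / 2) > 0" using L d by simp
    fix s t x y and m :: int
    assume st: "s \<in> {0..T'}" "t \<in> {0..T'}" "\<bar>s - t\<bar> < min L (d / 2)" and xy: "\<bar>y - x - of_int m * L\<bar> < min L (d / 2)"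
    define k where "k = - \<lfloor>x / L\<rfloor>"
    define x0 where "x0 = x + of_int k * L"
    define y0 where "y0 = y + of_int (k - m) * L"
    have "of_int \<lfloor>x / L\<rfloor> * L \<le> x" "x \<le> (of_int \<lfloor>x / L\<rfloor> + 1) * L"
      using floor_divide_lower[OF L, of x] floor_divide_upper[OF L, of x] by linarith+
    then have x0: "0 \<le> x0" "x0 \<le> L" by (auto simp: x0_def k_def algebra_simps)
    have yx: "\<bar>y0 - x0\<bar> < min L (d / 2)" using xy by (simp add: y0_def x0_def algebra_simps)
    have "w (t, x0) = w (t, x)" "w (s, y0) = w (s, y)"
      unfolding x0_def y0_def
      using periodic_of_int[of "\<lambda>x. w (t, x)" L x k] periodic_of_int[of "\<lambda>x. w (s, x)" L y "k - m"] per st(1,2)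
      by blast+
    moreover have "dist (s, y0) (t, x0) < d"
      using st(3) yx norm_Pair_le[of "s - t" "y0 - x0"] by (simp add: dist_norm)
    then have "dist (w (s, y0)) (w (t, x0)) < e"
      using st x0 yx by (intro d(2)) auto
    ultimately show "\<bar>w (s, y) - w (t, x)\<bar> \<le> e" by (simp add: dist_real_def)
  qed
qed

text \<open>By the mean value theorem \<open>g1\<close> equals a difference quotient of
  \<open>g\<close> over the step \<open>h\<close> at some intermediate point; moving from there back
  to \<open>x\<close> costs at most \<open>B * h\<close>.\<close>

lemma derivative_interpolation:
  fixes g g1 g2 :: "real \<Rightarrow> real"
  assumes "\<And>x. (g has_real_derivative g1 x) (at x)" "\<And>x. (g1 has_real_derivative g2 x) (at x)"
    and "\<And>x. \<bar>g x\<bar> \<le> A" "\<And>x. \<bar>g2 x\<bar> \<le> B" "h > 0"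
  shows "\<bar>g1 x\<bar> \<le> 2 * A / h + B * h"
proof -
  obtain \<xi> where \<xi>: "x < \<xi>" "\<xi> < x + h" "g (x + h) - g x = h * g1 \<xi>"
    using MVT2[of x "x + h" g g1] assms(1,5) by auto
  obtain \<zeta> where \<zeta>: "g1 \<xi> - g1 x = (\<xi> - x) * g2 \<zeta>"
    using MVT2[of x \<xi> g1 g2] assms(2) \<xi> by auto
  have "\<bar>h * g1 \<xi>\<bar> \<le> 2 * A"
    unfolding \<xi>(3)[symmetric] using assms(3)[of "x + h"] assms(3)[of x] by linarith
  then have "\<bar>g1 \<xi>\<bar> * h \<le> 2 * A"
    using assms(5) by (simp add: abs_mult mult.commute)
  then have "\<bar>g1 \<xi>\<bar> \<le> 2 * A / h" using assms(5) by (simp add: field_simps)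
  moreover have "\<bar>g1 \<xi> - g1 x\<bar> \<le> h * B"
    unfolding \<zeta> abs_mult using \<xi> assms(4)[of \<zeta>] by (intro mult_mono) auto
  ultimately show ?thesis by (simp add: abs_le_iff algebra_simps)
qed

section \<open>Integration by parts and passage to the limit in weak derivatives\<close>

lemma cell_integral_cutoff:
  fixes g :: "real \<times> real \<Rightarrow> real"
  assumes "\<And>z. fst z \<ge> T' \<Longrightarrow> g z = 0" "T' \<le> T"
  shows "(LINT z:cell T a b|lborel. g z) = (LINT z:cell T' a b|lborel. g z)"
  unfolding set_lebesgue_integral_def
proof (intro Bochner_Integration.integral_cong refl)
  fix z :: "real \<times> real"
  show "indicator (cell T a b) z *\<^sub>R g z = indicator (cell T' a b) z *\<^sub>R g z"
    using assms by (cases "fst z \<ge> T'") (auto simp: indicator_def)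
qed

lemma test_interior_mono: "T' \<le> T \<Longrightarrow> \<phi> \<in> test_interior T' a b \<Longrightarrow> \<phi> \<in> test_interior T a b"
  unfolding test_interior_def test_init_def by (auto intro: less_le_trans)

lemma test_init_dx_iter:
  assumes "\<phi> \<in> test_init T a b"
  shows "smooth ((dx ^^ j) \<phi>)" "(dx ^^ j) \<phi> (t, x + (b - a)) = (dx ^^ j) \<phi> (t, x)"
    "t \<ge> T \<Longrightarrow> (dx ^^ j) \<phi> (t, x) = 0"
proof -
  have *: "smooth ((dx ^^ j) \<phi>) \<and> (\<forall>t x. (dx ^^ j) \<phi> (t, x + (b - a)) = (dx ^^ j) \<phi> (t, x)) \<and>
    (\<forall>t x. t \<ge> T \<longrightarrow> (dx ^^ j) \<phi> (t, x) = 0)"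
  proof (induction j)
    case 0
    show ?case using assms by (auto simp: test_init_def)
  next
    case (Suc j)
    have "dx ((dx ^^ j) \<phi>) (t, x) = 0" if "t \<ge> T" for t x
    proof -
      have "((\<lambda>_. 0) has_real_derivative dx ((dx ^^ j) \<phi>) (t, x)) (at x)"
        using smooth_dx_real[of "(dx ^^ j) \<phi>" t x] Suc that by simp
      then show ?thesis using DERIV_const DERIV_unique by blast
    qed
    moreover have "dx ((dx ^^ j) \<phi>) (t, x + (b - a)) = dx ((dx ^^ j) \<phi>) (t, x)" for t x
      using Suc by (intro periodic_dt_dx(2)) auto
    ultimately show ?case using Suc by auto
  qed
  show "smooth ((dx ^^ j) \<phi>)" "(dx ^^ j) \<phi> (t, x + (b - a)) = (dx ^^ j) \<phi> (t, x)"
    "t \<ge> T \<Longrightarrow> (dx ^^ j) \<phi> (t, x) = 0" using * by blast+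
qed

lemma family_integral_dx:
  assumes V: "smooth_family (b - a) V" and \<phi>: "\<phi> \<in> test_init T' a b" and "a \<le> b"
  shows "(LINT z:cell T a b|lborel. V i k z * (dx ^^ j) \<phi> z) = (-1) ^ j * (LINT z:cell T a b|lborel. V i (k + j) z * \<phi> z)"
proof (induction j arbitrary: k)
  case (Suc j)
  let ?\<psi> = "(dx ^^ j) \<phi>"
  have sV: "smooth (V i k)" "dx (V i k) = V i (Suc k)" "\<And>t x. V i k (t, x + (b - a)) = V i k (t, x)" "smooth (V i (Suc k))"
    using V by (auto simp: smooth_family_def)
  note \<psi> = test_init_dx_iter[OF \<phi>, of j]
  have "(LINT z:cell T a b|lborel. dx (\<lambda>z. V i k z * ?\<psi> z) z) = 0"
    using sV \<psi> assms(3) by (intro cell_integral_dx) auto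
  then have "0 = (LINT z:cell T a b|lborel. V i k z * dx ?\<psi> z + V i (Suc k) z * ?\<psi> z)"
    by (simp add: dt_dx_mult[OF sV(1) \<psi>(1)] sV)
  also have "\<dots> = (LINT z:cell T a b|lborel. V i k z * dx ?\<psi> z) + (LINT z:cell T a b|lborel. V i (Suc k) z * ?\<psi> z)"
    using sV \<psi>(1) by (intro set_integral_add smooth_set_integrable) auto
  finally show ?case using Suc[of "Suc k"] by simp
qed simp

lemma space_integral_deriv:
  fixes W :: "nat \<Rightarrow> real \<Rightarrow> real"
  assumes W: "\<And>k. smooth (W k)" "\<And>k. deriv (W k) = W (Suc k)" "\<And>k x. W k (x + (b - a)) = W k x"
    and \<phi>: "\<phi> \<in> test_space a b" and "a \<le> b"
  shows "(LINT x:{a<..<b}|lborel. W k x * (deriv ^^ j) \<phi> x) = (-1) ^ j * (LINT x:{a<..<b}|lborel. W (k + j) x * \<phi> x)"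
proof (induction j arbitrary: k)
  case (Suc j)
  let ?\<psi> = "(deriv ^^ j) \<phi>"
  have \<phi>': "smooth \<phi>" "\<And>x. \<phi> (x + (b - a)) = \<phi> x" using \<phi> by (auto simp: test_space_def)
  have \<psi>: "smooth ?\<psi>" "\<And>x. ?\<psi> (x + (b - a)) = ?\<psi> x"
    using deriv_iter_periodic[OF \<phi>'] \<phi>'(1) by blast+
  have d: "((\<lambda>x. W k x * ?\<psi> x) has_real_derivative (W k x * deriv ?\<psi> x + W (Suc k) x * ?\<psi> x)) (at x)" for x
    using DERIV_mult'[OF smooth_has_real_derivative[OF W(1)] smooth_has_real_derivative[OF \<psi>(1)]] W(2) by simp
  have c: "continuous_on UNIV (W k)" "continuous_on UNIV ?\<psi>" "continuous_on UNIV (deriv ?\<psi>)" "continuous_on UNIV (W (Suc k))"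
    using W(1) \<psi>(1) by (auto intro!: smooth_continuous)
  have i: "set_integrable lborel {a<..<b} f" if "continuous_on UNIV f" for f :: "real \<Rightarrow> real"
    using that by (intro ess_bounded_integrable ess_bounded_continuous) auto
  have "(LINT x:{a<..<b}|lborel. W k x * deriv ?\<psi> x + W (Suc k) x * ?\<psi> x) = W k b * ?\<psi> b - W k a * ?\<psi> a"
    using assms(5) d by (rule set_integral_FTC) (intro continuous_intros c)
  also have "\<dots> = 0" using W(3)[of k a] \<psi>(2)[of a] by simp
  finally have "0 = (LINT x:{a<..<b}|lborel. W k x * deriv ?\<psi> x + W (Suc k) x * ?\<psi> x)" ..
  also have "\<dots> = (LINT x:{a<..<b}|lborel. W k x * deriv ?\<psi> x) + (LINT x:{a<..<b}|lborel. W (Suc k) x * ?\<psi> x)"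
    by (intro set_integral_add i continuous_intros c)
  finally show ?case using Suc[of "Suc k"] by simp
qed simp

text \<open>Here \<open>F\<close> stands for a weak derivative of \<open>B\<close>,
  \<open>\<psi>\<close> for the same derivative of the test function \<open>\<phi>\<close>, and
  \<open>c\<close> for the sign of the integrations by parts. Subtracting the two weak identities
  turns the integral of \<open>(F - V1) * \<phi>\<close> into that of
  \<open>(B - V0) * \<psi>\<close> up to sign, which is arbitrarily small; exchanging
  \<open>V1\<close> for \<open>V\<close> costs \<open>e\<close>.\<close>

lemma weak_limit_bound:
  fixes S :: "'a::euclidean_space set"
  assumes S: "bounded S" "S \<in> sets borel"
    and F: "ess_bounded S F" and B: "ess_bounded S B" and V: "ess_bounded S V"
    and \<phi>: "ess_bounded S \<phi>" "\<And>z. \<phi> z \<ge> 0" and \<psi>: "ess_bounded S \<psi>"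
    and c: "\<bar>c\<bar> = 1" and eq: "(LINT z:S|lborel. B z * \<psi> z) = c * (LINT z:S|lborel. F z * \<phi> z)"
    and approx: "\<And>e'. e' > 0 \<Longrightarrow> \<exists>V0 V1. ess_bounded S V0 \<and> ess_bounded S V1 \<and>
      (AE z\<in>S in lborel. \<bar>V0 z - B z\<bar> \<le> e') \<and> (\<forall>z\<in>S. \<bar>V1 z - V z\<bar> \<le> e) \<and>
      (LINT z:S|lborel. V0 z * \<psi> z) = c * (LINT z:S|lborel. V1 z * \<phi> z)"
  shows "(LINT z:S|lborel. (F z - V z - e) * \<phi> z) \<le> 0" "(LINT z:S|lborel. (V z - F z - e) * \<phi> z) \<le> 0"
proof -
  note int = ess_bounded_integrable[OF _ S]
  obtain C where C: "AE z\<in>S in lborel. \<bar>\<psi> z\<bar> \<le> C" using \<psi> by (auto simp: ess_bounded_def)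
  define C' where "C' = \<bar>C\<bar> * measure lborel S"
  have main: "\<exists>I. \<bar>I\<bar> \<le> e' * C' \<and> (LINT z:S|lborel. (F z - V z - e) * \<phi> z) \<le> I \<and> (LINT z:S|lborel. (V z - F z - e) * \<phi> z) \<le> - I"
    if e': "e' > 0" for e'
  proof -
    from approx[OF e'] obtain V0 V1 where
      V01: "ess_bounded S V0" "ess_bounded S V1"
        "AE z\<in>S in lborel. \<bar>V0 z - B z\<bar> \<le> e'" "\<And>z. z \<in> S \<Longrightarrow> \<bar>V1 z - V z\<bar> \<le> e"
      and eq': "(LINT z:S|lborel. V0 z * \<psi> z) = c * (LINT z:S|lborel. V1 z * \<phi> z)" by blast
    define I where "I = (LINT z:S|lborel. (F z - V1 z) * \<phi> z)"
    have i: "set_integrable lborel S (\<lambda>z. F z * \<phi> z)" "set_integrable lborel S (\<lambda>z. V1 z * \<phi> z)"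
      "set_integrable lborel S (\<lambda>z. B z * \<psi> z)" "set_integrable lborel S (\<lambda>z. V0 z * \<psi> z)"
      using F V01 \<phi> B \<psi> by (auto intro!: int)
    have "c * I = c * (LINT z:S|lborel. F z * \<phi> z) - c * (LINT z:S|lborel. V1 z * \<phi> z)"
      using i by (simp add: I_def left_diff_distrib set_integral_diff right_diff_distrib)
    also have "\<dots> = (LINT z:S|lborel. (B z - V0 z) * \<psi> z)"
      using i by (simp add: eq[symmetric] eq'[symmetric] left_diff_distrib set_integral_diff)
    finally have cI: "c * I = (LINT z:S|lborel. (B z - V0 z) * \<psi> z)" .
    have "AE z\<in>S in lborel. \<bar>(B z - V0 z) * \<psi> z\<bar> \<le> e' * \<bar>C\<bar>"
      using C V01(3) by eventually_elim (use e' in \<open>auto simp: abs_mult abs_minus_commute intro!: mult_mono\<close>)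
    then have "\<bar>c * I\<bar> \<le> e' * \<bar>C\<bar> * measure lborel S"
      unfolding cI using B V01 \<psi> S by (intro abs_set_integral_le) auto
    then have "\<bar>I\<bar> \<le> e' * C'" using c by (simp add: abs_mult C'_def)
    moreover have "(LINT z:S|lborel. (F z - V z - e) * \<phi> z) \<le> I"
      unfolding I_def
    proof (intro set_integral_mono int ess_bounded_mult ess_bounded_diff mult_right_mono)
      show "F z - V z - e \<le> F z - V1 z" if "z \<in> S" for z using V01(4)[OF that] by linarith
    qed (use S F V V01 \<phi> in auto)
    moreover have "(LINT z:S|lborel. (V z - F z - e) * \<phi> z) \<le> - I"
    proof -
      have "(LINT z:S|lborel. (V z - F z - e) * \<phi> z) \<le> (LINT z:S|lborel. (V1 z - F z) * \<phi> z)"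
      proof (intro set_integral_mono int ess_bounded_mult ess_bounded_diff mult_right_mono)
        show "V z - F z - e \<le> V1 z - F z" if "z \<in> S" for z using V01(4)[OF that] by linarith
      qed (use S F V V01 \<phi> in auto)
      also have "\<dots> = - I"
        using i by (simp add: I_def left_diff_distrib set_integral_diff)
      finally show ?thesis .
    qed
    ultimately show ?thesis by blast
  qed
  have *: "x \<le> 0" if "\<And>e'. e' > 0 \<Longrightarrow> x \<le> e' * C'" for x
  proof (rule field_le_epsilon)
    fix d :: real assume "d > 0"
    have "C' \<ge> 0" by (simp add: C'_def)
    have "x \<le> d / (C' + 1) * C'" using \<open>d > 0\<close> \<open>C' \<ge> 0\<close> by (intro that) auto
    also have "\<dots> \<le> d" using \<open>d > 0\<close> \<open>C' \<ge> 0\<close> by (simp add: field_simps)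
    finally show "x \<le> 0 + d" by simp
  qed
  show "(LINT z:S|lborel. (F z - V z - e) * \<phi> z) \<le> 0" "(LINT z:S|lborel. (V z - F z - e) * \<phi> z) \<le> 0"
  proof -
    show "(LINT z:S|lborel. (F z - V z - e) * \<phi> z) \<le> 0"
    proof (rule *)
      fix e' :: real assume "e' > 0"
      from main[OF this] obtain I where "\<bar>I\<bar> \<le> e' * C'" "(LINT z:S|lborel. (F z - V z - e) * \<phi> z) \<le> I" by blast
      then show "(LINT z:S|lborel. (F z - V z - e) * \<phi> z) \<le> e' * C'" by linarith
    qed
    show "(LINT z:S|lborel. (V z - F z - e) * \<phi> z) \<le> 0"
    proof (rule *)
      fix e' :: real assume "e' > 0"
      from main[OF this] obtain I where "\<bar>I\<bar> \<le> e' * C'" "(LINT z:S|lborel. (V z - F z - e) * \<phi> z) \<le> - I" by blast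
      then show "(LINT z:S|lborel. (V z - F z - e) * \<phi> z) \<le> e' * C'" by linarith
    qed
  qed
qed

lemma Linf_mult: "f \<in> Linf T a b \<Longrightarrow> g \<in> Linf T a b \<Longrightarrow> (\<lambda>z. f z * g z) \<in> Linf T a b"
  using ess_bounded_mult[of "{0<..<T} \<times> UNIV" f g] by (auto simp: Linf_def ess_bounded_def)

section \<open>Smooth approximation of the Kuramoto-Sivashinsky solution\<close>

lemma smooth_familyD:
  assumes "smooth_family L V"
  shows "smooth (V i j)" "dt (V i j) = V (Suc i) j" "dx (V i j) = V i (Suc j)"
    "V i j (t, x + L) = V i j (t, x)"
  using assms by (auto simp: smooth_family_def)

lemma smooth_family_lipschitz:
  assumes V: "smooth_family L V"
    and M: "\<And>z. fst z \<in> {0..T'} \<Longrightarrow> \<bar>V (Suc i) j z\<bar> \<le> M" "\<And>z. fst z \<in> {0..T'} \<Longrightarrow> \<bar>V i (Suc j) z\<bar> \<le> M"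
    and st: "s \<in> {0..T'}" "t \<in> {0..T'}"
  shows "\<bar>V i j (s, y) - V i j (t, x)\<bar> \<le> M * \<bar>s - t\<bar> + M * \<bar>y - x - of_int m * L\<bar>"
proof -
  note V' = smooth_familyD[OF V]
  have d: "((\<lambda>t. V i j (t, x)) has_real_derivative V (Suc i) j (t, x)) (at t)"
    "((\<lambda>x. V i j (t, x)) has_real_derivative V i (Suc j) (t, x)) (at x)" for t x
    using smooth_dt_real[OF V'(1)] smooth_dx_real[OF V'(1)] by (simp_all add: V')
  have 1: "\<bar>V i j (s, y) - V i j (t, y)\<bar> \<le> M * \<bar>s - t\<bar>"
    using field_differentiable_bound[of "{0..T'}" "\<lambda>t. V i j (t, y)" "\<lambda>t. V (Suc i) j (t, y)" M s t]
      DERIV_subset[OF d(1)] M(1) st by auto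
  have 2: "\<bar>V i j (t, y - of_int m * L) - V i j (t, x)\<bar> \<le> M * \<bar>y - of_int m * L - x\<bar>"
    using field_differentiable_bound[of UNIV "\<lambda>x. V i j (t, x)" "\<lambda>x. V i (Suc j) (t, x)" M "y - of_int m * L" x]
      DERIV_subset[OF d(2)] M(2) st by auto
  have "V i j (t, y) = V i j (t, y - of_int m * L)"
    using periodic_of_int[of "\<lambda>x. V i j (t, x)" L y "- m"] V'(4) by simp
  with 1 2 show ?thesis by (simp add: algebra_simps abs_le_iff)
qed

text \<open>\<open>f i j\<close> and \<open>g0 j\<close> are fixed representatives of the
  derivatives of \<open>u\<close> and \<open>u0\<close>, and \<open>w\<close> is the continuous
  representative of \<open>u\<close>. The nonlinear term in \<open>KS\<close> is still an abstract
  weak derivative of the square; \<open>weak_deriv_square\<close> makes it explicit.\<close>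

locale ks =
  fixes T a b M :: real and u w :: "real \<times> real \<Rightarrow> real" and u0 :: "real \<Rightarrow> real"
    and f :: "nat \<Rightarrow> nat \<Rightarrow> real \<times> real \<Rightarrow> real" and g0 :: "nat \<Rightarrow> real \<Rightarrow> real"
  assumes T: "T > 0" and ab: "a < b" and M: "M \<ge> 0"
    and u: "u \<in> Linf T a b" and f00: "f 0 0 = u"
    and f: "i + j \<le> 4 \<Longrightarrow> weak_deriv T a b i j u (f i j)"
    and fM: "i + j \<le> 4 \<Longrightarrow> AE z\<in>cell T a b in lborel. \<bar>f i j z\<bar> \<le> M"
    and w: "continuous_on ({0..<T} \<times> UNIV) w"
    and wu: "AE z\<in>{0<..<T} \<times> UNIV in lborel. w z = u z"
    and w0: "AE x in lborel. w (0, x) = u0 x"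
    and u0: "u0 \<in> Linf_space a b"
    and g0: "j \<le> 3 \<Longrightarrow> weak_deriv_space a b j u0 (g0 j)"
    and KS: "AE z in lborel. z \<in> {0<..<T} \<times> UNIV \<longrightarrow>
      f 1 0 z + D T a b 0 1 (\<lambda>z. (u z)\<^sup>2 / 2) z + f 0 2 z + f 0 4 z = 0"
begin

text \<open>The properties of a kernel are bundled with its width \<open>\<epsilon>\<close> so that
  later statements can speak of all sufficiently narrow kernels and compare two of them.\<close>

definition mollifies where
  "mollifies T' \<epsilon> K V \<longleftrightarrow> 0 < \<epsilon> \<and> T' + 2 * \<epsilon> < T \<and> smooth K \<and> (\<forall>w. K w \<ge> 0) \<and>
    (\<forall>z. fst z \<in> {0..T'} \<longrightarrow> (LINT w:cell T a b|lborel. K (w - z)) = 1) \<and>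
    (\<forall>w. K w \<noteq> 0 \<longrightarrow> \<epsilon> < fst w \<and> fst w < 2 * \<epsilon> \<and> (\<exists>m::int. \<bar>snd w - of_int m * (b - a)\<bar> < \<epsilon>)) \<and>
    (\<forall>z. fst z \<in> {0..T'} \<longrightarrow> (\<lambda>w. K (w - z)) \<in> test_interior T a b) \<and>
    smooth_family (b - a) V \<and>
    (\<forall>i j z. i + j \<le> 4 \<longrightarrow> fst z \<in> {0..T'} \<longrightarrow> V i j z = (LINT w:cell T a b|lborel. f i j w * K (w - z)))"

lemma exists_mollification:
  assumes "0 < \<epsilon>" "\<epsilon> \<le> (b - a) / 2" "0 \<le> T'" "T' + 2 * \<epsilon> < T"
  obtains K V where "mollifies T' \<epsilon> K V"
proof (rule mollification[OF ab assms Linf_ess_bounded[OF u]])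
  fix K V
  assume *: "smooth K" "\<And>w. K w \<ge> 0"
    "\<And>z. fst z \<in> {0..T'} \<Longrightarrow> (LINT w:cell T a b|lborel. K (w - z)) = 1"
    "\<And>w. K w \<noteq> 0 \<Longrightarrow> \<epsilon> < fst w \<and> fst w < 2 * \<epsilon> \<and> (\<exists>m::int. \<bar>snd w - of_int m * (b - a)\<bar> < \<epsilon>)"
    "\<And>z. fst z \<in> {0..T'} \<Longrightarrow> (\<lambda>w. K (w - z)) \<in> test_interior T a b"
    "smooth_family (b - a) V"
    "\<And>i j g z. weak_deriv T a b i j u g \<Longrightarrow> fst z \<in> {0..T'} \<Longrightarrow>
      V i j z = (LINT w:cell T a b|lborel. g w * K (w - z))"
  have "\<forall>i j z. i + j \<le> 4 \<longrightarrow> fst z \<in> {0..T'} \<longrightarrow> V i j z = (LINT w:cell T a b|lborel. f i j w * K (w - z))"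
    using *(7)[OF f] by blast
  then have "mollifies T' \<epsilon> K V"
    unfolding mollifies_def using assms * by blast
  then show thesis by (rule that)
qed

lemma mollifiesD:
  assumes "mollifies T' \<epsilon> K V"
  shows "0 < \<epsilon>" "T' + 2 * \<epsilon> < T" "smooth K" "K v \<ge> 0"
    "fst z \<in> {0..T'} \<Longrightarrow> (LINT w:cell T a b|lborel. K (w - z)) = 1"
    "K v \<noteq> 0 \<Longrightarrow> \<epsilon> < fst v \<and> fst v < 2 * \<epsilon> \<and> (\<exists>m::int. \<bar>snd v - of_int m * (b - a)\<bar> < \<epsilon>)"
    "fst z \<in> {0..T'} \<Longrightarrow> (\<lambda>w. K (w - z)) \<in> test_interior T a b"
    "smooth_family (b - a) V"
    "i + j \<le> 4 \<Longrightarrow> fst z \<in> {0..T'} \<Longrightarrow> V i j z = (LINT w:cell T a b|lborel. f i j w * K (w - z))"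
  using assms unfolding mollifies_def by blast+

section \<open>Bounds and convergence of the mollifications\<close>

lemma f_ess_bounded: "i + j \<le> 4 \<Longrightarrow> ess_bounded (cell T a b) (f i j)"
  using f by (auto simp: weak_deriv_def intro: Linf_ess_bounded)

lemma kernel_ess_bounded: "smooth K \<Longrightarrow> ess_bounded (cell T a b) (\<lambda>w. K (w - z))"
  by (rule ess_bounded_shift) auto

text \<open>The kernel is nonnegative with mass one, so the integral is a mean value and only the
  points in the support of the kernel count.\<close>

lemma mollifier_average_le:
  assumes m: "mollifies T' \<epsilon> K V" and z: "fst z \<in> {0..T'}"
    and h: "ess_bounded (cell T a b) h"
    and le: "AE w\<in>cell T a b in lborel. K (w - z) \<noteq> 0 \<longrightarrow> \<bar>h w\<bar> \<le> e"
  shows "\<bar>LINT w:cell T a b|lborel. h w * K (w - z)\<bar> \<le> e"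
proof -
  have K: "smooth K" "\<And>w. K w \<ge> 0" "(LINT w:cell T a b|lborel. K (w - z)) = 1"
    using mollifiesD[OF m] z by blast+
  note i = ess_bounded_integrable[OF _ bounded_cell cell_borel]
  have ik: "ess_bounded (cell T a b) (\<lambda>w. K (w - z))" by (rule kernel_ess_bounded[OF K(1)])
  have "(LINT w:cell T a b|lborel. h w * K (w - z)) \<le> (LINT w:cell T a b|lborel. e * K (w - z))"
    using le
  proof (intro set_integral_le_AE i ess_bounded_mult ess_bounded_const cell_borel h ik, elim eventually_mono, intro impI)
    fix w assume *: "w \<in> cell T a b \<longrightarrow> K (w - z) \<noteq> 0 \<longrightarrow> \<bar>h w\<bar> \<le> e" "w \<in> cell T a b"
    show "h w * K (w - z) \<le> e * K (w - z)"
      using * K(2)[of "w - z"] by (cases "K (w - z) = 0") (auto intro!: mult_right_mono)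
  qed
  moreover have "(LINT w:cell T a b|lborel. (- e) * K (w - z)) \<le> (LINT w:cell T a b|lborel. h w * K (w - z))"
    using le
  proof (intro set_integral_le_AE i ess_bounded_mult ess_bounded_const cell_borel h ik, elim eventually_mono, intro impI)
    fix w assume *: "w \<in> cell T a b \<longrightarrow> K (w - z) \<noteq> 0 \<longrightarrow> \<bar>h w\<bar> \<le> e" "w \<in> cell T a b"
    show "(- e) * K (w - z) \<le> h w * K (w - z)"
    proof (cases "K (w - z) = 0")
      case False
      then have "- e \<le> h w" using * by linarith
      then show ?thesis using K(2)[of "w - z"] by (rule mult_right_mono)
    qed simp
  qed
  ultimately show ?thesis unfolding set_integral_mult_right K(3) by (simp add: abs_le_iff)
qed

lemma mollification_bound:
  assumes m: "mollifies T' \<epsilon> K V" and z: "fst z \<in> {0..T'}" and "i + j \<le> 4"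
  shows "\<bar>V i j z\<bar> \<le> M"
proof -
  have "V i j z = (LINT w:cell T a b|lborel. f i j w * K (w - z))"
    by (rule mollifiesD(9)[OF m assms(3) z])
  also have "\<bar>\<dots>\<bar> \<le> M"
    using fM[OF assms(3)] by (intro mollifier_average_le[OF m z f_ess_bounded[OF assms(3)]]) (auto elim!: eventually_mono)
  finally show ?thesis .
qed

lemma w_periodic: "t \<in> {0..<T} \<Longrightarrow> w (t, x + (b - a)) = w (t, x)"
  using u by (intro continuous_representative_periodic[OF _ w wu]) (auto simp: Linf_def)

lemma wu_cell: "AE z\<in>cell T a b in lborel. w z = u z"
  using wu by eventually_elim auto

lemma mollification_close:
  assumes "0 \<le> T'" "T' < T" "e > 0"
  obtains \<epsilon>0 where "\<epsilon>0 > 0" "\<And>\<epsilon> K V z. mollifies T' \<epsilon> K V \<Longrightarrow> \<epsilon> < \<epsilon>0 \<Longrightarrow> fst z \<in> {0..T'} \<Longrightarrow> \<bar>V 0 0 z - w z\<bar> \<le> e"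
proof -
  \<comment> \<open>The kernel samples times up to \<open>2 * \<epsilon>\<close> after the current
    one, so uniform continuity of \<open>w\<close> is required slightly beyond
    \<open>T'\<close>.\<close>
  define T2 where "T2 = (T' + T) / 2"
  have T2: "T' < T2" "T2 < T" "0 \<le> T2" using assms by (auto simp: T2_def)
  have cw: "continuous_on ({0..T2} \<times> UNIV) w"
    by (rule continuous_on_subset[OF w]) (use T2 in auto)
  obtain \<delta> where \<delta>: "\<delta> > 0" "\<And>s t x y m. s \<in> {0..T2} \<Longrightarrow> t \<in> {0..T2} \<Longrightarrow> \<bar>s - t\<bar> < \<delta> \<Longrightarrow>
      \<bar>y - x - of_int m * (b - a)\<bar> < \<delta> \<Longrightarrow> \<bar>w (s, y) - w (t, x)\<bar> \<le> e"
    using periodic_uniformly_continuous[OF _ cw, of "b - a" e] ab w_periodic T2 \<open>e > 0\<close> by auto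
  show thesis
  proof (rule that)
    show "min (\<delta> / 2) ((T2 - T') / 2) > 0" using \<delta> T2 by simp
    fix \<epsilon> K V and z :: "real \<times> real"
    assume m: "mollifies T' \<epsilon> K V" and \<epsilon>: "\<epsilon> < min (\<delta> / 2) ((T2 - T') / 2)" and z: "fst z \<in> {0..T'}"
    have K: "smooth K" "(LINT w:cell T a b|lborel. K (w - z)) = 1" "\<epsilon> > 0"
      "\<And>w. K w \<noteq> 0 \<Longrightarrow> \<epsilon> < fst w \<and> fst w < 2 * \<epsilon> \<and> (\<exists>m::int. \<bar>snd w - of_int m * (b - a)\<bar> < \<epsilon>)"
      using mollifiesD[OF m] z by blast+
    note i = ess_bounded_integrable[OF _ bounded_cell cell_borel]
    have ik: "ess_bounded (cell T a b) (\<lambda>w. K (w - z))" by (rule kernel_ess_bounded[OF K(1)])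
    have iu: "ess_bounded (cell T a b) u" by (rule Linf_ess_bounded[OF u])
    have "V 0 0 z = (LINT v:cell T a b|lborel. u v * K (v - z))"
      using mollifiesD(9)[OF m _ z, of 0 0] f00 by simp
    then have "V 0 0 z - w z = (LINT v:cell T a b|lborel. u v * K (v - z)) - (LINT v:cell T a b|lborel. w z * K (v - z))"
      using K(2) by simp
    also have "\<dots> = (LINT v:cell T a b|lborel. (u v - w z) * K (v - z))"
      unfolding left_diff_distrib
      by (rule set_integral_diff(2)[symmetric]) (intro i ess_bounded_mult ess_bounded_cmult iu ik)+
    also have "\<bar>\<dots>\<bar> \<le> e"
    proof (rule mollifier_average_le[OF m z])
      show "ess_bounded (cell T a b) (\<lambda>v. u v - w z)" by (intro ess_bounded_diff iu) simp
      show "AE v\<in>cell T a b in lborel. K (v - z) \<noteq> 0 \<longrightarrow> \<bar>u v - w z\<bar> \<le> e"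
        using wu_cell
      proof (eventually_elim, intro impI)
        fix v assume v: "v \<in> cell T a b \<longrightarrow> w v = u v" "v \<in> cell T a b" "K (v - z) \<noteq> 0"
        from K(4)[OF v(3)] obtain m :: int where m: "\<epsilon> < fst v - fst z" "fst v - fst z < 2 * \<epsilon>" "\<bar>snd v - snd z - of_int m * (b - a)\<bar> < \<epsilon>"
          by auto
        have "\<bar>w (fst v, snd v) - w (fst z, snd z)\<bar> \<le> e"
          using m \<epsilon> z T2 K(3) by (intro \<delta>(2)[of _ _ _ _ m]) auto
        then show "\<bar>u v - w z\<bar> \<le> e" using v by simp
      qed
    qed
    finally show "\<bar>V 0 0 z - w z\<bar> \<le> e" .
  qed
qed

text \<open>Interpolation passes from order \<open>j\<close> to \<open>j + 1\<close> because the
  derivatives of order \<open>j + 2\<close>, which is at most four, are bounded by \<open>M\<close>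
  for both mollifications. Two mollifications are compared with each other instead of with
  \<open>f 0 j\<close>, since interpolation needs functions that are differentiable
  everywhere.\<close>

lemma mollification_cauchy:
  assumes "0 \<le> T'" "T' < T" "e > 0" "j \<le> 3"
  shows "\<exists>\<epsilon>0>0. \<forall>\<epsilon> \<epsilon>' K K' V V' z. mollifies T' \<epsilon> K V \<longrightarrow> mollifies T' \<epsilon>' K' V' \<longrightarrow> \<epsilon> < \<epsilon>0 \<longrightarrow> \<epsilon>' < \<epsilon>0 \<longrightarrow>
    fst z \<in> {0..T'} \<longrightarrow> \<bar>V 0 j z - V' 0 j z\<bar> \<le> e"
  using assms(3,4)
proof (induction j arbitrary: e)
  case 0
  obtain \<epsilon>0 where "\<epsilon>0 > 0" "\<And>\<epsilon> K V z. mollifies T' \<epsilon> K V \<Longrightarrow> \<epsilon> < \<epsilon>0 \<Longrightarrow> fst z \<in> {0..T'} \<Longrightarrow> \<bar>V 0 0 z - w z\<bar> \<le> e / 2"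
    by (rule mollification_close[OF assms(1,2), of "e / 2"]) (use 0 in auto)
  then show ?case by (intro exI[of _ \<epsilon>0]) (smt (verit) field_sum_of_halves)
next
  case (Suc j)
  \<comment> \<open>This step splits the interpolation bound into halves:
    \<open>2 * (e * h / 4) / h = e / 2\<close>, and \<open>2 * M * h \<le> e / 2\<close>.\<close>
  define h where "h = e / (2 * (2 * M + 1))"
  have h: "h > 0" "2 * M * h \<le> e / 2" using Suc M by (auto simp: h_def field_simps)
  obtain \<epsilon>0 where \<epsilon>0: "\<epsilon>0 > 0" "\<And>\<epsilon> \<epsilon>' K K' V V' z. mollifies T' \<epsilon> K V \<Longrightarrow> mollifies T' \<epsilon>' K' V' \<Longrightarrow> \<epsilon> < \<epsilon>0 \<Longrightarrow> \<epsilon>' < \<epsilon>0 \<Longrightarrow>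
    fst z \<in> {0..T'} \<Longrightarrow> \<bar>V 0 j z - V' 0 j z\<bar> \<le> e * h / 4"
    using Suc.IH[of "e * h / 4"] Suc.prems h by auto
  show ?case
  proof (intro exI[of _ \<epsilon>0] conjI allI impI)
    fix \<epsilon> \<epsilon>' K K' V V' and z :: "real \<times> real"
    assume m: "mollifies T' \<epsilon> K V" "mollifies T' \<epsilon>' K' V'" "\<epsilon> < \<epsilon>0" "\<epsilon>' < \<epsilon>0" and z: "fst z \<in> {0..T'}"
    have V: "smooth_family (b - a) V" "smooth_family (b - a) V'" using mollifiesD(8) m by blast+
    have d: "((\<lambda>x. V 0 k (t, x) - V' 0 k (t, x)) has_real_derivative (V 0 (Suc k) (t, x) - V' 0 (Suc k) (t, x))) (at x)" for k t x
      using DERIV_diff[OF smooth_dx_real[OF smooth_familyD(1)[OF V(1)]] smooth_dx_real[OF smooth_familyD(1)[OF V(2)]]]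
      by (simp add: smooth_familyD[OF V(1)] smooth_familyD[OF V(2)])
    have "\<bar>V 0 (Suc j) (fst z, snd z) - V' 0 (Suc j) (fst z, snd z)\<bar> \<le> 2 * (e * h / 4) / h + (2 * M) * h"
    proof (rule derivative_interpolation[OF d d _ _ h(1)])
      show "\<bar>V 0 j (fst z, x) - V' 0 j (fst z, x)\<bar> \<le> e * h / 4" for x
        using \<epsilon>0(2)[OF m] z by simp
      show "\<bar>V 0 (Suc (Suc j)) (fst z, x) - V' 0 (Suc (Suc j)) (fst z, x)\<bar> \<le> 2 * M" for x
        using mollification_bound[OF m(1), of "(fst z, x)" 0 "Suc (Suc j)"] mollification_bound[OF m(2), of "(fst z, x)" 0 "Suc (Suc j)"] Suc.prems z
        by auto
    qed
    also have "\<dots> \<le> e" using h Suc.prems by simp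
    finally show "\<bar>V 0 (Suc j) z - V' 0 (Suc j) z\<bar> \<le> e" by simp
  qed (fact \<epsilon>0(1))
qed

lemma exists_small_mollification:
  assumes "0 \<le> T'" "T' < T" "\<epsilon>0 > 0"
  obtains \<epsilon> K V where "mollifies T' \<epsilon> K V" "\<epsilon> < \<epsilon>0"
proof -
  define \<epsilon> where "\<epsilon> = min (\<epsilon>0 / 2) (min ((b - a) / 2) ((T - T') / 4))"
  have "0 < \<epsilon>" "\<epsilon> \<le> (b - a) / 2" "T' + 2 * \<epsilon> < T" "\<epsilon> < \<epsilon>0"
    using assms ab by (auto simp: \<epsilon>_def min_def field_simps)
  with that show thesis using exists_mollification[of \<epsilon> T'] assms by metis
qed

text \<open>The Cauchy property does not yet say what the limit is. Testing identifies it: finer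
  mollifications tend to \<open>w\<close>, hence to \<open>u\<close>, so their derivatives tend
  weakly to \<open>f 0 j\<close>. The same argument on the line \<open>t = 0\<close> uses only that
  \<open>w\<close> has the trace \<open>u0\<close> and yields the initial values of the space
  derivatives.\<close>

lemma mollification_close_deriv:
  assumes T': "0 < T'" "T' < T" and "e > 0" "j \<le> 3"
  shows "\<exists>\<epsilon>0>0. \<forall>\<epsilon> K V. mollifies T' \<epsilon> K V \<longrightarrow> \<epsilon> < \<epsilon>0 \<longrightarrow>
    (AE z\<in>cell T' a b in lborel. \<bar>V 0 j z - f 0 j z\<bar> \<le> e) \<and>
    (AE x\<in>{a<..<b} in lborel. \<bar>V 0 j (0, x) - g0 j x\<bar> \<le> e)"
proof -
  obtain \<epsilon>0 where \<epsilon>0: "\<epsilon>0 > 0" and cauchy: "\<And>\<epsilon> \<epsilon>' K K' V V' z. mollifies T' \<epsilon> K V \<Longrightarrow> mollifies T' \<epsilon>' K' V' \<Longrightarrow> \<epsilon> < \<epsilon>0 \<Longrightarrow> \<epsilon>' < \<epsilon>0 \<Longrightarrow>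
    fst z \<in> {0..T'} \<Longrightarrow> \<bar>V 0 j z - V' 0 j z\<bar> \<le> e"
    using mollification_cauchy[of T' e j] assms by auto
  show ?thesis
  proof (intro exI[of _ \<epsilon>0] conjI allI impI)
    fix \<epsilon> K V assume m: "mollifies T' \<epsilon> K V" and \<epsilon>: "\<epsilon> < \<epsilon>0"
    have V: "smooth_family (b - a) V" using mollifiesD(8) m by blast
    \<comment> \<open>An auxiliary finer mollification: it is as close to \<open>w\<close> as
      desired, while its derivative of order \<open>j\<close> stays within \<open>e\<close> of that
      of \<open>V\<close>.\<close>
    have approx: "\<exists>\<epsilon>' K' V'. mollifies T' \<epsilon>' K' V' \<and> (\<forall>z. fst z \<in> {0..T'} \<longrightarrow> \<bar>V' 0 0 z - w z\<bar> \<le> e') \<and>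
      (\<forall>z. fst z \<in> {0..T'} \<longrightarrow> \<bar>V' 0 j z - V 0 j z\<bar> \<le> e)" if e': "e' > 0" for e'
    proof -
      obtain \<epsilon>1 where \<epsilon>1: "\<epsilon>1 > 0" "\<And>\<epsilon> K V z. mollifies T' \<epsilon> K V \<Longrightarrow> \<epsilon> < \<epsilon>1 \<Longrightarrow> fst z \<in> {0..T'} \<Longrightarrow> \<bar>V 0 0 z - w z\<bar> \<le> e'"
        by (rule mollification_close[of T' e']) (use T' e' in auto)
      obtain \<epsilon>' K' V' where "mollifies T' \<epsilon>' K' V'" "\<epsilon>' < min \<epsilon>0 \<epsilon>1"
        by (rule exists_small_mollification[of T' "min \<epsilon>0 \<epsilon>1"]) (use T' \<epsilon>0 \<epsilon>1 in auto)
      then show ?thesis using \<epsilon>1(2) cauchy[OF _ m _ \<epsilon>] by (metis min_less_iff_conj)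
    qed
    show "AE z\<in>cell T' a b in lborel. \<bar>V 0 j z - f 0 j z\<bar> \<le> e"
    proof -
      have sub: "cell T' a b \<subseteq> cell T a b" using T' by auto
      have eb: "ess_bounded (cell T' a b) (f 0 j)" "ess_bounded (cell T' a b) u"
        using ess_bounded_subset[OF f_ess_bounded sub] ess_bounded_subset[OF Linf_ess_bounded[OF u] sub] assms by auto
      have main: "(LINT z:cell T' a b|lborel. (f 0 j z - V 0 j z - e) * \<phi> z) \<le> 0"
          "(LINT z:cell T' a b|lborel. (V 0 j z - f 0 j z - e) * \<phi> z) \<le> 0"
        if \<phi>: "\<phi> \<in> test_interior T' a b" "\<And>z. \<phi> z \<ge> 0" for \<phi>
      proof -
        have \<phi>': "\<phi> \<in> test_interior T a b" "\<phi> \<in> test_init T' a b"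
          using test_interior_mono[OF _ \<phi>(1)] T' \<phi>(1) by (auto simp: test_interior_def)
        have \<psi>: "smooth ((dx ^^ j) \<phi>)" by (rule test_init_dx_iter(1)[OF \<phi>'(2)])
        have z0: "\<phi> z = 0" "(dx ^^ j) \<phi> z = 0" if "fst z \<ge> T'" for z
          using test_init_dx_iter(3)[OF \<phi>'(2), of "fst z" 0 "snd z"] test_init_dx_iter(3)[OF \<phi>'(2), of "fst z" j "snd z"] that by auto
        have "(LINT z:cell T a b|lborel. u z * (dt ^^ 0) ((dx ^^ j) \<phi>) z) = (-1) ^ (0 + j) * (LINT z:cell T a b|lborel. f 0 j z * \<phi> z)"
          using f[of 0 j] assms(4) \<phi>'(1) unfolding weak_deriv_def by auto
        moreover have "(LINT z:cell T a b|lborel. u z * (dx ^^ j) \<phi> z) = (LINT z:cell T' a b|lborel. u z * (dx ^^ j) \<phi> z)"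
          using T' by (intro cell_integral_cutoff) (auto simp: z0)
        moreover have "(LINT z:cell T a b|lborel. f 0 j z * \<phi> z) = (LINT z:cell T' a b|lborel. f 0 j z * \<phi> z)"
          using T' by (intro cell_integral_cutoff) (auto simp: z0)
        ultimately have eq: "(LINT z:cell T' a b|lborel. u z * (dx ^^ j) \<phi> z) = (-1) ^ j * (LINT z:cell T' a b|lborel. f 0 j z * \<phi> z)"
          by simp
        have app: "\<exists>V0 V1. ess_bounded (cell T' a b) V0 \<and> ess_bounded (cell T' a b) V1 \<and>
          (AE z\<in>cell T' a b in lborel. \<bar>V0 z - u z\<bar> \<le> e') \<and> (\<forall>z\<in>cell T' a b. \<bar>V1 z - V 0 j z\<bar> \<le> e) \<and>
          (LINT z:cell T' a b|lborel. V0 z * (dx ^^ j) \<phi> z) = (-1) ^ j * (LINT z:cell T' a b|lborel. V1 z * \<phi> z)"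
          if e': "e' > 0" for e'
        proof -
          obtain \<epsilon>' K' V' where V': "mollifies T' \<epsilon>' K' V'" "\<And>z. fst z \<in> {0..T'} \<Longrightarrow> \<bar>V' 0 0 z - w z\<bar> \<le> e'"
              "\<And>z. fst z \<in> {0..T'} \<Longrightarrow> \<bar>V' 0 j z - V 0 j z\<bar> \<le> e"
            using approx[OF e'] by blast
          have sf: "smooth_family (b - a) V'" by (rule mollifiesD(8)[OF V'(1)])
          show ?thesis
          proof (intro exI conjI)
            show "ess_bounded (cell T' a b) (V' 0 0)" "ess_bounded (cell T' a b) (V' 0 j)"
              by (intro ess_bounded_smooth smooth_familyD(1)[OF sf])+
            show "AE z\<in>cell T' a b in lborel. \<bar>V' 0 0 z - u z\<bar> \<le> e'"
              using wu_cell
            proof (eventually_elim, intro impI)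
              fix z assume "z \<in> cell T a b \<longrightarrow> w z = u z" "z \<in> cell T' a b"
              then show "\<bar>V' 0 0 z - u z\<bar> \<le> e'" using V'(2)[of z] sub by auto
            qed
            show "\<forall>z\<in>cell T' a b. \<bar>V' 0 j z - V 0 j z\<bar> \<le> e" using V'(3) by auto
            show "(LINT z:cell T' a b|lborel. V' 0 0 z * (dx ^^ j) \<phi> z) = (-1) ^ j * (LINT z:cell T' a b|lborel. V' 0 j z * \<phi> z)"
              using family_integral_dx[OF sf \<phi>'(2), of T' 0 0 j] ab by simp
          qed
        qed
        have "smooth \<phi>" using \<phi>'(2) by (auto simp: test_init_def)
        note wl = weak_limit_bound[OF bounded_cell cell_borel eb ess_bounded_smooth[OF smooth_familyD(1)[OF V]]
            ess_bounded_smooth[OF this] \<phi>(2) ess_bounded_smooth[OF \<psi>] _ eq app]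
        show "(LINT z:cell T' a b|lborel. (f 0 j z - V 0 j z - e) * \<phi> z) \<le> 0"
          "(LINT z:cell T' a b|lborel. (V 0 j z - f 0 j z - e) * \<phi> z) \<le> 0"
          by (rule wl; simp)+
      qed
      have "set_integrable lborel (cell T' a b) (\<lambda>z. f 0 j z - V 0 j z - e)" "set_integrable lborel (cell T' a b) (\<lambda>z. V 0 j z - f 0 j z - e)"
        by (intro ess_bounded_integrable bounded_cell cell_borel ess_bounded_diff ess_bounded_const eb
            ess_bounded_smooth smooth_familyD(1)[OF V])+
      note intg = this
      have "AE z\<in>cell T' a b in lborel. f 0 j z - V 0 j z - e \<le> 0"
        by (rule AE_nonpos_cell[OF intg(1)], rule main(1))
      moreover have "AE z\<in>cell T' a b in lborel. V 0 j z - f 0 j z - e \<le> 0"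
        by (rule AE_nonpos_cell[OF intg(2)], rule main(2))
      ultimately show ?thesis by eventually_elim auto
    qed
    show "AE x\<in>{a<..<b} in lborel. \<bar>V 0 j (0, x) - g0 j x\<bar> \<le> e"
    proof -
      have b: "bounded {a<..<b}" "{a<..<b} \<in> sets borel" by auto
      have ebC: "ess_bounded {a<..<b} h" if "continuous_on UNIV h" for h :: "real \<Rightarrow> real"
        using that by (intro ess_bounded_continuous) auto
      have ebV: "ess_bounded {a<..<b} (\<lambda>x. V 0 j (0, x))"
        by (intro ebC smooth_continuous_slice smooth_familyD(1)[OF V])
      have eb: "ess_bounded {a<..<b} (g0 j)" "ess_bounded {a<..<b} u0"
        using Linf_space_ess_bounded u0 g0[OF assms(4)] by (auto simp: weak_deriv_space_def)
      have main: "(LINT x:{a<..<b}|lborel. (g0 j x - V 0 j (0, x) - e) * \<phi> x) \<le> 0"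
          "(LINT x:{a<..<b}|lborel. (V 0 j (0, x) - g0 j x - e) * \<phi> x) \<le> 0"
        if \<phi>: "\<phi> \<in> test_space a b" "\<And>x. \<phi> x \<ge> 0" for \<phi>
      proof -
        have s: "smooth \<phi>" "smooth ((deriv ^^ j) \<phi>)" using \<phi>(1) by (auto simp: test_space_def)
        have eq: "(LINT x:{a<..<b}|lborel. u0 x * (deriv ^^ j) \<phi> x) = (-1) ^ j * (LINT x:{a<..<b}|lborel. g0 j x * \<phi> x)"
          using g0[OF assms(4)] \<phi>(1) unfolding weak_deriv_space_def by auto
        have app: "\<exists>V0 V1. ess_bounded {a<..<b} V0 \<and> ess_bounded {a<..<b} V1 \<and>
          (AE x\<in>{a<..<b} in lborel. \<bar>V0 x - u0 x\<bar> \<le> e') \<and> (\<forall>x\<in>{a<..<b}. \<bar>V1 x - V 0 j (0, x)\<bar> \<le> e) \<and>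
          (LINT x:{a<..<b}|lborel. V0 x * (deriv ^^ j) \<phi> x) = (-1) ^ j * (LINT x:{a<..<b}|lborel. V1 x * \<phi> x)"
          if e': "e' > 0" for e'
        proof -
          obtain \<epsilon>' K' V' where V': "mollifies T' \<epsilon>' K' V'" "\<And>z. fst z \<in> {0..T'} \<Longrightarrow> \<bar>V' 0 0 z - w z\<bar> \<le> e'"
              "\<And>z. fst z \<in> {0..T'} \<Longrightarrow> \<bar>V' 0 j z - V 0 j z\<bar> \<le> e"
            using approx[OF e'] by blast
          have sf: "smooth_family (b - a) V'" by (rule mollifiesD(8)[OF V'(1)])
          have d: "((\<lambda>x. V' 0 k (0, x)) has_real_derivative V' 0 (Suc k) (0, x)) (at x)" for k x
            using smooth_dx_real[OF smooth_familyD(1)[OF sf]] by (simp add: smooth_familyD[OF sf])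
          have sm: "smooth (\<lambda>x. V' 0 k (0, x))" for k
          \<comment> \<open>The scalar \<open>c\<close> in the class absorbs the direction
            \<open>v\<close>, by which the derivative is multiplied.\<close>
          proof (rule smooth_coinduct[where P = "\<lambda>h. \<exists>k c. h = (\<lambda>x. c * V' 0 k (0, x))"])
            show "\<exists>k' c. (\<lambda>x. V' 0 k (0, x)) = (\<lambda>x. c * V' 0 k' (0, x))"
              by (intro exI[of _ k] exI[of _ 1]) simp
            fix h :: "real \<Rightarrow> real" assume "\<exists>k c. h = (\<lambda>x. c * V' 0 k (0, x))"
            then obtain k c where h: "h = (\<lambda>x. c * V' 0 k (0, x))" by blast
            have dh: "(h has_derivative (\<lambda>v. c * V' 0 (Suc k) (0, x) * v)) (at x)" for x
              unfolding h using DERIV_cmult[OF d] by (simp add: has_field_derivative_def)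
            show "h differentiable_on UNIV \<and> (\<forall>v. \<exists>k c. (\<lambda>z. frechet_derivative h (at z) v) = (\<lambda>x. c * V' 0 k (0, x)))"
              unfolding frechet_eq[OF dh]
              using dh by (auto simp: differentiable_on_def intro!: differentiableI exI[of _ "Suc k"] exI[of _ "c * _"])
          qed
          show ?thesis
          proof (intro exI conjI)
            show "ess_bounded {a<..<b} (\<lambda>x. V' 0 0 (0, x))" "ess_bounded {a<..<b} (\<lambda>x. V' 0 j (0, x))"
              by (intro ebC smooth_continuous_slice smooth_familyD(1)[OF sf])+
            show "AE x\<in>{a<..<b} in lborel. \<bar>V' 0 0 (0, x) - u0 x\<bar> \<le> e'"
              using w0
            proof (eventually_elim, intro impI)
              fix x assume "w (0, x) = u0 x"
              then show "\<bar>V' 0 0 (0, x) - u0 x\<bar> \<le> e'" using V'(2)[of "(0, x)"] T' by auto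
            qed
            show "\<forall>x\<in>{a<..<b}. \<bar>V' 0 j (0, x) - V 0 j (0, x)\<bar> \<le> e" using V'(3) T' by auto
            show "(LINT x:{a<..<b}|lborel. V' 0 0 (0, x) * (deriv ^^ j) \<phi> x) = (-1) ^ j * (LINT x:{a<..<b}|lborel. V' 0 j (0, x) * \<phi> x)"
              using space_integral_deriv[of "\<lambda>k x. V' 0 k (0, x)" b a \<phi> 0 j] sm DERIV_imp_deriv[OF d] smooth_familyD(4)[OF sf] \<phi>(1) ab
              by (simp add: fun_eq_iff)
          qed
        qed
        note wl = weak_limit_bound[OF b eb ebV ebC[OF smooth_continuous[OF s(1)]] \<phi>(2) ebC[OF smooth_continuous[OF s(2)]] _ eq app]
        show "(LINT x:{a<..<b}|lborel. (g0 j x - V 0 j (0, x) - e) * \<phi> x) \<le> 0"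
          "(LINT x:{a<..<b}|lborel. (V 0 j (0, x) - g0 j x - e) * \<phi> x) \<le> 0"
          by (rule wl; simp)+
      qed
      have "set_integrable lborel {a<..<b} (\<lambda>x. g0 j x - V 0 j (0, x) - e)" "set_integrable lborel {a<..<b} (\<lambda>x. V 0 j (0, x) - g0 j x - e)"
        by (intro ess_bounded_integrable b ess_bounded_diff ess_bounded_const eb ebV)+
      note intg = this
      have "AE x\<in>{a<..<b} in lborel. g0 j x - V 0 j (0, x) - e \<le> 0"
        by (rule AE_nonpos_space[OF intg(1)], rule main(1))
      moreover have "AE x\<in>{a<..<b} in lborel. V 0 j (0, x) - g0 j x - e \<le> 0"
        by (rule AE_nonpos_space[OF intg(2)], rule main(2))
      ultimately show ?thesis by eventually_elim auto
    qed
  qed (fact \<epsilon>0)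
qed

lemma mollification_close_derivs:
  assumes T': "0 < T'" "T' < T" and "e > 0"
  shows "\<exists>\<epsilon>0>0. \<forall>\<epsilon> K V j. mollifies T' \<epsilon> K V \<longrightarrow> \<epsilon> < \<epsilon>0 \<longrightarrow> j \<le> 3 \<longrightarrow>
    (AE z\<in>cell T' a b in lborel. \<bar>V 0 j z - f 0 j z\<bar> \<le> e) \<and>
    (AE x\<in>{a<..<b} in lborel. \<bar>V 0 j (0, x) - g0 j x\<bar> \<le> e)"
proof -
  define P where "P j \<epsilon>0 \<longleftrightarrow> \<epsilon>0 > 0 \<and> (\<forall>\<epsilon> K V. mollifies T' \<epsilon> K V \<longrightarrow> \<epsilon> < \<epsilon>0 \<longrightarrow>
    (AE z\<in>cell T' a b in lborel. \<bar>V 0 j z - f 0 j z\<bar> \<le> e) \<and>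
    (AE x\<in>{a<..<b} in lborel. \<bar>V 0 j (0, x) - g0 j x\<bar> \<le> e))" for j \<epsilon>0
  have "\<forall>j\<in>{..3}. \<exists>\<epsilon>0. P j \<epsilon>0"
    unfolding P_def using mollification_close_deriv[OF assms] by blast
  from bchoice[OF this] obtain E where E': "\<forall>j\<in>{..3}. P j (E j)" ..
  have E: "E j > 0" "\<And>\<epsilon> K V. mollifies T' \<epsilon> K V \<Longrightarrow> \<epsilon> < E j \<Longrightarrow>
    (AE z\<in>cell T' a b in lborel. \<bar>V 0 j z - f 0 j z\<bar> \<le> e) \<and>
    (AE x\<in>{a<..<b} in lborel. \<bar>V 0 j (0, x) - g0 j x\<bar> \<le> e)" if "j \<le> 3" for j
  proof -
    have "P j (E j)" using E' that by simp
    then show "E j > 0" "\<And>\<epsilon> K V. mollifies T' \<epsilon> K V \<Longrightarrow> \<epsilon> < E j \<Longrightarrow>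
      (AE z\<in>cell T' a b in lborel. \<bar>V 0 j z - f 0 j z\<bar> \<le> e) \<and>
      (AE x\<in>{a<..<b} in lborel. \<bar>V 0 j (0, x) - g0 j x\<bar> \<le> e)"
      unfolding P_def by blast+
  qed
  show ?thesis
  proof (intro exI[of _ "Min (E ` {..3})"] conjI[of "_ > 0"] allI impI)
    show "Min (E ` {..3}) > 0" using E(1) by (subst Min_gr_iff) auto
    fix \<epsilon> K V and j :: nat assume *: "mollifies T' \<epsilon> K V" "\<epsilon> < Min (E ` {..3})" "j \<le> 3"
    have "\<epsilon> < E j" using *(2,3) by (subst (asm) Min_gr_iff) auto
    from E(2)[OF *(3,1) this]
    show "(AE z\<in>cell T' a b in lborel. \<bar>V 0 j z - f 0 j z\<bar> \<le> e) \<and>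
      (AE x\<in>{a<..<b} in lborel. \<bar>V 0 j (0, x) - g0 j x\<bar> \<le> e)" .
  qed
qed

section \<open>The weak chain rule and the residual of the mollified equation\<close>

lemma AE_cell_mono: "AE z\<in>cell T a b in lborel. P z \<Longrightarrow> T' \<le> T \<Longrightarrow> AE z\<in>cell T' a b in lborel. P z"
  by (erule eventually_mono) auto

lemma product_close:
  fixes p q p' q' :: real
  assumes "\<bar>p'\<bar> \<le> M" "\<bar>q\<bar> \<le> M" "\<bar>p - p'\<bar> \<le> e" "\<bar>q - q'\<bar> \<le> e"
  shows "\<bar>p * q - p' * q'\<bar> \<le> 2 * M * e"
proof -
  have "p * q - p' * q' = (p - p') * q + p' * (q - q')" by (simp add: algebra_simps)
  also have "\<bar>\<dots>\<bar> \<le> \<bar>p - p'\<bar> * \<bar>q\<bar> + \<bar>p'\<bar> * \<bar>q - q'\<bar>" by (metis abs_mult abs_triangle_ineq)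
  also have "\<dots> \<le> e * M + M * e" using assms by (intro add_mono mult_mono) auto
  finally show ?thesis by simp
qed

text \<open>For a mollification the identity is the vanishing integral of the space derivative of
  \<open>V 0 0 z * V 0 0 z * \<phi> z\<close>. Uniform closeness of \<open>V 0 0\<close> and
  \<open>V 0 1\<close> transfers it to \<open>u\<close>, with an error proportional to an arbitrary
  \<open>e\<close>.\<close>

lemma weak_deriv_square: "weak_deriv T a b 0 1 (\<lambda>z. (u z)\<^sup>2 / 2) (\<lambda>z. u z * f 0 1 z)"
  unfolding weak_deriv_def
proof (intro conjI ballI)
  show "(\<lambda>z. u z * f 0 1 z) \<in> Linf T a b"
    using u f[of 0 1] by (intro Linf_mult) (auto simp: weak_deriv_def)
  fix \<phi> assume \<phi>: "\<phi> \<in> test_interior T a b"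
  then obtain s where s: "s < T" "\<And>t x. t \<ge> s \<Longrightarrow> \<phi> (t, x) = 0" and sm: "smooth \<phi>"
    by (auto simp: test_interior_def test_init_def)
  \<comment> \<open>The mollifications converge only on time ranges that end before
    \<open>T\<close>; the support of the test function ends before this \<open>T'\<close>.\<close>
  define T' where "T' = (max s 0 + T) / 2"
  have T': "0 < T'" "T' < T" "s < T'" using T s by (auto simp: T'_def)
  have \<phi>': "\<phi> \<in> test_init T' a b" using \<phi> s T' by (auto simp: test_interior_def test_init_def)
  note \<psi> = test_init_dx_iter[OF \<phi>', where j = 1, simplified]
  have sub: "cell T' a b \<subseteq> cell T a b" using T' by auto
  have eb: "ess_bounded (cell T' a b) u" "ess_bounded (cell T' a b) (f 0 1)"
    using ess_bounded_subset[OF f_ess_bounded[of 0 1] sub] ess_bounded_subset[OF Linf_ess_bounded[OF u] sub] by auto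
  have e\<phi>: "ess_bounded (cell T' a b) \<phi>" "ess_bounded (cell T' a b) (dx \<phi>)" using sm by auto
  note int = ess_bounded_integrable[OF _ bounded_cell cell_borel]
  obtain C1 where C1: "AE z\<in>cell T' a b in lborel. \<bar>dx \<phi> z\<bar> \<le> C1" using e\<phi>(2) by (auto simp: ess_bounded_def)
  obtain C2 where C2: "AE z\<in>cell T' a b in lborel. \<bar>\<phi> z\<bar> \<le> C2" using e\<phi>(1) by (auto simp: ess_bounded_def)
  define I where "I = (LINT z:cell T' a b|lborel. u z * u z / 2 * dx \<phi> z + u z * f 0 1 z * \<phi> z)"
  define C where "C = (M * \<bar>C1\<bar> + 2 * M * \<bar>C2\<bar>) * measure lborel (cell T' a b)"
  have "C \<ge> 0" using M by (simp add: C_def)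
  have "\<bar>I\<bar> \<le> e * C" if "e > 0" for e
  proof -
    from mollification_close_derivs[OF T'(1,2) \<open>e > 0\<close>] obtain \<epsilon>0 where
      \<epsilon>0: "\<epsilon>0 > 0" "\<And>\<epsilon> K V j. mollifies T' \<epsilon> K V \<Longrightarrow> \<epsilon> < \<epsilon>0 \<Longrightarrow> j \<le> 3 \<Longrightarrow>
        AE z\<in>cell T' a b in lborel. \<bar>V 0 j z - f 0 j z\<bar> \<le> e"
      by blast
    obtain \<epsilon> K V where m: "mollifies T' \<epsilon> K V" "\<epsilon> < \<epsilon>0"
      by (rule exists_small_mollification[OF less_imp_le[OF T'(1)] T'(2) \<epsilon>0(1)])
    have V: "smooth_family (b - a) V" by (rule mollifiesD(8)[OF m(1)])
    note V' = smooth_familyD[OF V]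
    have sV: "smooth (\<lambda>z. V 0 0 z * V 0 0 z)" using V'(1) by auto
    have "(LINT z:cell T' a b|lborel. dx (\<lambda>z. V 0 0 z * V 0 0 z * \<phi> z) z) = 0"
    proof (rule cell_integral_dx)
      show "smooth (\<lambda>z. V 0 0 z * V 0 0 z * \<phi> z)" using sV sm by auto
      show "V 0 0 (t, x + (b - a)) * V 0 0 (t, x + (b - a)) * \<phi> (t, x + (b - a)) = V 0 0 (t, x) * V 0 0 (t, x) * \<phi> (t, x)" for t x
        using V'(4) \<phi>' by (simp add: test_init_def)
    qed (use ab in simp)
    moreover have "dx (\<lambda>z. V 0 0 z * V 0 0 z * \<phi> z) = (\<lambda>z. 2 * (V 0 0 z * V 0 0 z / 2 * dx \<phi> z + V 0 0 z * V 0 1 z * \<phi> z))"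
      unfolding dt_dx_mult(2)[OF sV sm] dt_dx_mult(2)[OF V'(1) V'(1)] V'(3) by (simp add: fun_eq_iff algebra_simps)
    ultimately have "(LINT z:cell T' a b|lborel. 2 * (V 0 0 z * V 0 0 z / 2 * dx \<phi> z + V 0 0 z * V 0 1 z * \<phi> z)) = 0"
      by simp
    then have z: "(LINT z:cell T' a b|lborel. V 0 0 z * V 0 0 z / 2 * dx \<phi> z + V 0 0 z * V 0 1 z * \<phi> z) = 0"
      unfolding set_integral_mult_right by linarith
    have ebV: "ess_bounded (cell T' a b) (V i j)" for i j using V'(1) by auto
    let ?d = "\<lambda>z. (u z * u z / 2 * dx \<phi> z + u z * f 0 1 z * \<phi> z) - (V 0 0 z * V 0 0 z / 2 * dx \<phi> z + V 0 0 z * V 0 1 z * \<phi> z)"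
    have eI: "ess_bounded (cell T' a b) (\<lambda>z. u z * u z / 2 * dx \<phi> z + u z * f 0 1 z * \<phi> z)"
      "ess_bounded (cell T' a b) (\<lambda>z. V 0 0 z * V 0 0 z / 2 * dx \<phi> z + V 0 0 z * V 0 1 z * \<phi> z)"
      by (intro ess_bounded_add ess_bounded_mult ess_bounded_divide eb e\<phi> ebV)+
    have Id: "I = (LINT z:cell T' a b|lborel. ?d z)"
      using z set_integral_diff(2)[OF eI[THEN int]] by (simp add: I_def)
    have "\<bar>I\<bar> \<le> (e * (M * \<bar>C1\<bar> + 2 * M * \<bar>C2\<bar>)) * measure lborel (cell T' a b)"
      unfolding Id
    proof (rule abs_set_integral_le[OF ess_bounded_diff[OF eI] bounded_cell cell_borel])
      have a1: "AE z\<in>cell T' a b in lborel. \<bar>V 0 0 z - u z\<bar> \<le> e" using \<epsilon>0(2)[OF m, of 0] f00 by simp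
      have a2: "AE z\<in>cell T' a b in lborel. \<bar>V 0 1 z - f 0 1 z\<bar> \<le> e" using \<epsilon>0(2)[OF m, of 1] by simp
      have a3: "AE z\<in>cell T' a b in lborel. \<bar>u z\<bar> \<le> M" using AE_cell_mono[OF fM[of 0 0], of T'] f00 T' by simp
      have a4: "AE z\<in>cell T' a b in lborel. \<bar>f 0 1 z\<bar> \<le> M" using AE_cell_mono[OF fM[of 0 1], of T'] T' by simp
      show "AE z\<in>cell T' a b in lborel. \<bar>?d z\<bar> \<le> e * (M * \<bar>C1\<bar> + 2 * M * \<bar>C2\<bar>)"
        using a1 a2 a3 a4 C1 C2
      proof (eventually_elim, intro impI)
        fix z assume *: "z \<in> cell T' a b \<longrightarrow> \<bar>V 0 0 z - u z\<bar> \<le> e" "z \<in> cell T' a b \<longrightarrow> \<bar>V 0 1 z - f 0 1 z\<bar> \<le> e"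
          "z \<in> cell T' a b \<longrightarrow> \<bar>u z\<bar> \<le> M" "z \<in> cell T' a b \<longrightarrow> \<bar>f 0 1 z\<bar> \<le> M"
          "z \<in> cell T' a b \<longrightarrow> \<bar>dx \<phi> z\<bar> \<le> C1" "z \<in> cell T' a b \<longrightarrow> \<bar>\<phi> z\<bar> \<le> C2" "z \<in> cell T' a b"
        have VM: "\<bar>V 0 0 z\<bar> \<le> M" "\<bar>V 0 1 z\<bar> \<le> M"
          using mollification_bound[OF m(1), of z 0 0] mollification_bound[OF m(1), of z 0 1] *(7) by auto
        have p: "\<bar>u z * u z - V 0 0 z * V 0 0 z\<bar> \<le> 2 * M * e" "\<bar>u z * f 0 1 z - V 0 0 z * V 0 1 z\<bar> \<le> 2 * M * e"
          using * VM by (auto intro!: product_close simp: abs_minus_commute)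
        have "?d z = (u z * u z - V 0 0 z * V 0 0 z) / 2 * dx \<phi> z + (u z * f 0 1 z - V 0 0 z * V 0 1 z) * \<phi> z"
          by (simp add: field_simps)
        also have "\<bar>\<dots>\<bar> \<le> \<bar>(u z * u z - V 0 0 z * V 0 0 z) / 2\<bar> * \<bar>dx \<phi> z\<bar> + \<bar>u z * f 0 1 z - V 0 0 z * V 0 1 z\<bar> * \<bar>\<phi> z\<bar>"
          by (metis abs_mult abs_triangle_ineq)
        also have "\<dots> \<le> (M * e) * \<bar>C1\<bar> + (2 * M * e) * \<bar>C2\<bar>"
        proof (intro add_mono mult_mono)
          show "\<bar>(u z * u z - V 0 0 z * V 0 0 z) / 2\<bar> \<le> M * e" using p(1) by simp
          show "\<bar>u z * f 0 1 z - V 0 0 z * V 0 1 z\<bar> \<le> 2 * M * e" by (rule p(2))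
          show "\<bar>dx \<phi> z\<bar> \<le> \<bar>C1\<bar>" "\<bar>\<phi> z\<bar> \<le> \<bar>C2\<bar>" using *(5,6,7) by linarith+
        qed (use M \<open>e > 0\<close> in simp_all)
        finally show "\<bar>?d z\<bar> \<le> e * (M * \<bar>C1\<bar> + 2 * M * \<bar>C2\<bar>)" by (simp add: algebra_simps)
      qed
    qed
    then show ?thesis unfolding C_def by (simp only: mult.assoc)
  qed
  note IC = this
  have "\<bar>I\<bar> \<le> d" if "d > 0" for d
  proof -
    have "d / (C + 1) > 0" using \<open>C \<ge> 0\<close> that by simp
    from IC[OF this] have "\<bar>I\<bar> \<le> d / (C + 1) * C" .
    also have "\<dots> \<le> d" using \<open>C \<ge> 0\<close> that by (simp add: field_simps)
    finally show ?thesis .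
  qed
  then have "I = 0" by (metis abs_ge_zero abs_le_zero_iff dense_ge)
  moreover have "set_integrable lborel (cell T' a b) (\<lambda>z. u z * u z / 2 * dx \<phi> z)" "set_integrable lborel (cell T' a b) (\<lambda>z. u z * f 0 1 z * \<phi> z)"
    by (intro int ess_bounded_mult ess_bounded_divide eb e\<phi>)+
  ultimately have "(LINT z:cell T' a b|lborel. u z * u z / 2 * dx \<phi> z) = - (LINT z:cell T' a b|lborel. u z * f 0 1 z * \<phi> z)"
    by (simp add: I_def set_integral_add)
  moreover have "(LINT z:cell T a b|lborel. u z * u z / 2 * dx \<phi> z) = (LINT z:cell T' a b|lborel. u z * u z / 2 * dx \<phi> z)"
    "(LINT z:cell T a b|lborel. u z * f 0 1 z * \<phi> z) = (LINT z:cell T' a b|lborel. u z * f 0 1 z * \<phi> z)"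
  proof -
    have "\<phi> z = 0" "dx \<phi> z = 0" if "fst z \<ge> T'" for z
      using \<psi>(3)[of "fst z" "snd z"] s(2)[of "fst z" "snd z"] T' that by auto
    then show "(LINT z:cell T a b|lborel. u z * u z / 2 * dx \<phi> z) = (LINT z:cell T' a b|lborel. u z * u z / 2 * dx \<phi> z)"
      "(LINT z:cell T a b|lborel. u z * f 0 1 z * \<phi> z) = (LINT z:cell T' a b|lborel. u z * f 0 1 z * \<phi> z)"
      using T' by (auto intro!: cell_integral_cutoff)
  qed
  ultimately show "(LINT z:cell T a b|lborel. (u z)\<^sup>2 / 2 * (dt ^^ 0) ((dx ^^ 1) \<phi>) z)
      = (-1) ^ (0 + 1) * (LINT z:cell T a b|lborel. u z * f 0 1 z * \<phi> z)"
    by (simp add: power2_eq_square)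
qed

text \<open>The linear terms of the equation commute with mollification; what remains is the
  commutator of the product. Across the support of the kernel, of extent
  \<open>2 * \<epsilon>\<close> in time and \<open>\<epsilon>\<close> in space modulo the period,
  each factor varies by at most \<open>3 * M * \<epsilon>\<close>, which gives
  \<open>6 * M * M * \<epsilon>\<close>. Replacing \<open>V\<close> by \<open>u\<close> and
  \<open>f 0 1\<close> inside the mean gives \<open>2 * M * e\<close>.\<close>

lemma mollification_residual:
  assumes m: "mollifies T' \<epsilon> K V" and T1: "T1 + 2 * \<epsilon> \<le> T'" and z: "fst z \<in> {0..T1}" and e: "e \<ge> 0"
    and cl: "AE z\<in>cell T' a b in lborel. \<bar>V 0 0 z - f 0 0 z\<bar> \<le> e" "AE z\<in>cell T' a b in lborel. \<bar>V 0 1 z - f 0 1 z\<bar> \<le> e"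
  shows "\<bar>V 1 0 z + V 0 0 z * V 0 1 z + V 0 2 z + V 0 4 z\<bar> \<le> 2 * M * e + 6 * M * M * \<epsilon>"
proof -
  note mD = mollifiesD[OF m]
  have z': "fst z \<in> {0..T'}" using z T1 mD(1) by auto
  define N where "N = D T a b 0 1 (\<lambda>z. (u z)\<^sup>2 / 2)"
  have N: "weak_deriv T a b 0 1 (\<lambda>z. (u z)\<^sup>2 / 2) N"
    unfolding N_def D_def by (rule someI[where P = "weak_deriv T a b 0 1 (\<lambda>z. (u z)\<^sup>2 / 2)", OF weak_deriv_square])
  let ?K = "\<lambda>w. K (w - z)"
  \<comment> \<open>\<open>N\<close> is whichever weak derivative \<open>D\<close> selects. It is
    compared with \<open>u * f 0 1\<close> only after testing with the kernel, so that no pointwise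
    uniqueness enters.\<close>
  have NK: "(LINT w:cell T a b|lborel. N w * ?K w) = (LINT w:cell T a b|lborel. u w * f 0 1 w * ?K w)"
    using N weak_deriv_square mD(7)[OF z'] unfolding weak_deriv_def by fastforce
  note int = ess_bounded_integrable[OF _ bounded_cell cell_borel]
  have eK: "ess_bounded (cell T a b) ?K" by (rule kernel_ess_bounded[OF mD(3)])
  have eN: "ess_bounded (cell T a b) N" using N by (auto simp: weak_deriv_def intro: Linf_ess_bounded)
  have eu: "ess_bounded (cell T a b) u" by (rule Linf_ess_bounded[OF u])
  have ef: "ess_bounded (cell T a b) (f 1 0)" "ess_bounded (cell T a b) (f 0 2)" "ess_bounded (cell T a b) (f 0 4)" "ess_bounded (cell T a b) (f 0 1)"
    by (auto intro!: f_ess_bounded)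
  have i: "set_integrable lborel (cell T a b) (\<lambda>w. f 1 0 w * ?K w)" "set_integrable lborel (cell T a b) (\<lambda>w. N w * ?K w)"
    "set_integrable lborel (cell T a b) (\<lambda>w. f 0 2 w * ?K w)" "set_integrable lborel (cell T a b) (\<lambda>w. f 0 4 w * ?K w)"
    "set_integrable lborel (cell T a b) (\<lambda>w. u w * f 0 1 w * ?K w)"
    by (intro int ess_bounded_mult ef eN eK eu)+
  have "(LINT w:cell T a b|lborel. f 1 0 w * ?K w + N w * ?K w + f 0 2 w * ?K w + f 0 4 w * ?K w) = (LINT w:cell T a b|lborel. 0)"
    unfolding set_lebesgue_integral_def
  proof (rule integral_cong_AE)
    have "set_integrable lborel (cell T a b) (\<lambda>w. f 1 0 w * ?K w + N w * ?K w + f 0 2 w * ?K w + f 0 4 w * ?K w)"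
      by (intro set_integral_add(1) i)
    then show "(\<lambda>x. indicator (cell T a b) x *\<^sub>R (f 1 0 x * ?K x + N x * ?K x + f 0 2 x * ?K x + f 0 4 x * ?K x)) \<in> borel_measurable lborel"
      unfolding set_integrable_def by (rule borel_measurable_integrable)
    show "AE x in lborel. indicator (cell T a b) x *\<^sub>R (f 1 0 x * ?K x + N x * ?K x + f 0 2 x * ?K x + f 0 4 x * ?K x) = indicator (cell T a b) x *\<^sub>R 0"
      using KS
    proof eventually_elim
      case (elim x)
      show ?case
      proof (cases "x \<in> cell T a b")
        case True
        then have "f 1 0 x + N x + f 0 2 x + f 0 4 x = 0" using elim by (auto simp: N_def)
        then show ?thesis by (simp flip: distrib_right)
      qed simp
    qed
  qed simp
  then have sum0: "V 1 0 z + (LINT w:cell T a b|lborel. u w * f 0 1 w * ?K w) + V 0 2 z + V 0 4 z = 0"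
    using i mD(9)[of _ _ z] z' NK by (simp add: set_integral_add)
  have "V 1 0 z + V 0 0 z * V 0 1 z + V 0 2 z + V 0 4 z
      = (LINT w:cell T a b|lborel. V 0 0 z * V 0 1 z * ?K w) - (LINT w:cell T a b|lborel. u w * f 0 1 w * ?K w)"
    using sum0 mD(5)[OF z'] by simp
  also have "\<dots> = (LINT w:cell T a b|lborel. (V 0 0 z * V 0 1 z - u w * f 0 1 w) * ?K w)"
    unfolding left_diff_distrib
    by (rule set_integral_diff(2)[symmetric]) (intro i ess_bounded_cmult int eK)+
  also have "\<bar>\<dots>\<bar> \<le> 2 * M * e + 6 * M * M * \<epsilon>"
  proof (rule mollifier_average_le[OF m z'])
    show "ess_bounded (cell T a b) (\<lambda>w. V 0 0 z * V 0 1 z - u w * f 0 1 w)"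
      by (intro ess_bounded_diff ess_bounded_mult ef eu ess_bounded_const cell_borel)
    have a3: "AE z\<in>cell T a b in lborel. \<bar>u z\<bar> \<le> M" using fM[of 0 0] f00 by simp
    have a4: "AE z\<in>cell T a b in lborel. \<bar>f 0 1 z\<bar> \<le> M" using fM[of 0 1] by simp
    show "AE v\<in>cell T a b in lborel. ?K v \<noteq> 0 \<longrightarrow> \<bar>V 0 0 z * V 0 1 z - u v * f 0 1 v\<bar> \<le> 2 * M * e + 6 * M * M * \<epsilon>"
      using cl a3 a4
    proof (eventually_elim, intro impI)
      fix v assume *: "v \<in> cell T' a b \<longrightarrow> \<bar>V 0 0 v - f 0 0 v\<bar> \<le> e" "v \<in> cell T' a b \<longrightarrow> \<bar>V 0 1 v - f 0 1 v\<bar> \<le> e"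
        "v \<in> cell T a b \<longrightarrow> \<bar>u v\<bar> \<le> M" "v \<in> cell T a b \<longrightarrow> \<bar>f 0 1 v\<bar> \<le> M" "v \<in> cell T a b" "K (v - z) \<noteq> 0"
      from mD(6)[OF *(6)] obtain k :: int where k: "\<epsilon> < fst v - fst z" "fst v - fst z < 2 * \<epsilon>" "\<bar>snd v - snd z - of_int k * (b - a)\<bar> < \<epsilon>"
        by auto
      have v: "v \<in> cell T' a b" "fst v \<in> {0..T'}" using *(5) k(2) z T1 by (auto simp: mem_Times_iff)
      have B: "\<bar>V i j z\<bar> \<le> M" if "fst z \<in> {0..T'}" "i + j \<le> 4" for i j z by (rule mollification_bound[OF m that])
      have lip: "\<bar>V 0 j z - V 0 j v\<bar> \<le> 3 * M * \<epsilon>" if "j \<le> 3" for j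
      proof -
        have "\<bar>V 0 j (fst v, snd v) - V 0 j (fst z, snd z)\<bar> \<le> M * \<bar>fst v - fst z\<bar> + M * \<bar>snd v - snd z - of_int k * (b - a)\<bar>"
          using that by (intro smooth_family_lipschitz[OF mD(8) _ _ v(2) z'] B) auto
        also have "\<dots> \<le> M * (2 * \<epsilon>) + M * \<epsilon>"
          using k mD(1) M by (intro add_mono mult_left_mono) auto
        finally show ?thesis by (simp add: abs_minus_commute)
      qed
      have "\<bar>V 0 0 z * V 0 1 z - V 0 0 v * V 0 1 v\<bar> \<le> 2 * M * (3 * M * \<epsilon>)"
        using lip[of 0] lip[of 1] B[OF v(2), of 0 0] B[OF z', of 0 1] by (intro product_close) auto
      moreover have "\<bar>V 0 0 v * V 0 1 v - u v * f 0 1 v\<bar> \<le> 2 * M * e"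
        using * v f00 B[OF v(2), of 0 1] by (intro product_close) auto
      ultimately show "\<bar>V 0 0 z * V 0 1 z - u v * f 0 1 v\<bar> \<le> 2 * M * e + 6 * M * M * \<epsilon>" by (simp add: abs_le_iff)
    qed
  qed
  finally show ?thesis .
qed

lemma smooth_approximation:
  assumes T1: "0 < T1" "T1 < T" and e: "e > 0"
  obtains V where "smooth_family (b - a) V"
    "\<And>i j z. i + j \<le> 4 \<Longrightarrow> fst z \<in> {0..T1} \<Longrightarrow> \<bar>V i j z\<bar> \<le> M"
    "\<And>j. j \<le> 3 \<Longrightarrow> AE z\<in>cell T1 a b in lborel. \<bar>V 0 j z - f 0 j z\<bar> \<le> e"
    "\<And>j. j \<le> 3 \<Longrightarrow> AE x\<in>{a<..<b} in lborel. \<bar>V 0 j (0, x) - g0 j x\<bar> \<le> e"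
    "\<And>z. fst z \<in> {0..T1} \<Longrightarrow> \<bar>V 1 0 z + V 0 0 z * V 0 1 z + V 0 2 z + V 0 4 z\<bar> \<le> e"
proof -
  define T' where "T' = (T1 + T) / 2"
  have T': "0 < T'" "T' < T" "T1 < T'" using T1 by (auto simp: T'_def)
  \<comment> \<open>The residual of the mollified equation is at most
    \<open>2 * M * e' + 6 * M * M * \<epsilon>\<close>. The denominators here and in
    \<open>\<epsilon>1\<close> make each of the two terms at most \<open>e / 2\<close>.\<close>
  define e' where "e' = min e (e / (4 * M + 1))"
  have e': "e' > 0" "e' \<le> e" using e M by (auto simp: e'_def)
  have "2 * M * e' \<le> 2 * M * (e / (4 * M + 1))" using M by (intro mult_left_mono) (auto simp: e'_def)
  also have "\<dots> \<le> e / 2" using M e by (simp add: field_simps)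
  finally have e2: "2 * M * e' \<le> e / 2" .
  from mollification_close_derivs[OF T'(1,2) e'(1)] obtain \<epsilon>0 where
    \<epsilon>0: "\<epsilon>0 > 0" "\<And>\<epsilon> K V j. mollifies T' \<epsilon> K V \<Longrightarrow> \<epsilon> < \<epsilon>0 \<Longrightarrow> j \<le> 3 \<Longrightarrow>
      AE z\<in>cell T' a b in lborel. \<bar>V 0 j z - f 0 j z\<bar> \<le> e'"
    "\<And>\<epsilon> K V j. mollifies T' \<epsilon> K V \<Longrightarrow> \<epsilon> < \<epsilon>0 \<Longrightarrow> j \<le> 3 \<Longrightarrow>
      AE x\<in>{a<..<b} in lborel. \<bar>V 0 j (0, x) - g0 j x\<bar> \<le> e'"
    by blast
  define \<epsilon>1 where "\<epsilon>1 = min \<epsilon>0 (min ((T' - T1) / 2) (e / (12 * M * M + 1)))"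
  have "\<epsilon>1 > 0" using \<epsilon>0 T' e M by (auto simp: \<epsilon>1_def intro!: divide_pos_pos add_nonneg_pos)
  then obtain \<epsilon> K V where m: "mollifies T' \<epsilon> K V" "\<epsilon> < \<epsilon>1"
    by (rule exists_small_mollification[OF less_imp_le[OF T'(1)] T'(2)])
  have \<epsilon>: "\<epsilon> < \<epsilon>0" "T1 + 2 * \<epsilon> \<le> T'" "\<epsilon> \<le> e / (12 * M * M + 1)" using m(2) by (auto simp: \<epsilon>1_def)
  have "6 * M * M * \<epsilon> \<le> 6 * M * M * (e / (12 * M * M + 1))" using M \<epsilon> by (intro mult_left_mono) auto
  also have "\<dots> \<le> e / 2"
  proof -
    have "12 * M * M + 1 > 0" using M by (simp add: add_nonneg_pos)
    then show ?thesis using e by (simp add: field_simps)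
  qed
  finally have e3: "6 * M * M * \<epsilon> \<le> e / 2" .
  show thesis
  proof (rule that[of V])
    show "smooth_family (b - a) V" by (rule mollifiesD(8)[OF m(1)])
    show "\<bar>V i j z\<bar> \<le> M" if "i + j \<le> 4" "fst z \<in> {0..T1}" for i j z
      using that T' by (intro mollification_bound[OF m(1)]) auto
    show "AE z\<in>cell T1 a b in lborel. \<bar>V 0 j z - f 0 j z\<bar> \<le> e" if "j \<le> 3" for j
      using \<epsilon>0(2)[OF m(1) \<epsilon>(1) that] by eventually_elim (use T' e' in auto)
    show "AE x\<in>{a<..<b} in lborel. \<bar>V 0 j (0, x) - g0 j x\<bar> \<le> e" if "j \<le> 3" for j
      using \<epsilon>0(3)[OF m(1) \<epsilon>(1) that] by eventually_elim (use e' in auto)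
    show "\<bar>V 1 0 z + V 0 0 z * V 0 1 z + V 0 2 z + V 0 4 z\<bar> \<le> e" if "fst z \<in> {0..T1}" for z
      using mollification_residual[OF m(1) \<epsilon>(2) that less_imp_le[OF e'(1)] \<epsilon>0(2)[OF m(1) \<epsilon>(1)] \<epsilon>0(2)[OF m(1) \<epsilon>(1)]] e2 e3
      by simp
  qed
qed

end

section \<open>The relative energy method\<close>

text \<open>Starting the integral at \<open>c - 1\<close> costs nothing, since \<open>\<psi>\<close>
  vanishes up to \<open>c\<close>. For \<open>t \<le> c - 1\<close> the antiderivative is zero in a
  whole neighbourhood, so it is differentiable on the entire line.\<close>

lemma smooth_antiderivative:
  fixes \<psi> :: "real \<Rightarrow> real"
  assumes \<psi>: "smooth \<psi>" "\<And>t. t \<le> c \<Longrightarrow> \<psi> t = 0"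
  obtains G where "smooth G" "\<And>t. (G has_real_derivative \<psi> t) (at t)"
proof -
  define G where "G t = integral {c - 1..t} \<psi>" for t
  have d: "(G has_real_derivative \<psi> t) (at t)" for t
  proof (cases "t > c - 1")
    case True
    have "(G has_real_derivative \<psi> t) (at t within {c - 1..t + 1})"
      unfolding G_def using True
      by (intro integral_has_real_derivative smooth_continuous \<psi>) auto
    moreover have "t \<in> interior {c - 1..t + 1}" using True by simp
    ultimately show ?thesis using at_within_interior by metis
  next
    case False
    have "G s = 0" if "s < c" for s
    proof -
      have "G s = integral {c - 1..s} (\<lambda>_. 0 :: real)"
        unfolding G_def using that \<psi>(2) by (intro Henstock_Kurzweil_Integration.integral_cong) auto
      then show ?thesis by simp
    qed
    then have "eventually (\<lambda>s. 0 = G s) (nhds t)"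
      using False by (auto simp: eventually_nhds intro!: exI[of _ "{..<c}"])
    moreover have "((\<lambda>_. 0) has_real_derivative \<psi> t) (at t)" using \<psi>(2) False by simp
    ultimately show ?thesis by (rule DERIV_cong_ev[OF refl _ refl, THEN iffD1])
  qed
  show thesis by (rule that[OF smooth_if_deriv[OF d \<psi>(1)] d])
qed

definition rel_energy :: "real \<Rightarrow> (nat \<Rightarrow> real) \<Rightarrow> (nat \<Rightarrow> real) \<Rightarrow> real" where
  "rel_energy \<tau> q p = energy \<tau> (\<lambda>j. q j - p j)"

lemma rel_energy_eq:
  "rel_energy \<tau> q p = (q 0 - p 0)\<^sup>2 / 2 + \<tau> / 2 * ((q 1 - p 1)\<^sup>2 + (q 2 - p 2)\<^sup>2 + (q 3 - p 3)\<^sup>2)"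
  by (simp add: rel_energy_def energy_def numeral_eq_Suc)

lemma energy_eq: "energy \<tau> p = (p 0)\<^sup>2 / 2 + \<tau> / 2 * ((p 1)\<^sup>2 + (p 2)\<^sup>2 + (p 3)\<^sup>2)"
  by (simp add: energy_def numeral_eq_Suc)

text \<open>The left-hand side is the energy balance of \<open>q\<close>, minus the four equations of \<open>q\<close> tested with \<open>p j * \<phi>\<close>,
  plus the energy balance of \<open>p\<close>; here \<open>p' j\<close> and \<open>p'' j\<close> are the time and space derivatives of \<open>p j\<close>.\<close>
lemma rel_energy_identity:
  fixes q p p' p'' :: "nat \<Rightarrow> real" and \<tau> \<phi> \<phi>' \<rho>0 \<rho>2 :: real
  assumes eqs: "p'' 3 = \<rho>0 - p' 0 - p 0 * p'' 0 - p 2" "p'' 2 = \<tau> * p' 1 + p 3"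
    "p'' 1 = \<tau> * p' 2 + p 2 - \<rho>2" "p'' 0 = p 1 - \<tau> * p' 3"
  shows "(energy \<tau> q * \<phi>' + energy_source q * \<phi>)
    - (q 0 * (p 0 * \<phi>' + p' 0 * \<phi>) + ((q 0)\<^sup>2 / 2 + q 3) * (p'' 0 * \<phi>) - q 2 * (p 0 * \<phi>))
    - (\<tau> * q 1 * (p 1 * \<phi>' + p' 1 * \<phi>) + (- q 2) * (p'' 1 * \<phi>) - q 3 * (p 1 * \<phi>))
    - (\<tau> * q 2 * (p 2 * \<phi>' + p' 2 * \<phi>) + (- q 1) * (p'' 2 * \<phi>) - q 2 * (p 2 * \<phi>))
    - (\<tau> * q 3 * (p 3 * \<phi>' + p' 3 * \<phi>) + q 0 * (p'' 3 * \<phi>) - (- q 1) * (p 3 * \<phi>))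
    + (energy \<tau> p * \<phi>' + (p 0 * p' 0 + \<tau> * (p 1 * p' 1 + p 2 * p' 2 + p 3 * p' 3)) * \<phi>)
    - (- (p 0)\<^sup>2 / 2 * p'' 0 - p 0 * p'' 3 - p'' 0 * p 3 + p 1 * p'' 2 + p'' 1 * p 2) * \<phi>
    = rel_energy \<tau> q p * \<phi>' + (- (q 0 - p 0) * \<rho>0 - (q 2 - p 2) * \<rho>2 - (q 0 - p 0) * (q 2 - p 2)
      - (q 2 - p 2)\<^sup>2 - (q 0 - p 0)\<^sup>2 * p'' 0 / 2) * \<phi>"
  unfolding rel_energy_eq energy_eq energy_source_def eqs
  by (simp add: field_simps power2_eq_square)

text \<open>Three applications of Young's inequality. The terms \<open>w2 * \<rho>2\<close> and
  \<open>w0 * w2\<close> each leave half of \<open>w2\<^sup>2\<close>, and together they use up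
  exactly the damping \<open>- w2\<^sup>2\<close>. This matters because the energy controls
  \<open>w2\<^sup>2\<close> only with the factor \<open>\<tau>\<close>.\<close>

lemma rel_energy_production_le:
  fixes w0 w2 \<rho>0 \<rho>2 p :: real
  assumes "\<bar>p\<bar> \<le> 2 * M" "\<bar>\<rho>0\<bar> \<le> A" "\<bar>\<rho>2\<bar> \<le> B"
  shows "- w0 * \<rho>0 - w2 * \<rho>2 - w0 * w2 - w2\<^sup>2 - w0\<^sup>2 * p / 2 \<le> (2 + 2 * M) * (w0\<^sup>2 / 2) + (A\<^sup>2 + B\<^sup>2) / 2"
proof -
  have "\<rho>0\<^sup>2 \<le> A\<^sup>2" "\<rho>2\<^sup>2 \<le> B\<^sup>2" using assms by (simp_all add: abs_le_square_iff[symmetric])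
  moreover have "- w0\<^sup>2 * p / 2 \<le> w0\<^sup>2 * (2 * M) / 2"
    using mult_left_mono[of "- p" "2 * M" "w0\<^sup>2"] assms(1) by (simp add: abs_le_iff)
  moreover have "0 \<le> (w0 + \<rho>0)\<^sup>2" "0 \<le> (w2 + \<rho>2)\<^sup>2" "0 \<le> (w0 + w2)\<^sup>2" by simp_all
  ultimately show ?thesis by (simp add: power2_eq_square field_simps)
qed

text \<open>The corrections \<open>- \<tau> V 1 2\<close> and \<open>\<tau> V 1 0\<close> make the second and the fourth equation hold exactly and
  leave residuals of order \<open>\<tau>\<close> in the first and in the damped third equation.\<close>
definition ansatz :: "(nat \<Rightarrow> nat \<Rightarrow> real \<times> real \<Rightarrow> real) \<Rightarrow> real \<Rightarrow> nat \<Rightarrow> nat \<Rightarrow> nat \<Rightarrow> real \<times> real \<Rightarrow> real" where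
  "ansatz V \<tau> i k j z = (if j = 0 then V i k z - \<tau> * V (Suc i) (k + 2) z
     else if j = 1 then V i (k + 1) z else if j = 2 then V i (k + 2) z + \<tau> * V (Suc i) k z else V i (k + 3) z)"

lemma ansatz_smooth:
  assumes V: "smooth_family L V"
  shows "smooth (ansatz V \<tau> i k j)" "dt (ansatz V \<tau> i k j) = ansatz V \<tau> (Suc i) k j"
    "dx (ansatz V \<tau> i k j) = ansatz V \<tau> i (Suc k) j"
    "ansatz V \<tau> i k j (t, x + L) = ansatz V \<tau> i k j (t, x)"
proof -
  note V' = smooth_familyD[OF V]
  consider "j = 0" | "j = 1" | "j = 2" | "j > 2" by linarith
  then have "smooth (ansatz V \<tau> i k j) \<and> dt (ansatz V \<tau> i k j) = ansatz V \<tau> (Suc i) k j \<and>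
    dx (ansatz V \<tau> i k j) = ansatz V \<tau> i (Suc k) j"
  proof cases
    case 1
    have e: "ansatz V \<tau> i k j = (\<lambda>z. V i k z + (- \<tau>) * V (Suc i) (k + 2) z)" for i k
      by (auto simp: ansatz_def 1)
    have s: "smooth (\<lambda>z. (- \<tau>) * V (Suc i) (k + 2) z)" by (intro smooth_cmult V')
    show ?thesis
      unfolding e dt_dx_add[OF V'(1) s] dt_dx_cmult[OF V'(1)] V'(2,3) using smooth_add[OF V'(1) s] by simp
  next
    case 2
    have e: "ansatz V \<tau> i k j = V i (k + 1)" for i k
      by (auto simp: ansatz_def 2)
    show ?thesis unfolding e using V' by simp
  next
    case 3
    have e: "ansatz V \<tau> i k j = (\<lambda>z. V i (k + 2) z + \<tau> * V (Suc i) k z)" for i k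
      by (auto simp: ansatz_def 3)
    have s: "smooth (\<lambda>z. \<tau> * V (Suc i) k z)" by (intro smooth_cmult V')
    show ?thesis
      unfolding e dt_dx_add[OF V'(1) s] dt_dx_cmult[OF V'(1)] V'(2,3) using smooth_add[OF V'(1) s] by simp
  next
    case 4
    have e: "ansatz V \<tau> i k j = V i (k + 3)" for i k
      using 4 by (auto simp: ansatz_def)
    show ?thesis unfolding e using V' by simp
  qed
  then show "smooth (ansatz V \<tau> i k j)" "dt (ansatz V \<tau> i k j) = ansatz V \<tau> (Suc i) k j"
    "dx (ansatz V \<tau> i k j) = ansatz V \<tau> i (Suc k) j" by blast+
  show "ansatz V \<tau> i k j (t, x + L) = ansatz V \<tau> i k j (t, x)"
    by (simp add: ansatz_def V')
qed

text \<open>The cubic expression is the part of the relative flux that involves \<open>p\<close>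
  alone: the energy flux of \<open>p\<close> minus the sum of each \<open>p j\<close> times the flux
  of the corresponding equation. Its space derivative integrates to zero over a period, which
  removes the last line of \<open>rel_energy_identity\<close>.\<close>

lemma smooth_energy_dt_dx:
  fixes P :: "nat \<Rightarrow> real \<times> real \<Rightarrow> real"
  assumes P: "\<And>j. smooth (P j)" and \<phi>: "smooth \<phi>" "dx \<phi> = (\<lambda>_. 0)"
  shows "smooth (\<lambda>z. energy \<tau> (\<lambda>j. P j z) * \<phi> z)"
    "dt (\<lambda>z. energy \<tau> (\<lambda>j. P j z) * \<phi> z) z = energy \<tau> (\<lambda>j. P j z) * dt \<phi> z
      + (P 0 z * dt (P 0) z + \<tau> * (P 1 z * dt (P 1) z + P 2 z * dt (P 2) z + P 3 z * dt (P 3) z)) * \<phi> z"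
    "smooth (\<lambda>z. (- ((P 0 z) ^ 3) / 6 - P 0 z * P 3 z + P 1 z * P 2 z) * \<phi> z)"
    "dx (\<lambda>z. (- ((P 0 z) ^ 3) / 6 - P 0 z * P 3 z + P 1 z * P 2 z) * \<phi> z) z
      = (- (P 0 z)\<^sup>2 / 2 * dx (P 0) z - P 0 z * dx (P 3) z - dx (P 0) z * P 3 z + P 1 z * dx (P 2) z + dx (P 1) z * P 2 z) * \<phi> z"
proof -
  have PP: "smooth (\<lambda>z. P i z * P j z)" for i j by (intro smooth_mult P)
  define H where "H = (\<lambda>z. (P 1 z * P 1 z + P 2 z * P 2 z) + P 3 z * P 3 z)"
  define F where "F = (\<lambda>z. (1 / 2) * (P 0 z * P 0 z) + (\<tau> / 2) * H z)"
  have sH: "smooth H" unfolding H_def by (intro smooth_add PP)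
  have sF: "smooth F" unfolding F_def by (intro smooth_add smooth_cmult PP sH)
  have eF: "energy \<tau> (\<lambda>j. P j z) = F z" for z
    by (simp add: energy_eq F_def H_def power2_eq_square)
  show "smooth (\<lambda>z. energy \<tau> (\<lambda>j. P j z) * \<phi> z)" unfolding eF by (intro smooth_mult sF \<phi>)
  have dH: "dt H = (\<lambda>z. 2 * (P 1 z * dt (P 1) z + P 2 z * dt (P 2) z + P 3 z * dt (P 3) z))"
    unfolding H_def dt_dx_add[OF smooth_add[OF PP PP] PP] dt_dx_add[OF PP PP] dt_dx_mult[OF P P]
    by (simp add: fun_eq_iff algebra_simps)
  have dF: "dt F = (\<lambda>z. P 0 z * dt (P 0) z + \<tau> * (P 1 z * dt (P 1) z + P 2 z * dt (P 2) z + P 3 z * dt (P 3) z))"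
    unfolding F_def dt_dx_add[OF smooth_cmult[OF PP] smooth_cmult[OF sH]] dt_dx_cmult[OF PP] dt_dx_cmult[OF sH] dt_dx_mult[OF P P] dH
    by (simp add: fun_eq_iff field_simps)
  show "dt (\<lambda>z. energy \<tau> (\<lambda>j. P j z) * \<phi> z) z = energy \<tau> (\<lambda>j. P j z) * dt \<phi> z
      + (P 0 z * dt (P 0) z + \<tau> * (P 1 z * dt (P 1) z + P 2 z * dt (P 2) z + P 3 z * dt (P 3) z)) * \<phi> z"
    unfolding eF dt_dx_mult[OF sF \<phi>(1)] dF by simp
  define N where "N = (\<lambda>z. ((- 1 / 6) * (P 0 z * P 0 z * P 0 z) + (- 1) * (P 0 z * P 3 z)) + P 1 z * P 2 z)"
  have sP: "smooth (\<lambda>z. P 0 z * P 0 z * P 0 z)" by (intro smooth_mult P)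
  have sN: "smooth N" unfolding N_def by (intro smooth_add smooth_cmult PP sP)
  have eN: "- ((P 0 z) ^ 3) / 6 - P 0 z * P 3 z + P 1 z * P 2 z = N z" for z
    by (simp add: N_def power3_eq_cube)
  show "smooth (\<lambda>z. (- ((P 0 z) ^ 3) / 6 - P 0 z * P 3 z + P 1 z * P 2 z) * \<phi> z)"
    unfolding eN by (intro smooth_mult sN \<phi>)
  have dN: "dx N = (\<lambda>z. - (P 0 z)\<^sup>2 / 2 * dx (P 0) z - P 0 z * dx (P 3) z - dx (P 0) z * P 3 z + P 1 z * dx (P 2) z + dx (P 1) z * P 2 z)"
    unfolding N_def dt_dx_add[OF smooth_add[OF smooth_cmult[OF sP] smooth_cmult[OF PP]] PP]
      dt_dx_add[OF smooth_cmult[OF sP] smooth_cmult[OF PP]] dt_dx_cmult[OF PP] dt_dx_cmult[OF sP]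
      dt_dx_mult[OF PP P] dt_dx_mult[OF P P]
    by (simp add: fun_eq_iff field_simps power2_eq_square)
  show "dx (\<lambda>z. (- ((P 0 z) ^ 3) / 6 - P 0 z * P 3 z + P 1 z * P 2 z) * \<phi> z) z
      = (- (P 0 z)\<^sup>2 / 2 * dx (P 0) z - P 0 z * dx (P 3) z - dx (P 0) z * P 3 z + P 1 z * dx (P 2) z + dx (P 1) z * P 2 z) * \<phi> z"
    unfolding eN dt_dx_mult[OF sN \<phi>(1)] dN \<phi>(2) by simp
qed

lemma deriv_zero_right:
  fixes \<theta> :: "real \<Rightarrow> real"
  assumes "\<And>t. t \<ge> d \<Longrightarrow> \<theta> t = 0" "t > d"
  shows "deriv \<theta> t = 0"
proof -
  have "eventually (\<lambda>s. 0 = \<theta> s) (nhds t)"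
    using assms by (auto simp: eventually_nhds intro!: exI[of _ "{d<..}"])
  then have "(\<theta> has_real_derivative 0) (at t)"
    using DERIV_cong_ev[OF refl _ refl, THEN iffD1, OF _ DERIV_const] by blast
  then show ?thesis by (rule DERIV_imp_deriv)
qed

lemma weak_balance_iff:
  "weak_balance T a b A B R A0 \<longleftrightarrow> (\<forall>\<phi>\<in>test_init T a b.
     (LINT z:cell T a b|lborel. A z * dt \<phi> z + B z * dx \<phi> z - R z * \<phi> z) +
     (LINT x:{a<..<b}|lborel. A0 x * \<phi> (0, x)) = 0)"
  by (simp add: weak_balance_def)

text \<open>The accuracy of the smooth approximation is tied to \<open>\<tau>\<close>: residual and
  initial error are at most \<open>\<tau>\<close>. \<open>V\<close> may depend on
  \<open>\<tau>\<close> and \<open>T1\<close>, but the derivative bound \<open>M\<close> does not,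
  and the constants below are built from \<open>T\<close>, \<open>a\<close>, \<open>b\<close> and
  \<open>M\<close> only.\<close>

locale approximate_solution =
  fixes T a b M \<tau> T1 :: real and V :: "nat \<Rightarrow> nat \<Rightarrow> real \<times> real \<Rightarrow> real"
    and q :: "real \<times> real \<Rightarrow> nat \<Rightarrow> real" and qin :: "real \<Rightarrow> nat \<Rightarrow> real"
  assumes T1: "0 < T1" "T1 < T" and ab: "a < b" and M: "M \<ge> 0" and \<tau>: "0 < \<tau>" "\<tau> \<le> 1"
    and V: "smooth_family (b - a) V"
    and VM: "i + j \<le> 4 \<Longrightarrow> fst z \<in> {0..T1} \<Longrightarrow> \<bar>V i j z\<bar> \<le> M"
    and res: "fst z \<in> {0..T1} \<Longrightarrow> \<bar>V 1 0 z + V 0 0 z * V 0 1 z + V 0 2 z + V 0 4 z\<bar> \<le> \<tau>"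
    and q: "entropy_solution \<tau> T a b q qin"
    and qin: "j \<le> 3 \<Longrightarrow> ess_bounded {a<..<b} (\<lambda>x. qin x j)"
    and init: "j \<le> 3 \<Longrightarrow> AE x\<in>{a<..<b} in lborel. \<bar>V 0 j (0, x) - qin x j\<bar> \<le> \<tau>"
begin

abbreviation "P \<equiv> ansatz V \<tau> 0 0"
abbreviation "P' \<equiv> ansatz V \<tau> 1 0"
abbreviation "P'' \<equiv> ansatz V \<tau> 0 1"

definition "\<rho>0 z = P' 0 z + P 0 z * P'' 0 z + P 2 z + P'' 3 z"
definition "\<rho>2 z = \<tau> * P' 2 z + P 2 z - P'' 1 z"

text \<open>The coefficient of the relative energy in \<open>rel_energy_production_le\<close>. The
  next constant is half the sum of the squared residual constants of \<open>P_bounds\<close>, and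
  the third one comes from the computation in \<open>initial_rel_energy\<close>.\<close>

definition "growth = 2 + 2 * M"
definition "source_const = ((1 + 2 * M + 3 * M\<^sup>2)\<^sup>2 + (3 * M)\<^sup>2) / 2"
definition "init_const = (1 + M)\<^sup>2 + 1"

lemma q_ess_bounded: "j \<le> 3 \<Longrightarrow> ess_bounded (cell T a b) (\<lambda>z. q z j)"
  using q by (auto simp: entropy_solution_def intro: Linf_ess_bounded)

lemma P_smooth: "smooth (P j)" "dt (P j) = P' j" "dx (P j) = P'' j" "smooth (P' j)" "smooth (P'' j)"
  "P j (t, x + (b - a)) = P j (t, x)"
  using ansatz_smooth[OF V] by simp_all

lemma P_equations:
  "P'' 3 z = \<rho>0 z - P' 0 z - P 0 z * P'' 0 z - P 2 z" "P'' 2 z = \<tau> * P' 1 z + P 3 z"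
  "P'' 1 z = \<tau> * P' 2 z + P 2 z - \<rho>2 z" "P'' 0 z = P 1 z - \<tau> * P' 3 z"
  by (simp_all add: \<rho>0_def \<rho>2_def ansatz_def numeral_eq_Suc)

text \<open>Order four is exactly what occurs: \<open>V 0 4\<close>, \<open>V 1 3\<close> and
  \<open>V 2 2\<close> enter \<open>\<rho>0\<close>. Its part without a factor \<open>\<tau>\<close>
  is the Kuramoto-Sivashinsky residual of \<open>V\<close>, which is at most \<open>\<tau>\<close>
  by \<open>res\<close>. Higher powers of \<open>\<tau>\<close> are absorbed by
  \<open>\<tau> \<le> 1\<close>.\<close>

lemma P_bounds:
  assumes z: "fst z \<in> {0..T1}"
  shows "\<bar>P'' 0 z\<bar> \<le> 2 * M" "\<bar>\<rho>0 z\<bar> \<le> (1 + 2 * M + 3 * M\<^sup>2) * \<tau>" "\<bar>\<rho>2 z\<bar> \<le> (3 * M) * \<tau>"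
proof -
  have b: "\<bar>V i j z\<bar> \<le> M" if "i + j \<le> 4" for i j using VM[OF that z] .
  have t: "\<bar>\<tau> * x\<bar> \<le> \<tau> * C" if "\<bar>x\<bar> \<le> C" for x C :: real
    using \<tau> that by (simp add: abs_mult)
  have t1: "\<bar>\<tau> * x\<bar> \<le> C" if "\<bar>x\<bar> \<le> C" for x C :: real
  proof -
    have "\<tau> * C \<le> 1 * C" using \<tau> that by (intro mult_right_mono) linarith+
    with t[OF that] show ?thesis by simp
  qed
  have "P'' 0 z = V 0 1 z - \<tau> * V 1 3 z" by (simp add: ansatz_def numeral_eq_Suc)
  then show "\<bar>P'' 0 z\<bar> \<le> 2 * M" using b[of 0 1] t1[OF b[of 1 3]] by simp
  have "\<rho>2 z = \<tau> * (V 1 2 z + \<tau> * V 2 0 z + V 1 0 z)"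
    by (simp add: \<rho>2_def ansatz_def numeral_eq_Suc algebra_simps)
  also have "\<bar>\<dots>\<bar> \<le> \<tau> * (3 * M)"
    using b[of 1 2] t1[OF b[of 2 0]] b[of 1 0] by (intro t) simp
  finally show "\<bar>\<rho>2 z\<bar> \<le> (3 * M) * \<tau>" by (simp add: mult.commute)
  have "\<rho>0 z = (V 1 0 z + V 0 0 z * V 0 1 z + V 0 2 z + V 0 4 z)
      + \<tau> * (- V 2 2 z + V 1 0 z - V 0 0 z * V 1 3 z - V 1 2 z * V 0 1 z + \<tau> * (V 1 2 z * V 1 3 z))"
    by (simp add: \<rho>0_def ansatz_def numeral_eq_Suc algebra_simps)
  also have "\<bar>\<dots>\<bar> \<le> \<tau> + \<tau> * (M + M + M\<^sup>2 + M\<^sup>2 + M\<^sup>2)"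
  proof -
    have p: "\<bar>V i j z * V k l z\<bar> \<le> M\<^sup>2" if "i + j \<le> 4" "k + l \<le> 4" for i j k l
      using mult_mono[OF b[OF that(1)] b[OF that(2)]] M by (simp add: abs_mult power2_eq_square)
    have "\<bar>- V 2 2 z + V 1 0 z - V 0 0 z * V 1 3 z - V 1 2 z * V 0 1 z + \<tau> * (V 1 2 z * V 1 3 z)\<bar> \<le> M + M + M\<^sup>2 + M\<^sup>2 + M\<^sup>2"
      using b[of 2 2] b[of 1 0] p[of 0 0 1 3] p[of 1 2 0 1] t1[OF p[of 1 2 1 3]] by (simp add: abs_le_iff)
    from t[OF this] show ?thesis using res[OF z] by linarith
  qed
  also have "\<dots> = (1 + 2 * M + 3 * M\<^sup>2) * \<tau>" by (simp add: algebra_simps)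
  finally show "\<bar>\<rho>0 z\<bar> \<le> (1 + 2 * M + 3 * M\<^sup>2) * \<tau>" .
qed

definition "E z = rel_energy \<tau> (q z) (\<lambda>j. P j z)"

lemma E_nonneg: "E z \<ge> 0"
  using \<tau> by (simp add: E_def rel_energy_eq)

lemma E_ess_bounded: "ess_bounded (cell T a b) E"
  unfolding E_def[abs_def] rel_energy_eq
  by (intro ess_bounded_add ess_bounded_divide ess_bounded_power2 ess_bounded_cmult ess_bounded_diff
      q_ess_bounded ess_bounded_smooth P_smooth) auto

text \<open>The initial data carry no corrections, so components 0 and 2 differ from the ansatz by
  the mollification error \<open>\<tau>\<close> plus a correction of at most
  \<open>M * \<tau>\<close>; the squares of these differences are of the required order.\<close>

lemma initial_rel_energy:
  "AE x\<in>{a<..<b} in lborel. rel_energy \<tau> (qin x) (\<lambda>j. P j (0, x)) \<le> init_const * \<tau>\<^sup>2"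
proof -
  have "AE x\<in>{a<..<b} in lborel. \<bar>V 0 0 (0, x) - qin x 0\<bar> \<le> \<tau>"
    "AE x\<in>{a<..<b} in lborel. \<bar>V 0 1 (0, x) - qin x 1\<bar> \<le> \<tau>"
    "AE x\<in>{a<..<b} in lborel. \<bar>V 0 2 (0, x) - qin x 2\<bar> \<le> \<tau>"
    "AE x\<in>{a<..<b} in lborel. \<bar>V 0 3 (0, x) - qin x 3\<bar> \<le> \<tau>"
    by (rule init, simp)+
  then show ?thesis
  proof eventually_elim
    case (elim x)
    show ?case
    proof
      assume x: "x \<in> {a<..<b}"
      have t: "\<bar>\<tau> * V 1 j (0, x)\<bar> \<le> \<tau> * M" if "j \<le> 3" for j
        using \<tau> T1 that by (auto simp: abs_mult intro!: mult_left_mono VM)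
      have "\<bar>qin x 0 - P 0 (0, x)\<bar> \<le> (1 + M) * \<tau>" "\<bar>qin x 2 - P 2 (0, x)\<bar> \<le> (1 + M) * \<tau>"
        "\<bar>qin x 1 - P 1 (0, x)\<bar> \<le> \<tau>" "\<bar>qin x 3 - P 3 (0, x)\<bar> \<le> \<tau>"
        using elim x t[of 0] t[of 2] by (auto simp: ansatz_def numeral_eq_Suc algebra_simps abs_le_iff)
      then have s: "(qin x 0 - P 0 (0, x))\<^sup>2 \<le> ((1 + M) * \<tau>)\<^sup>2" "(qin x 2 - P 2 (0, x))\<^sup>2 \<le> ((1 + M) * \<tau>)\<^sup>2"
        "(qin x 1 - P 1 (0, x))\<^sup>2 \<le> \<tau>\<^sup>2" "(qin x 3 - P 3 (0, x))\<^sup>2 \<le> \<tau>\<^sup>2"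
        by (simp_all add: abs_le_square_iff[symmetric])
      have "rel_energy \<tau> (qin x) (\<lambda>j. P j (0, x)) \<le> ((1 + M) * \<tau>)\<^sup>2 / 2 + \<tau> / 2 * (\<tau>\<^sup>2 + ((1 + M) * \<tau>)\<^sup>2 + \<tau>\<^sup>2)"
        unfolding rel_energy_eq using s \<tau> by (intro add_mono mult_left_mono divide_right_mono) auto
      also have "\<dots> \<le> ((1 + M) * \<tau>)\<^sup>2 / 2 + 1 / 2 * (\<tau>\<^sup>2 + ((1 + M) * \<tau>)\<^sup>2 + \<tau>\<^sup>2)"
        using \<tau> by (intro add_left_mono mult_right_mono) auto
      also have "\<dots> = init_const * \<tau>\<^sup>2" unfolding init_const_def power_mult_distrib by (simp add: distrib_left distrib_right)
      finally show "rel_energy \<tau> (qin x) (\<lambda>j. P j (0, x)) \<le> init_const * \<tau>\<^sup>2" .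
    qed
  qed
qed

text \<open>The weight depends on time only, which eliminates the flux of the energy inequality.
  That inequality is tested with \<open>\<phi>\<close> and the equation of index \<open>j\<close>
  with \<open>P j * \<phi>\<close>, which is why \<open>P\<close> has to be smooth and periodic. The
  terms \<open>XP\<close> and \<open>XF\<close> are exact derivatives: the first integrates to minus
  the initial energy of \<open>P\<close>, the second to zero.\<close>

lemma rel_energy_inequality:
  assumes \<theta>: "smooth \<theta>" "\<And>t. \<theta> t \<ge> 0" "\<And>t. t \<ge> d \<Longrightarrow> \<theta> t = 0" and d: "0 < d" "d < T1"
  shows "0 \<le> (LINT z:cell T a b|lborel. E z * (deriv \<theta> (fst z) + growth * \<theta> (fst z)) + source_const * \<tau>\<^sup>2 * \<theta> (fst z))
    + init_const * \<tau>\<^sup>2 * \<theta> 0 * (b - a)"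
proof -
  define \<phi> :: "real \<times> real \<Rightarrow> real" where "\<phi> = (\<lambda>z. \<theta> (fst z))"
  have \<phi>: "smooth \<phi>" "dt \<phi> = (\<lambda>z. deriv \<theta> (fst z))" "dx \<phi> = (\<lambda>_. 0)"
    using smooth_compose[OF \<theta>(1) smooth_fst] dt_dx_compose[OF smooth_fst \<theta>(1)]
    by (simp_all add: \<phi>_def dt_dx_fst_snd)
  have test: "\<phi> \<in> test_init T a b"
    using \<phi>(1) \<theta>(3) d T1 by (auto simp: test_init_def \<phi>_def intro!: exI[of _ d])
  have P\<phi>: "smooth (\<lambda>z. P j z * \<phi> z)" "dt (\<lambda>z. P j z * \<phi> z) = (\<lambda>z. P j z * dt \<phi> z + P' j z * \<phi> z)"
    "dx (\<lambda>z. P j z * \<phi> z) = (\<lambda>z. P'' j z * \<phi> z)" for j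
    using smooth_mult[OF P_smooth(1) \<phi>(1)] dt_dx_mult[OF P_smooth(1) \<phi>(1)] \<phi>(3) by (simp_all add: P_smooth)
  have testP: "(\<lambda>z. P j z * \<phi> z) \<in> test_init T a b" for j
    using P\<phi>(1) P_smooth(6) \<theta>(3) d T1 by (auto simp: test_init_def \<phi>_def intro!: exI[of _ d])
  define XE where "XE z = energy \<tau> (q z) * dt \<phi> z + energy_source (q z) * \<phi> z" for z
  define X0 where "X0 z = q z 0 * (P 0 z * dt \<phi> z + P' 0 z * \<phi> z) + ((q z 0)\<^sup>2 / 2 + q z 3) * (P'' 0 z * \<phi> z) - q z 2 * (P 0 z * \<phi> z)" for z
  define X1 where "X1 z = \<tau> * q z 1 * (P 1 z * dt \<phi> z + P' 1 z * \<phi> z) + (- q z 2) * (P'' 1 z * \<phi> z) - q z 3 * (P 1 z * \<phi> z)" for z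
  define X2 where "X2 z = \<tau> * q z 2 * (P 2 z * dt \<phi> z + P' 2 z * \<phi> z) + (- q z 1) * (P'' 2 z * \<phi> z) - q z 2 * (P 2 z * \<phi> z)" for z
  define X3 where "X3 z = \<tau> * q z 3 * (P 3 z * dt \<phi> z + P' 3 z * \<phi> z) + q z 0 * (P'' 3 z * \<phi> z) - (- q z 1) * (P 3 z * \<phi> z)" for z
  define XP where "XP = dt (\<lambda>z. energy \<tau> (\<lambda>j. P j z) * \<phi> z)"
  define XF where "XF = dx (\<lambda>z. (- ((P 0 z) ^ 3) / 6 - P 0 z * P 3 z + P 1 z * P 2 z) * \<phi> z)"
  note sm = smooth_energy_dt_dx[of P, OF P_smooth(1) \<phi>(1,3)]
  have eq: "ess_bounded (cell T a b) (\<lambda>z. q z j)" if "j \<le> 3" for j by (rule q_ess_bounded[OF that])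
  have es: "ess_bounded (cell T a b) (P j)" "ess_bounded (cell T a b) (P' j)" "ess_bounded (cell T a b) (P'' j)"
    "ess_bounded (cell T a b) \<phi>" "ess_bounded (cell T a b) (dt \<phi>)" for j
    using P_smooth \<phi>(1) by auto
  have e4: "ess_bounded (cell T a b) (\<lambda>z. q z 0)" "ess_bounded (cell T a b) (\<lambda>z. q z 1)"
    "ess_bounded (cell T a b) (\<lambda>z. q z 2)" "ess_bounded (cell T a b) (\<lambda>z. q z 3)" by (auto intro!: eq)
  note eb_intros = ess_bounded_add ess_bounded_diff ess_bounded_mult ess_bounded_cmult ess_bounded_divide
    ess_bounded_uminus ess_bounded_power2 e4 es
  have eX: "ess_bounded (cell T a b) XE" "ess_bounded (cell T a b) X0" "ess_bounded (cell T a b) X1"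
      "ess_bounded (cell T a b) X2" "ess_bounded (cell T a b) X3" "ess_bounded (cell T a b) XP" "ess_bounded (cell T a b) XF"
    unfolding XE_def[abs_def] X0_def[abs_def] X1_def[abs_def] X2_def[abs_def] X3_def[abs_def] energy_eq energy_source_def
    subgoal by (intro eb_intros)
    subgoal by (intro eb_intros)
    subgoal by (intro eb_intros)
    subgoal by (intro eb_intros)
    subgoal by (intro eb_intros)
    subgoal unfolding XP_def by (intro ess_bounded_smooth smooth_dt sm)
    subgoal unfolding XF_def by (intro ess_bounded_smooth smooth_dx sm)
    done
  note i = eX[THEN ess_bounded_integrable, OF bounded_cell cell_borel]
  define Y where "Y z = XE z - X0 z - X1 z - X2 z - X3 z + XP z - XF z" for z
  have Yi: "set_integrable lborel (cell T a b) Y"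
    unfolding Y_def[abs_def] by (intro set_integral_add(1) set_integral_diff(1) i)
  have Y: "Y z = E z * deriv \<theta> (fst z) + (- (q z 0 - P 0 z) * \<rho>0 z - (q z 2 - P 2 z) * \<rho>2 z - (q z 0 - P 0 z) * (q z 2 - P 2 z)
      - (q z 2 - P 2 z)\<^sup>2 - (q z 0 - P 0 z)\<^sup>2 * P'' 0 z / 2) * \<theta> (fst z)" for z
    using rel_energy_identity[where p = "\<lambda>j. P j z" and p' = "\<lambda>j. P' j z" and p'' = "\<lambda>j. P'' j z" and q = "q z"
        and \<phi> = "\<phi> z" and \<phi>' = "dt \<phi> z", OF P_equations]
    by (simp only: Y_def XE_def X0_def X1_def X2_def X3_def XP_def XF_def sm P_smooth E_def) (simp only: \<phi>(2), simp only: \<phi>_def)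
  let ?B = "\<lambda>z. E z * (deriv \<theta> (fst z) + growth * \<theta> (fst z)) + source_const * \<tau>\<^sup>2 * \<theta> (fst z)"
  \<comment> \<open>The bounds on the ansatz are known up to \<open>T1\<close> only; later both
    \<open>\<theta>\<close> and its derivative vanish because \<open>d < T1\<close>.\<close>
  have Y_le: "Y z \<le> ?B z" if z: "z \<in> cell T a b" for z
  proof (cases "fst z \<le> T1")
    case True
    then have z1: "fst z \<in> {0..T1}" using z by (cases z) auto
    have "- (q z 0 - P 0 z) * \<rho>0 z - (q z 2 - P 2 z) * \<rho>2 z - (q z 0 - P 0 z) * (q z 2 - P 2 z)
        - (q z 2 - P 2 z)\<^sup>2 - (q z 0 - P 0 z)\<^sup>2 * P'' 0 z / 2
      \<le> (2 + 2 * M) * ((q z 0 - P 0 z)\<^sup>2 / 2) + (((1 + 2 * M + 3 * M\<^sup>2) * \<tau>)\<^sup>2 + ((3 * M) * \<tau>)\<^sup>2) / 2"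
      using P_bounds[OF z1] by (intro rel_energy_production_le)
    also have "\<dots> \<le> growth * E z + source_const * \<tau>\<^sup>2"
    proof -
      have "(q z 0 - P 0 z)\<^sup>2 / 2 \<le> E z" using \<tau> by (simp add: E_def rel_energy_eq)
      then have "(2 + 2 * M) * ((q z 0 - P 0 z)\<^sup>2 / 2) \<le> growth * E z"
        unfolding growth_def using M by (intro mult_left_mono) auto
      moreover have "((A * \<tau>)\<^sup>2 + (B * \<tau>)\<^sup>2) / 2 = (A\<^sup>2 + B\<^sup>2) / 2 * \<tau>\<^sup>2" for A B
        by (simp add: power_mult_distrib field_simps)
      ultimately show ?thesis unfolding source_const_def by (metis add_right_mono)
    qed
    finally have "(- (q z 0 - P 0 z) * \<rho>0 z - (q z 2 - P 2 z) * \<rho>2 z - (q z 0 - P 0 z) * (q z 2 - P 2 z)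
        - (q z 2 - P 2 z)\<^sup>2 - (q z 0 - P 0 z)\<^sup>2 * P'' 0 z / 2) * \<theta> (fst z) \<le> (growth * E z + source_const * \<tau>\<^sup>2) * \<theta> (fst z)"
      using \<theta>(2) by (rule mult_right_mono)
    then show ?thesis unfolding Y by (simp add: algebra_simps)
  next
    case False
    then have "\<theta> (fst z) = 0" "deriv \<theta> (fst z) = 0"
      using \<theta>(3) d deriv_zero_right[of d \<theta> "fst z"] by auto
    then show ?thesis unfolding Y by simp
  qed
  have eB: "ess_bounded (cell T a b) ?B"
  proof -
    have "ess_bounded (cell T a b) (\<lambda>z. \<theta> (fst z))" "ess_bounded (cell T a b) (\<lambda>z. deriv \<theta> (fst z))"
      using es(4) es(5)[unfolded \<phi>(2)] unfolding \<phi>_def by simp_all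
    then show ?thesis by (intro ess_bounded_add ess_bounded_mult ess_bounded_cmult E_ess_bounded)
  qed
  have YB: "(LINT z:cell T a b|lborel. Y z) \<le> (LINT z:cell T a b|lborel. ?B z)"
    using Y_le by (intro set_integral_mono Yi ess_bounded_integrable eB) auto
  have b: "bounded {a<..<b}" "{a<..<b} \<in> sets borel" by auto
  note int1 = ess_bounded_integrable[OF _ b]
  have eP0: "ess_bounded {a<..<b} (\<lambda>x. P j (0, x))" for j
    by (intro ess_bounded_continuous smooth_continuous_slice P_smooth b)
  have eqin: "ess_bounded {a<..<b} (\<lambda>x. qin x 0)" "ess_bounded {a<..<b} (\<lambda>x. qin x 1)"
    "ess_bounded {a<..<b} (\<lambda>x. qin x 2)" "ess_bounded {a<..<b} (\<lambda>x. qin x 3)" by (auto intro!: qin)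
  define ZE where "ZE x = energy \<tau> (qin x) * \<theta> 0" for x
  define Z0 where "Z0 x = qin x 0 * (P 0 (0, x) * \<theta> 0)" for x
  define Z1 where "Z1 x = \<tau> * qin x 1 * (P 1 (0, x) * \<theta> 0)" for x
  define Z2 where "Z2 x = \<tau> * qin x 2 * (P 2 (0, x) * \<theta> 0)" for x
  define Z3 where "Z3 x = \<tau> * qin x 3 * (P 3 (0, x) * \<theta> 0)" for x
  define ZP where "ZP x = energy \<tau> (\<lambda>j. P j (0, x)) * \<theta> 0" for x
  have c0: "ess_bounded {a<..<b} (\<lambda>_. \<theta> 0)" by simp
  have eZ: "ess_bounded {a<..<b} ZE" "ess_bounded {a<..<b} Z0" "ess_bounded {a<..<b} Z1" "ess_bounded {a<..<b} Z2"
    "ess_bounded {a<..<b} Z3" "ess_bounded {a<..<b} ZP"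
    unfolding ZE_def[abs_def] Z0_def[abs_def] Z1_def[abs_def] Z2_def[abs_def] Z3_def[abs_def] ZP_def[abs_def] energy_eq
    by (intro ess_bounded_add ess_bounded_mult ess_bounded_cmult ess_bounded_divide ess_bounded_power2 eqin eP0 c0)+
  note iZ = eZ[THEN int1]
  have "energy_inequality \<tau> T a b q qin" "weak_solution \<tau> T a b q qin" using q by (auto simp: entropy_solution_def)
  note qq = this(1)[unfolded energy_inequality_def, rule_format, OF test] this(2)[unfolded weak_solution_def weak_balance_iff]
  have WE: "(LINT z:cell T a b|lborel. XE z) + (LINT x:{a<..<b}|lborel. ZE x) \<ge> 0"
    using qq(1) \<theta>(2) by (simp add: XE_def ZE_def \<phi>(3)) (simp add: \<phi>_def)
  have W0: "(LINT z:cell T a b|lborel. X0 z) + (LINT x:{a<..<b}|lborel. Z0 x) = 0"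
    using bspec[OF conjunct1[OF qq(2)] testP[of 0]] unfolding P\<phi> X0_def Z0_def by (simp only: \<phi>_def fst_conv)
  have W1: "(LINT z:cell T a b|lborel. X1 z) + (LINT x:{a<..<b}|lborel. Z1 x) = 0"
    using bspec[OF conjunct1[OF conjunct2[OF qq(2)]] testP[of 1]] unfolding P\<phi> X1_def Z1_def by (simp only: \<phi>_def fst_conv)
  have W2: "(LINT z:cell T a b|lborel. X2 z) + (LINT x:{a<..<b}|lborel. Z2 x) = 0"
    using bspec[OF conjunct1[OF conjunct2[OF conjunct2[OF qq(2)]]] testP[of 2]] unfolding P\<phi> X2_def Z2_def by (simp only: \<phi>_def fst_conv)
  have W3: "(LINT z:cell T a b|lborel. X3 z) + (LINT x:{a<..<b}|lborel. Z3 x) = 0"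
    using bspec[OF conjunct2[OF conjunct2[OF conjunct2[OF qq(2)]]] testP[of 3]] unfolding P\<phi> X3_def Z3_def by (simp only: \<phi>_def fst_conv)
  have WP: "(LINT z:cell T a b|lborel. XP z) = - (LINT x:{a<..<b}|lborel. ZP x)"
  proof -
    have "(LINT z:cell T a b|lborel. XP z) = (LINT x:{a<..<b}|lborel. energy \<tau> (\<lambda>j. P j (T, x)) * \<phi> (T, x) - energy \<tau> (\<lambda>j. P j (0, x)) * \<phi> (0, x))"
      unfolding XP_def using T1 by (intro cell_integral_dt sm) auto
    also have "\<dots> = (LINT x:{a<..<b}|lborel. - ZP x)"
      using \<theta>(3)[of T] d T1 by (simp add: \<phi>_def ZP_def)
    finally show ?thesis using iZ(6) by (simp add: set_integral_uminus)
  qed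
  have WF: "(LINT z:cell T a b|lborel. XF z) = 0"
    unfolding XF_def using ab by (intro cell_integral_dx sm) (auto simp: P_smooth(6)[of _ "_" "_"] \<phi>_def)
  have "(LINT z:cell T a b|lborel. Y z) = (LINT z:cell T a b|lborel. XE z) - (LINT z:cell T a b|lborel. X0 z) - (LINT z:cell T a b|lborel. X1 z)
      - (LINT z:cell T a b|lborel. X2 z) - (LINT z:cell T a b|lborel. X3 z) + (LINT z:cell T a b|lborel. XP z) - (LINT z:cell T a b|lborel. XF z)"
    unfolding Y_def by (simp only: set_integral_add set_integral_diff i)
  moreover have "(LINT x:{a<..<b}|lborel. ZE x - Z0 x - Z1 x - Z2 x - Z3 x + ZP x)
      = (LINT x:{a<..<b}|lborel. ZE x) - (LINT x:{a<..<b}|lborel. Z0 x) - (LINT x:{a<..<b}|lborel. Z1 x) - (LINT x:{a<..<b}|lborel. Z2 x)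
      - (LINT x:{a<..<b}|lborel. Z3 x) + (LINT x:{a<..<b}|lborel. ZP x)"
    by (simp only: set_integral_add set_integral_diff iZ)
  ultimately have "0 \<le> (LINT z:cell T a b|lborel. Y z) + (LINT x:{a<..<b}|lborel. ZE x - Z0 x - Z1 x - Z2 x - Z3 x + ZP x)"
    using WE W0 W1 W2 W3 WP WF by linarith
  moreover have "(LINT x:{a<..<b}|lborel. ZE x - Z0 x - Z1 x - Z2 x - Z3 x + ZP x) \<le> (LINT x:{a<..<b}|lborel. init_const * \<tau>\<^sup>2 * \<theta> 0)"
  proof (rule set_integral_le_AE)
    show "set_integrable lborel {a<..<b} (\<lambda>x. ZE x - Z0 x - Z1 x - Z2 x - Z3 x + ZP x)"
      by (intro set_integral_add(1) set_integral_diff(1) iZ)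
    show "set_integrable lborel {a<..<b} (\<lambda>x. init_const * \<tau>\<^sup>2 * \<theta> 0)" by (rule int1) simp
    show "AE x\<in>{a<..<b} in lborel. ZE x - Z0 x - Z1 x - Z2 x - Z3 x + ZP x \<le> init_const * \<tau>\<^sup>2 * \<theta> 0"
      using initial_rel_energy
    proof eventually_elim
      case (elim x)
      \<comment> \<open>Completing the square: the initial terms of the energies and of the tested
        equations combine to the relative energy of the initial data.\<close>
      have "ZE x - Z0 x - Z1 x - Z2 x - Z3 x + ZP x = rel_energy \<tau> (qin x) (\<lambda>j. P j (0, x)) * \<theta> 0"
        unfolding ZE_def Z0_def Z1_def Z2_def Z3_def ZP_def rel_energy_eq energy_eq
        by (simp add: field_simps power2_eq_square)
      then show ?case using elim \<theta>(2)[of 0] by (auto intro: mult_right_mono)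
    qed
  qed
  moreover have "(LINT x:{a<..<b}|lborel. init_const * \<tau>\<^sup>2 * \<theta> 0) = init_const * \<tau>\<^sup>2 * \<theta> 0 * (b - a)"
    using set_integral_const[OF b, of "init_const * \<tau>\<^sup>2 * \<theta> 0"] ab by simp
  ultimately show ?thesis using YB by linarith
qed

text \<open>The source accumulated over time \<open>T\<close> and the initial contribution, both
  over one period; the exponential undoes the decay of the weight in
  \<open>gronwall\<close>.\<close>

definition "energy_const = exp (growth * T) * ((source_const * T + init_const) * (b - a))"

lemma consts_nonneg: "growth \<ge> 0" "source_const \<ge> 0" "init_const \<ge> 0" "energy_const \<ge> 0"
  using M T1 ab by (auto simp: growth_def source_const_def init_const_def energy_const_def
      intro!: mult_nonneg_nonneg add_nonneg_nonneg)

text \<open>The weight solves the dual problem \<open>\<theta>' + growth * \<theta> = - exp (-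
  growth * t) * \<psi>\<close> with \<open>\<theta> = 0\<close> after \<open>d\<close>, so the
  growth term cancels and the tested energy remains with a good sign. The integral of
  \<open>\<psi>\<close> is at most \<open>d - c\<close>, which bounds \<open>\<theta>\<close> at
  nonnegative times and makes the source and initial terms proportional to
  \<open>d - c\<close>.\<close>

lemma gronwall:
  assumes cd: "0 < c" "c \<le> d" "d < T1"
    and \<psi>: "smooth \<psi>" "\<And>t. 0 \<le> \<psi> t" "\<And>t. \<psi> t \<le> 1" "\<And>t. t \<le> c \<or> d \<le> t \<Longrightarrow> \<psi> t = 0"
  shows "(LINT z:cell T a b|lborel. E z * \<psi> (fst z)) \<le> energy_const * \<tau>\<^sup>2 * (d - c)"
proof -
  obtain G where G: "smooth G" "\<And>t. (G has_real_derivative \<psi> t) (at t)"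
    using smooth_antiderivative[of \<psi> c] \<psi>(1,4) by blast
  have Gmono: "G s \<le> G t" if "s \<le> t" for s t
    by (rule DERIV_nonneg_imp_nondecreasing[OF that]) (use G(2) \<psi>(2) in blast)
  have Gd: "G t = G d" if "t \<ge> d" for t
  proof (cases "t = d")
    case False
    with that obtain \<xi> where "\<xi> > d" "G t - G d = (t - d) * \<psi> \<xi>"
      using MVT2[of d t G \<psi>] G(2) by auto
    then show ?thesis using \<psi>(4)[of \<xi>] by simp
  qed simp
  have G0: "G d - G 0 \<le> d - c"
  proof -
    obtain \<xi> where \<xi>: "\<xi> < c" "G c - G 0 = (c - 0) * \<psi> \<xi>"
      using MVT2[of 0 c G \<psi>] G(2) cd by auto
    have "G d - G c \<le> d - c"
    proof (cases "c = d")
      case False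
      with cd obtain \<xi> where "G d - G c = (d - c) * \<psi> \<xi>"
        using MVT2[of c d G \<psi>] G(2) by auto
      then show ?thesis using mult_left_mono[OF \<psi>(3)[of \<xi>], of "d - c"] cd by simp
    qed simp
    then show ?thesis using \<xi> \<psi>(4)[of \<xi>] by simp
  qed
  \<comment> \<open>\<open>\<kappa> t\<close> is the integral of \<open>\<psi>\<close> from
    \<open>t\<close> to \<open>d\<close>; it is nonnegative, decreasing, and zero after
    \<open>d\<close>.\<close>
  define \<kappa> where "\<kappa> t = G d - G t" for t
  have s\<kappa>: "smooth \<kappa>" unfolding \<kappa>_def[abs_def] by (intro smooth_diff smooth_const G)
  define \<theta> where "\<theta> t = exp ((- growth) * t) * \<kappa> t" for t
  have s\<theta>: "smooth \<theta>"
    unfolding \<theta>_def[abs_def] by (intro smooth_mult[OF smooth_compose[OF smooth_exp smooth_cmult[OF smooth_ident]] s\<kappa>])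
  have \<kappa>0: "\<kappa> t \<ge> 0" for t using Gmono[of t d] Gd[of t] by (cases "t \<le> d") (auto simp: \<kappa>_def)
  have d\<theta>: "deriv \<theta> t + growth * \<theta> t = - (exp ((- growth) * t) * \<psi> t)" for t
  proof -
    have "(\<theta> has_real_derivative (- growth) * \<theta> t - exp ((- growth) * t) * \<psi> t) (at t)"
      unfolding \<theta>_def[abs_def] \<kappa>_def by (auto intro!: derivative_eq_intros G(2) simp: algebra_simps)
    then show ?thesis by (simp add: DERIV_imp_deriv)
  qed
  have \<theta>le: "\<theta> t \<le> d - c" if "t \<ge> 0" for t
  proof -
    have "exp ((- growth) * t) \<le> 1" using that consts_nonneg by (simp add: mult_nonneg_nonneg)
    from mult_right_mono[OF this \<kappa>0[of t]] have "\<theta> t \<le> \<kappa> t" by (simp add: \<theta>_def)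
    also have "\<dots> \<le> d - c" using G0 Gmono[OF that] by (simp add: \<kappa>_def)
    finally show ?thesis .
  qed
  note int = ess_bounded_integrable[OF _ bounded_cell cell_borel]
  have sm1: "smooth (\<lambda>z :: real \<times> real. \<theta> (fst z))" "smooth (\<lambda>z :: real \<times> real. exp ((- growth) * fst z) * \<psi> (fst z))"
      "smooth (\<lambda>z :: real \<times> real. \<psi> (fst z))"
    using smooth_compose[OF s\<theta> smooth_fst] smooth_compose[OF \<psi>(1) smooth_fst]
      smooth_compose[OF smooth_exp smooth_cmult[OF smooth_fst, of "- growth"]] by (auto intro!: smooth_mult)
  note eb = sm1[THEN ess_bounded_smooth, of T a b]
  have e1: "ess_bounded (cell T a b) (\<lambda>z. E z * (exp ((- growth) * fst z) * \<psi> (fst z)))"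
    by (intro ess_bounded_mult E_ess_bounded eb)
  have e2: "ess_bounded (cell T a b) (\<lambda>z. source_const * \<tau>\<^sup>2 * \<theta> (fst z))"
    by (intro ess_bounded_cmult eb)
  have "0 \<le> (LINT z:cell T a b|lborel. E z * (deriv \<theta> (fst z) + growth * \<theta> (fst z)) + source_const * \<tau>\<^sup>2 * \<theta> (fst z))
    + init_const * \<tau>\<^sup>2 * \<theta> 0 * (b - a)"
  proof (rule rel_energy_inequality[OF s\<theta>])
    show "\<theta> t \<ge> 0" for t using \<kappa>0[of t] by (simp add: \<theta>_def)
    show "\<theta> t = 0" if "t \<ge> d" for t unfolding \<theta>_def \<kappa>_def Gd[OF that] by simp
  qed (use cd in simp_all)
  also have "(\<lambda>z. E z * (deriv \<theta> (fst z) + growth * \<theta> (fst z)) + source_const * \<tau>\<^sup>2 * \<theta> (fst z))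
      = (\<lambda>z. source_const * \<tau>\<^sup>2 * \<theta> (fst z) - E z * (exp ((- growth) * fst z) * \<psi> (fst z)))"
    unfolding d\<theta> by simp
  finally have "(LINT z:cell T a b|lborel. E z * (exp ((- growth) * fst z) * \<psi> (fst z)))
      \<le> (LINT z:cell T a b|lborel. source_const * \<tau>\<^sup>2 * \<theta> (fst z)) + init_const * \<tau>\<^sup>2 * \<theta> 0 * (b - a)"
    by (simp only: set_integral_diff(2)[OF int[OF e2] int[OF e1]])
  also have "\<dots> \<le> source_const * \<tau>\<^sup>2 * (d - c) * (T * (b - a)) + init_const * \<tau>\<^sup>2 * (d - c) * (b - a)"
  proof (rule add_mono)
    have "(LINT z:cell T a b|lborel. source_const * \<tau>\<^sup>2 * \<theta> (fst z)) \<le> (LINT z:cell T a b|lborel. source_const * \<tau>\<^sup>2 * (d - c))"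
      using consts_nonneg by (intro set_integral_mono int e2 ess_bounded_const cell_borel mult_left_mono \<theta>le) auto
    also have "\<dots> = source_const * \<tau>\<^sup>2 * (d - c) * (T * (b - a))"
      using T1 ab by (simp only: set_integral_const[OF bounded_cell cell_borel] measure_cell)
    finally show "(LINT z:cell T a b|lborel. source_const * \<tau>\<^sup>2 * \<theta> (fst z)) \<le> source_const * \<tau>\<^sup>2 * (d - c) * (T * (b - a))" .
    show "init_const * \<tau>\<^sup>2 * \<theta> 0 * (b - a) \<le> init_const * \<tau>\<^sup>2 * (d - c) * (b - a)"
      using consts_nonneg ab by (intro mult_right_mono mult_left_mono \<theta>le) auto
  qed
  finally have *: "(LINT z:cell T a b|lborel. E z * (exp ((- growth) * fst z) * \<psi> (fst z)))
      \<le> (source_const * T + init_const) * (b - a) * \<tau>\<^sup>2 * (d - c)" by (simp add: algebra_simps)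
  have e3: "ess_bounded (cell T a b) (\<lambda>z. E z * \<psi> (fst z))"
    by (intro ess_bounded_mult E_ess_bounded eb)
  have "(LINT z:cell T a b|lborel. E z * \<psi> (fst z)) \<le> (LINT z:cell T a b|lborel. exp (growth * T) * (E z * (exp ((- growth) * fst z) * \<psi> (fst z))))"
  proof (intro set_integral_mono int e3 ess_bounded_cmult e1)
    fix z assume "z \<in> cell T a b"
    then have "growth * fst z \<le> growth * T" using consts_nonneg by (intro mult_left_mono) auto
    then have "1 \<le> exp (growth * T) * exp ((- growth) * fst z)" by (simp flip: exp_add)
    then have "1 * (E z * \<psi> (fst z)) \<le> (exp (growth * T) * exp ((- growth) * fst z)) * (E z * \<psi> (fst z))"
      using E_nonneg \<psi>(2) by (intro mult_right_mono) auto
    then show "E z * \<psi> (fst z) \<le> exp (growth * T) * (E z * (exp ((- growth) * fst z) * \<psi> (fst z)))"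
      by (simp add: algebra_simps)
  qed
  also have "\<dots> = exp (growth * T) * (LINT z:cell T a b|lborel. E z * (exp ((- growth) * fst z) * \<psi> (fst z)))"
    by (rule set_integral_mult_right)
  also have "\<dots> \<le> exp (growth * T) * ((source_const * T + init_const) * (b - a) * \<tau>\<^sup>2 * (d - c))"
    by (intro mult_left_mono *) simp
  also have "\<dots> = energy_const * \<tau>\<^sup>2 * (d - c)" by (simp add: energy_const_def)
  finally show ?thesis .
qed

text \<open>The bumps take values between 0 and 1 and vanish outside \<open>(c,d)\<close>, so
  \<open>gronwall\<close> bounds all of them alike, and they tend to the indicator of the
  interval.\<close>

lemma rel_energy_bound:
  assumes cd: "0 < c" "c \<le> d" "d < T1"
  shows "(LINT z:{c<..<d} \<times> {a<..<b}|lborel. E z) \<le> energy_const * \<tau>\<^sup>2 * (d - c)"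
proof (rule LIMSEQ_le_const2)
  show "(\<lambda>n. LINT z:cell T a b|lborel. E z * bump c d n (fst z)) \<longlonglongrightarrow> (LINT z:{c<..<d} \<times> {a<..<b}|lborel. E z)"
  proof (rule set_integral_mult_tendsto)
    show "set_integrable lborel (cell T a b) E" by (intro ess_bounded_integrable E_ess_bounded) auto
    show "(\<lambda>z :: real \<times> real. bump c d n (fst z)) \<in> borel_measurable borel" for n
      by (intro smooth_measurable smooth_compose[OF smooth_bump] smooth_fst)
    show "\<bar>bump c d n (fst z)\<bar> \<le> 1" for n and z :: "real \<times> real" using bump_nonneg[of c d n "fst z"] bump_le_1[of c d n "fst z"] by simp
    show "(\<lambda>n. bump c d n (fst z)) \<longlonglongrightarrow> indicator ({c<..<d} \<times> {a<..<b}) z" if "z \<in> cell T a b" for z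
    proof -
      have "indicator ({c<..<d} \<times> {a<..<b}) z = (indicator {c<..<d} (fst z) :: real)"
        using that by (cases z) (auto simp: indicator_def)
      then show ?thesis using bump_tendsto by simp
    qed
    show "{c<..<d} \<times> {a<..<b} \<subseteq> cell T a b" using cd T1 by auto
    show "{c<..<d} \<times> {a<..<b} \<in> sets borel" by (intro borel_open open_Times) auto
  qed simp
  show "\<exists>N. \<forall>n\<ge>N. (LINT z:cell T a b|lborel. E z * bump c d n (fst z)) \<le> energy_const * \<tau>\<^sup>2 * (d - c)"
    by (intro exI[of _ 0] allI impI gronwall cd smooth_bump bump_nonneg bump_le_1 bump_eq_0)
qed

text \<open>The distance of \<open>g\<close> to \<open>q\<close> is split at the ansatz. From
  \<open>g\<close> to \<open>P j\<close> there is the mollification error plus the correction, at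
  most \<open>(1 + M) * \<tau>\<close>; from \<open>P j\<close> to \<open>q\<close> the relative
  energy controls the error with weight 1 for the component 0 and \<open>\<tau>\<close> for the
  others.\<close>

lemma error_bound:
  assumes cd: "0 < c" "c \<le> d" "d < T1" and j: "j \<le> 3"
    and g: "ess_bounded (cell T a b) g" "AE z\<in>cell T1 a b in lborel. \<bar>V 0 j z - g z\<bar> \<le> \<tau>"
    and s: "s = (if j = 0 then 1 else \<tau>)"
  shows "s * (LINT z:{c<..<d} \<times> {a<..<b}|lborel. (g z - q z j)\<^sup>2)
    \<le> (2 * (1 + M)\<^sup>2 * (b - a) + 4 * energy_const) * \<tau>\<^sup>2 * (d - c)"
proof -
  define S where "S = {c<..<d} \<times> {a<..<b}"
  have S: "bounded S" "S \<in> sets borel" "S \<subseteq> cell T a b" "S \<subseteq> cell T1 a b"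
    using cd T1 by (auto simp: S_def intro!: bounded_Times borel_open open_Times)
  have s01: "0 \<le> s" "s \<le> 1" using s \<tau> by auto
  note int = ess_bounded_integrable[OF _ S(1,2)]
  have sub: "ess_bounded S h" if "ess_bounded (cell T a b) h" for h
    using ess_bounded_subset[OF that S(3,2)] .
  have "s * (LINT z:S|lborel. (g z - q z j)\<^sup>2) = (LINT z:S|lborel. s * (g z - q z j)\<^sup>2)" by simp
  also have "\<dots> \<le> (LINT z:S|lborel. 2 * ((1 + M) * \<tau>)\<^sup>2 + 4 * E z)"
  proof (rule set_integral_le_AE)
    show "set_integrable lborel S (\<lambda>z. s * (g z - q z j)\<^sup>2)"
      by (intro int ess_bounded_cmult ess_bounded_power2 ess_bounded_diff sub g q_ess_bounded j)
    show "set_integrable lborel S (\<lambda>z. 2 * ((1 + M) * \<tau>)\<^sup>2 + 4 * E z)"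
      by (intro int ess_bounded_add ess_bounded_const S ess_bounded_cmult sub E_ess_bounded)
    show "AE z\<in>S in lborel. s * (g z - q z j)\<^sup>2 \<le> 2 * ((1 + M) * \<tau>)\<^sup>2 + 4 * E z"
      using g(2)
    proof (eventually_elim, intro impI)
      fix z assume z: "z \<in> cell T1 a b \<longrightarrow> \<bar>V 0 j z - g z\<bar> \<le> \<tau>" "z \<in> S"
      then have z1: "fst z \<in> {0..T1}" "\<bar>V 0 j z - g z\<bar> \<le> \<tau>" using S(4) by (auto simp: mem_Times_iff)
      have t: "\<bar>\<tau> * V 1 k z\<bar> \<le> \<tau> * M" if "k \<le> 3" for k
        using \<tau> that z1(1) by (auto simp: abs_mult intro!: mult_left_mono VM)
      have "j = 0 \<or> j = 1 \<or> j = 2 \<or> j = 3" using j by auto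
      \<comment> \<open>Only the components 0 and 2 carry a correction, namely
        \<open>\<tau> * V 1 2\<close> and \<open>\<tau> * V 1 0\<close>.\<close>
      then have "\<bar>V 0 j z - P j z\<bar> \<le> \<tau> * M"
        using t[of 0] t[of 2] \<tau> M by (auto simp: ansatz_def numeral_eq_Suc)
      then have gP: "\<bar>g z - P j z\<bar> \<le> (1 + M) * \<tau>" using z1(2) by (auto simp: algebra_simps abs_le_iff)
      then have gP2: "(g z - P j z)\<^sup>2 \<le> ((1 + M) * \<tau>)\<^sup>2" by (simp add: abs_le_square_iff[symmetric])
      have "s * (q z j - P j z)\<^sup>2 \<le> 2 * E z"
      proof -
        have e: "2 * E z = (q z 0 - P 0 z)\<^sup>2 + \<tau> * (q z 1 - P 1 z)\<^sup>2 + \<tau> * (q z 2 - P 2 z)\<^sup>2 + \<tau> * (q z 3 - P 3 z)\<^sup>2"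
          by (simp add: E_def rel_energy_eq distrib_left)
        have n: "0 \<le> \<tau> * (q z k - P k z)\<^sup>2" "0 \<le> (q z k - P k z)\<^sup>2" for k using \<tau> by simp_all
        consider "j = 0" "s = 1" | "j = 1" "s = \<tau>" | "j = 2" "s = \<tau>" | "j = 3" "s = \<tau>"
          using \<open>j = 0 \<or> j = 1 \<or> j = 2 \<or> j = 3\<close> s by auto
        then show ?thesis
        proof cases
          case 1
          show ?thesis unfolding 1 using e n(1)[of 1] n(1)[of 2] n(1)[of 3] by simp
        next
          case 2
          show ?thesis unfolding 2 using e n(1)[of 2] n(1)[of 3] n(2)[of 0] by linarith
        next
          case 3
          show ?thesis unfolding 3 using e n(1)[of 1] n(1)[of 3] n(2)[of 0] by linarith
        next
          case 4
          show ?thesis unfolding 4 using e n(1)[of 1] n(1)[of 2] n(2)[of 0] by linarith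
        qed
      qed
      moreover have "s * (g z - P j z)\<^sup>2 \<le> ((1 + M) * \<tau>)\<^sup>2"
        using gP2 mult_left_le_one_le[OF zero_le_power2[of "g z - P j z"] s01] by linarith
      moreover have "s * (g z - q z j)\<^sup>2 \<le> s * (2 * (g z - P j z)\<^sup>2 + 2 * (q z j - P j z)\<^sup>2)"
      proof (rule mult_left_mono[OF _ s01(1)])
        have "0 \<le> ((g z - P j z) + (q z j - P j z))\<^sup>2" by simp
        then show "(g z - q z j)\<^sup>2 \<le> 2 * (g z - P j z)\<^sup>2 + 2 * (q z j - P j z)\<^sup>2"
          by (simp add: power2_eq_square algebra_simps)
      qed
      ultimately show "s * (g z - q z j)\<^sup>2 \<le> 2 * ((1 + M) * \<tau>)\<^sup>2 + 4 * E z"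
        by (simp add: distrib_left)
    qed
  qed
  also have "\<dots> = 2 * ((1 + M) * \<tau>)\<^sup>2 * measure lborel S + 4 * (LINT z:S|lborel. E z)"
    by (subst set_integral_add(2)) (auto intro!: int ess_bounded_const ess_bounded_cmult sub E_ess_bounded S
        simp: set_integral_const[OF S(1,2)])
  also have "measure lborel S = (d - c) * (b - a)"
  proof -
    have "S = box (c, a) (d, b)" by (auto simp: S_def box_prod)
    then show ?thesis using cd ab
      by (simp add: measure_lborel_box_eq Basis_prod_def prod.union_disjoint inner_Pair_0)
  qed
  also have "2 * ((1 + M) * \<tau>)\<^sup>2 * ((d - c) * (b - a)) + 4 * (LINT z:S|lborel. E z)
      \<le> 2 * ((1 + M) * \<tau>)\<^sup>2 * ((d - c) * (b - a)) + 4 * (energy_const * \<tau>\<^sup>2 * (d - c))"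
    using rel_energy_bound[OF cd] by (simp add: S_def)
  also have "\<dots> = (2 * (1 + M)\<^sup>2 * (b - a) + 4 * energy_const) * \<tau>\<^sup>2 * (d - c)"
    unfolding power_mult_distrib by (simp add: algebra_simps)
  finally show ?thesis by (simp add: S_def)
qed

end

section \<open>The error estimate\<close>

lemma L2_norm_measurable:
  assumes f: "set_borel_measurable lborel ({0<..<T} \<times> UNIV) f"
  shows "(\<lambda>t. L2_norm a b (\<lambda>x. f (t, x))) \<in> borel_measurable (restrict_space lborel {0<..<T})"
proof -
  \<comment> \<open>\<open>f\<close> is measurable on the time strip only, so it is extended by
    zero; on the strip the norms agree.\<close>
  define g where "g z = indicator ({0<..<T} \<times> UNIV) z * f z" for z
  have [measurable]: "g \<in> borel_measurable (borel \<Otimes>\<^sub>M borel)"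
    using f by (simp add: set_borel_measurable_def g_def[abs_def] borel_prod)
  have "(\<lambda>t. \<integral>\<^sup>+ x\<in>{a<..<b}. ennreal ((g (t, x))\<^sup>2) \<partial>lborel) \<in> borel_measurable borel"
    by measurable
  then have "(\<lambda>t. L2_norm a b (\<lambda>x. g (t, x))) \<in> borel_measurable lborel"
    unfolding L2_norm_def Let_def by measurable
  then have "(\<lambda>t. L2_norm a b (\<lambda>x. g (t, x))) \<in> borel_measurable (restrict_space lborel {0<..<T})"
    by (rule measurable_restrict_space1)
  moreover have "L2_norm a b (\<lambda>x. g (t, x)) = L2_norm a b (\<lambda>x. f (t, x))" if "t \<in> {0<..<T}" for t
    using that by (simp add: g_def)
  ultimately show ?thesis
    by (subst measurable_cong[where g = "\<lambda>t. L2_norm a b (\<lambda>x. g (t, x))"]) (auto simp: space_restrict_space)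
qed

text \<open>A bound on time intervals that is proportional to their length becomes a bound at almost
  every time, by \<open>AE_nonpos_if_box_integrals_nonpos\<close> in dimension one applied to the
  squared spatial norm minus \<open>B\<^sup>2\<close>.\<close>

lemma Linf_L2_norm_le:
  assumes f: "set_borel_measurable lborel ({0<..<T} \<times> UNIV) f" "ess_bounded (cell T a b) f" and "B \<ge> 0"
    and le: "\<And>c d. 0 < c \<Longrightarrow> c \<le> d \<Longrightarrow> d < T \<Longrightarrow> (LINT z:{c<..<d} \<times> {a<..<b}|lborel. (f z)\<^sup>2) \<le> B\<^sup>2 * (d - c)"
  shows "Linf_L2_norm T a b f \<le> ennreal B"
  unfolding Linf_L2_norm_def
proof (rule esssup_I)
  show "(\<lambda>t. L2_norm a b (\<lambda>x. f (t, x))) \<in> borel_measurable (restrict_space lborel {0<..<T})"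
    by (rule L2_norm_measurable[OF f(1)])
  have int: "set_integrable lborel (cell T a b) (\<lambda>z. (f z)\<^sup>2)"
    by (intro ess_bounded_integrable ess_bounded_power2 f) auto
  note F = set_integral_Times[OF int]
  have const: "set_integrable lborel {0<..<T} (\<lambda>_. B\<^sup>2)"
    by (intro ess_bounded_integrable) auto
  have "AE t\<in>{0<..<T} in lborel. (LINT x:{a<..<b}|lborel. (f (t, x))\<^sup>2) - B\<^sup>2 \<le> 0"
  proof (rule AE_nonpos_if_box_integrals_nonpos)
    show "set_integrable lborel {0<..<T} (\<lambda>t. (LINT x:{a<..<b}|lborel. (f (t, x))\<^sup>2) - B\<^sup>2)"
      by (intro set_integral_diff(1) F(3) const)
    fix c d :: real assume sub: "cbox c d \<subseteq> {0<..<T}"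
    show "(LINT t:box c d|lborel. (LINT x:{a<..<b}|lborel. (f (t, x))\<^sup>2) - B\<^sup>2) \<le> 0"
    proof (cases "c < d")
      case True
      then have "c \<in> cbox c d" "d \<in> cbox c d" by auto
      then have cd: "0 < c" "d < T" using sub by auto
      have s: "box c d \<subseteq> {0<..<T}" "box c d \<in> sets lborel" "bounded (box c d)" using sub box_subset_cbox by auto
      have i2: "set_integrable lborel (box c d \<times> {a<..<b}) (\<lambda>z. (f z)\<^sup>2)"
        by (rule set_integrable_subset[OF int]) (use s in \<open>auto intro!: borel_open open_Times\<close>)
      have "(LINT t:box c d|lborel. (LINT x:{a<..<b}|lborel. (f (t, x))\<^sup>2) - B\<^sup>2)
          = (LINT t:box c d|lborel. LINT x:{a<..<b}|lborel. (f (t, x))\<^sup>2) - (LINT t:box c d|lborel. B\<^sup>2)"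
        by (intro set_integral_diff(2) set_integral_Times(3)[OF i2] set_integrable_subset[OF const] s)
      also have "\<dots> = (LINT z:{c<..<d} \<times> {a<..<b}|lborel. (f z)\<^sup>2) - B\<^sup>2 * (d - c)"
        using set_integral_const[OF s(3), of "B\<^sup>2"] True by (simp add: set_integral_Times(1)[OF i2[unfolded box_real]] box_real)
      finally show ?thesis using le[OF cd(1) _ cd(2)] True by simp
    qed (simp add: set_lebesgue_integral_def box_real)
  qed simp
  with F(4) have "AE t\<in>{0<..<T} in lborel. L2_norm a b (\<lambda>x. f (t, x)) \<le> ennreal B"
  proof (eventually_elim, intro impI)
    fix t assume *: "t \<in> {0<..<T} \<longrightarrow> set_integrable lborel {a<..<b} (\<lambda>x. (f (t, x))\<^sup>2)"
      "t \<in> {0<..<T} \<longrightarrow> (LINT x:{a<..<b}|lborel. (f (t, x))\<^sup>2) - B\<^sup>2 \<le> 0" "t \<in> {0<..<T}"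
    define I where "I = (LINT x:{a<..<b}|lborel. (f (t, x))\<^sup>2)"
    have I: "0 \<le> I" "I \<le> B\<^sup>2"
      using * by (auto simp: I_def set_lebesgue_integral_def intro!: integral_nonneg_AE)
    have "(\<integral>\<^sup>+ x\<in>{a<..<b}. ennreal ((f (t, x))\<^sup>2) \<partial>lborel) = (\<integral>\<^sup>+ x. ennreal (indicator {a<..<b} x *\<^sub>R (f (t, x))\<^sup>2) \<partial>lborel)"
      by (intro nn_integral_cong) (auto simp: indicator_def)
    also have "\<dots> = ennreal I"
      unfolding I_def set_lebesgue_integral_def
      using * by (intro nn_integral_eq_integral) (auto simp: set_integrable_def)
    finally have "L2_norm a b (\<lambda>x. f (t, x)) = ennreal (sqrt I)"
      using I by (simp add: L2_norm_def)
    also have "\<dots> \<le> ennreal B"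
      using I \<open>B \<ge> 0\<close> by (intro ennreal_leI real_le_lsqrt) auto
    finally show "L2_norm a b (\<lambda>x. f (t, x)) \<le> ennreal B" .
  qed
  then show "AE t in restrict_space lborel {0<..<T}. L2_norm a b (\<lambda>x. f (t, x)) \<le> ennreal B"
    by (subst AE_restrict_space_iff) auto
qed

text \<open>Every time interval in \<open>(0,T)\<close> gets its own \<open>T1\<close> and its own
  smooth approximation. Since \<open>K\<close> depends on neither, the interval bounds can be
  collected into an essential supremum over all of \<open>(0,T)\<close>.\<close>

lemma (in ks) error_estimate:
  assumes \<tau>: "0 < \<tau>" "\<tau> \<le> 1" and q: "entropy_solution \<tau> T a b q qin"
    and qin: "\<And>j x. j \<le> 3 \<Longrightarrow> qin x j = g0 j x" and j: "j \<le> 3"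
    and s: "s = (if j = 0 then 1 else \<tau>)"
    and K: "K = 2 * (1 + M)\<^sup>2 * (b - a) + 4 * approximate_solution.energy_const T a b M"
  shows "ennreal (sqrt s) * Linf_L2_norm T a b (\<lambda>z. f 0 j z - q z j) \<le> ennreal (sqrt K * \<tau>)" "K \<ge> 0"
proof -
  have appr: "\<exists>V. approximate_solution T a b M \<tau> T1 V q qin \<and>
      (AE z\<in>cell T1 a b in lborel. \<bar>V 0 j z - f 0 j z\<bar> \<le> \<tau>)" if T1: "0 < T1" "T1 < T" for T1
  proof (rule smooth_approximation[OF T1 \<tau>(1)])
    fix V assume V: "smooth_family (b - a) V"
      "\<And>i j z. i + j \<le> 4 \<Longrightarrow> fst z \<in> {0..T1} \<Longrightarrow> \<bar>V i j z\<bar> \<le> M"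
      "\<And>j. j \<le> 3 \<Longrightarrow> AE z\<in>cell T1 a b in lborel. \<bar>V 0 j z - f 0 j z\<bar> \<le> \<tau>"
      "\<And>j. j \<le> 3 \<Longrightarrow> AE x\<in>{a<..<b} in lborel. \<bar>V 0 j (0, x) - g0 j x\<bar> \<le> \<tau>"
      "\<And>z. fst z \<in> {0..T1} \<Longrightarrow> \<bar>V 1 0 z + V 0 0 z * V 0 1 z + V 0 2 z + V 0 4 z\<bar> \<le> \<tau>"
    have qe: "ess_bounded {a<..<b} (\<lambda>x. qin x j)" if "j \<le> 3" for j
      using g0[OF that] by (simp add: qin[OF that] weak_deriv_space_def Linf_space_ess_bounded)
    have V4: "AE x\<in>{a<..<b} in lborel. \<bar>V 0 j (0, x) - qin x j\<bar> \<le> \<tau>" if "j \<le> 3" for j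
      using V(4)[OF that] by (simp only: qin[OF that])
    have "approximate_solution T a b M \<tau> T1 V q qin"
      by unfold_locales (fact T1 ab M \<tau> V V4 q qe)+
    then show ?thesis using V(3)[OF j] by blast
  qed
  have eb: "ess_bounded (cell T a b) (f 0 j)" using j by (intro f_ess_bounded) simp
  have s0: "s > 0" using \<tau> s by simp
  obtain V0 where "approximate_solution T a b M \<tau> (T / 2) V0 q qin" using appr[of "T / 2"] T by auto
  then have "approximate_solution.energy_const T a b M \<ge> 0" by (rule approximate_solution.consts_nonneg(4))
  then show K0: "K \<ge> 0" using ab by (simp add: K)
  define B where "B = sqrt K * \<tau> / sqrt s"
  have B0: "B \<ge> 0" using K0 \<tau> s0 by (simp add: B_def)
  have B2: "B\<^sup>2 = K * \<tau>\<^sup>2 / s" using K0 s0 by (simp add: B_def power_divide power_mult_distrib)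
  have qL: "(\<lambda>z. q z j) \<in> Linf T a b" "f 0 j \<in> Linf T a b"
    using q j f[of 0 j] by (auto simp: entropy_solution_def weak_deriv_def)
  have "Linf_L2_norm T a b (\<lambda>z. f 0 j z - q z j) \<le> ennreal B"
  proof (rule Linf_L2_norm_le[OF _ _ B0])
    have "ess_bounded ({0<..<T} \<times> UNIV) (\<lambda>z. f 0 j z - q z j)"
      using qL by (intro ess_bounded_diff) (auto simp: Linf_def ess_bounded_def)
    then show "set_borel_measurable lborel ({0<..<T} \<times> UNIV) (\<lambda>z. f 0 j z - q z j)"
      by (simp add: ess_bounded_def)
    show "ess_bounded (cell T a b) (\<lambda>z. f 0 j z - q z j)"
      using qL by (intro ess_bounded_diff Linf_ess_bounded)
    fix c d :: real assume cd: "0 < c" "c \<le> d" "d < T"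
    define T1 where "T1 = (d + T) / 2"
    have T1: "0 < T1" "T1 < T" "d < T1" using cd by (auto simp: T1_def)
    obtain V where V: "approximate_solution T a b M \<tau> T1 V q qin"
      "AE z\<in>cell T1 a b in lborel. \<bar>V 0 j z - f 0 j z\<bar> \<le> \<tau>"
      using appr[OF T1(1,2)] by blast
    have "s * (LINT z:{c<..<d} \<times> {a<..<b}|lborel. (f 0 j z - q z j)\<^sup>2) \<le> K * \<tau>\<^sup>2 * (d - c)"
      unfolding K by (rule approximate_solution.error_bound[OF V(1) cd(1,2) T1(3) j eb V(2) s])
    then show "(LINT z:{c<..<d} \<times> {a<..<b}|lborel. (f 0 j z - q z j)\<^sup>2) \<le> B\<^sup>2 * (d - c)"
      using s0 by (simp add: B2 field_simps)
  qed
  then have "ennreal (sqrt s) * Linf_L2_norm T a b (\<lambda>z. f 0 j z - q z j) \<le> ennreal (sqrt s) * ennreal B"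
    by (rule mult_left_mono) simp
  also have "\<dots> = ennreal (sqrt K * \<tau>)"
    using s0 B0 by (simp add: ennreal_mult[symmetric] B_def)
  finally show "ennreal (sqrt s) * Linf_L2_norm T a b (\<lambda>z. f 0 j z - q z j) \<le> ennreal (sqrt K * \<tau>)" .
qed

theorem theorem3p7:
  fixes T a b :: real and u :: "real \<times> real \<Rightarrow> real" and u0 :: "real \<Rightarrow> real"
  assumes "T > 0" and "a < b"
    and "u \<in> Winf T a b 4" and "KS_solution T a b u"
    and "u0 \<in> Winf_space a b 4" and "has_initial_value T u u0"
  shows "\<exists>C>0. \<exists>\<tau>0>0. \<forall>\<tau>\<in>{0<..\<tau>0}. \<forall>q.
    entropy_solution \<tau> T a b q
      (\<lambda>x. (!) [u0 x, D_space a b 1 u0 x, D_space a b 2 u0 x, D_space a b 3 u0 x]) \<longrightarrow>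
    Linf_L2_norm T a b (\<lambda>z. u z - q z 0) +
      (\<Sum>j=1..3. ennreal (sqrt \<tau>) * Linf_L2_norm T a b (\<lambda>z. D T a b 0 j u z - q z j))
    \<le> ennreal (C * \<tau>)"
proof -
  \<comment> \<open>In order zero \<open>u\<close> itself is taken: \<open>D\<close> would choose
    some representative of it, whereas the claim and the trace condition speak of
    \<open>u\<close>.\<close>
  define f where "f i j = (if i = 0 \<and> j = 0 then u else D T a b i j u)" for i j
  define g0 where "g0 j = (if j = 0 then u0 else D_space a b j u0)" for j
  have u: "u \<in> Linf T a b" using assms(3) by (simp add: Winf_def)
  have f: "weak_deriv T a b i j u (f i j)" if "i + j \<le> 4" for i j
  proof (cases "i = 0 \<and> j = 0")
    case True
    then show ?thesis using weak_deriv_self[OF u] by (simp add: f_def)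
  next
    case False
    have "\<exists>g. weak_deriv T a b i j u g" using assms(3) that by (simp add: Winf_def)
    then have "weak_deriv T a b i j u (D T a b i j u)" unfolding D_def by (rule someI_ex)
    then show ?thesis using False by (auto simp: f_def)
  qed
  have u0: "u0 \<in> Linf_space a b" using assms(5) by (simp add: Winf_space_def)
  have g0: "weak_deriv_space a b j u0 (g0 j)" if "j \<le> 3" for j
  proof (cases "j = 0")
    case True
    then show ?thesis using u0 by (simp add: g0_def weak_deriv_space_def)
  next
    case False
    have "\<exists>g. weak_deriv_space a b j u0 g" using assms(5) that by (simp add: Winf_space_def)
    then have "weak_deriv_space a b j u0 (D_space a b j u0)" unfolding D_space_def by (rule someI_ex)
    then show ?thesis using False by (simp add: g0_def)
  qed
  define B where "B i j = (SOME B. AE z\<in>cell T a b in lborel. \<bar>f i j z\<bar> \<le> B)" for i j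
  have B: "AE z\<in>cell T a b in lborel. \<bar>f i j z\<bar> \<le> B i j" if "i + j \<le> 4" for i j
  proof -
    have "\<exists>B. AE z\<in>cell T a b in lborel. \<bar>f i j z\<bar> \<le> B"
      using Linf_ess_bounded[of "f i j" T a b] f[OF that] unfolding weak_deriv_def ess_bounded_def by blast
    then show ?thesis unfolding B_def by (rule someI_ex)
  qed
  \<comment> \<open>One bound for all derivatives up to order four, fixed before
    \<open>\<tau>\<close> and \<open>q\<close> are introduced.\<close>
  define M where "M = (\<Sum>i\<le>4. \<Sum>j\<le>4. \<bar>B i j\<bar>)"
  have BM: "B i j \<le> M" if "i + j \<le> (4 :: nat)" for i j
  proof -
    have "B i j \<le> \<bar>B i j\<bar>" by simp
    also have "\<dots> \<le> (\<Sum>j\<le>4. \<bar>B i j\<bar>)" using that by (intro member_le_sum) auto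
    also have "\<dots> \<le> M" unfolding M_def using that by (intro member_le_sum[of i]) (auto intro!: sum_nonneg)
    finally show ?thesis .
  qed
  obtain w where w: "continuous_on ({0..<T} \<times> UNIV) w"
    "AE z\<in>{0<..<T} \<times> UNIV in lborel. w z = u z" "AE x in lborel. w (0, x) = u0 x"
    using assms(6) by (auto simp: has_initial_value_def)
  interpret ks T a b M u w u0 f g0
  proof
    show "M \<ge> 0" by (auto simp: M_def intro!: sum_nonneg)
    show "AE z\<in>cell T a b in lborel. \<bar>f i j z\<bar> \<le> M" if "i + j \<le> 4" for i j
      using B[OF that] by eventually_elim (use BM[OF that] in auto)
    show "AE z in lborel. z \<in> {0<..<T} \<times> UNIV \<longrightarrow>
      f 1 0 z + D T a b 0 1 (\<lambda>z. (u z)\<^sup>2 / 2) z + f 0 2 z + f 0 4 z = 0"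
      using assms(4) by (simp add: KS_solution_def f_def)
  qed (use assms u u0 f g0 w in \<open>auto simp: f_def\<close>)
  define K where "K = 2 * (1 + M)\<^sup>2 * (b - a) + 4 * approximate_solution.energy_const T a b M"
  \<comment> \<open>The factor 4 counts the components, and the summand 1 makes the constant
    positive. The absolute value of \<open>K\<close> gives a constant before any \<open>q\<close> is
    available; \<open>\<tau>0 = 1\<close> matches the assumption \<open>\<tau> \<le> 1\<close> of
    the estimates.\<close>
  show ?thesis
  proof (rule exI[of _ "4 * sqrt \<bar>K\<bar> + 1"], rule conjI[OF _ exI[of _ "1 :: real"]], goal_cases)
    case 1
    show ?case by (simp add: add_nonneg_pos)
  next
    case 2
    show ?case
    proof (intro conjI ballI allI impI)
      fix \<tau> q assume \<tau>: "\<tau> \<in> {0<..1 :: real}" and q: "entropy_solution \<tau> T a b q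
        (\<lambda>x. (!) [u0 x, D_space a b 1 u0 x, D_space a b 2 u0 x, D_space a b 3 u0 x])"
      define X where "X = sqrt \<bar>K\<bar> * \<tau>"
      have X0: "X \<ge> 0" using \<tau> by (simp add: X_def)
      have est: "ennreal (sqrt (if j = 0 then 1 else \<tau>)) * Linf_L2_norm T a b (\<lambda>z. f 0 j z - q z j) \<le> ennreal X"
        if j: "j \<le> 3" for j
      proof -
        have "[u0 x, D_space a b 1 u0 x, D_space a b 2 u0 x, D_space a b 3 u0 x] ! k = g0 k x" if "k \<le> 3" for k x
          using that by (auto simp: g0_def le_Suc_eq numeral_eq_Suc)
        then have "ennreal (sqrt (if j = 0 then 1 else \<tau>)) * Linf_L2_norm T a b (\<lambda>z. f 0 j z - q z j) \<le> ennreal (sqrt K * \<tau>)"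
          using \<tau> by (intro error_estimate(1)[OF _ _ q _ j refl K_def]) auto
        also have "\<dots> \<le> ennreal X"
          using \<tau> by (intro ennreal_leI) (auto simp: X_def intro!: mult_right_mono)
        finally show ?thesis .
      qed
      have "Linf_L2_norm T a b (\<lambda>z. u z - q z 0) \<le> ennreal X"
        using est[of 0] by (simp add: f_def)
      moreover have "(\<Sum>j=1..3. ennreal (sqrt \<tau>) * Linf_L2_norm T a b (\<lambda>z. D T a b 0 j u z - q z j)) \<le> (\<Sum>j=1..(3::nat). ennreal X)"
      proof (rule sum_mono)
        fix j :: nat assume "j \<in> {1..3}"
        then show "ennreal (sqrt \<tau>) * Linf_L2_norm T a b (\<lambda>z. D T a b 0 j u z - q z j) \<le> ennreal X"
          using est[of j] by (simp add: f_def)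
      qed
      ultimately have "Linf_L2_norm T a b (\<lambda>z. u z - q z 0) +
        (\<Sum>j=1..3. ennreal (sqrt \<tau>) * Linf_L2_norm T a b (\<lambda>z. D T a b 0 j u z - q z j)) \<le> ennreal X + (\<Sum>j=1..(3::nat). ennreal X)"
        by (rule add_mono)
      also have "\<dots> = ennreal (4 * X)"
      proof -
        have "(\<Sum>j=1..(3::nat). ennreal X) = ennreal (3 * X)"
          using X0 by (simp add: sum_ennreal del: sum_constant) simp
        then show ?thesis using ennreal_plus[of X "3 * X"] X0 by simp
      qed
      also have "\<dots> \<le> ennreal ((4 * sqrt \<bar>K\<bar> + 1) * \<tau>)"
        using \<tau> by (intro ennreal_leI) (simp add: X_def algebra_simps)
      finally show "Linf_L2_norm T a b (\<lambda>z. u z - q z 0) +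
        (\<Sum>j=1..3. ennreal (sqrt \<tau>) * Linf_L2_norm T a b (\<lambda>z. D T a b 0 j u z - q z j))
        \<le> ennreal ((4 * sqrt \<bar>K\<bar> + 1) * \<tau>)" .
    qed simp
  qed
qed

end
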